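(* Let $\overline{R}(u)$ be either of $R^+(u)$, $R^-(u)$ and let $(W,Y_W)$ be a $V(\overline{R})$-module. Then the operator series $$L(z)=Y_W(L^+(0)\mathbf{1},z)\in\mathrm{End}\,\mathbb{C}^N\otimes\mathrm{Hom}(W,W((z))_h)$$ satisfies the $RLL$-relation $$\overline{R}(u-v)\,L_1(u)\,L_2(v)=L_2(v)\,L_1(u)\,\overline{R}(-v+u).$$
   Context: Fix an integer $N\geq 2$ and a formal parameter $h$. A $\mathbb{C}[[h]]$-module $V$ is topologically free if $V\cong V_0[[h]]$ for some complex vector space $V_0$. For such $V$, $V((z))_h$ denotes the module of all $a(z)=\sum_{r\in\mathbb{Z}}a_rz^{-r-1}\in V[[z^{\pm1}]]$ with $a_r\to0$ as $r\to\infty$ $h$-adically; $V((u_1,\ldots,u_n))_h$ is the $h$-adic completion of $V((u_1,\ldots,u_n))$. Tensor products over $\mathbb{C}[[h]]$ are $h$-adically completed. Expansion convention: $(a_1u_1+\cdots+a_nu_n)^r$ with $r<0$, nonzero $a_i\in\mathbb{C}$, is expanded in nonnegative powers of $u_2,\ldots,u_n$ (the same if the last variable is replaced by $h$); so $\overline{R}(u-v)$ and $\overline{R}(-v+u)$ are expanded in nonnegative powers of $v$ and of $u$, respectively. $R$-matrices: $R(u)=I-Phu^{-1}$, with $I$ the identity and $P$ the permutation operator on $\mathbb{C}^N\otimes\mathbb{C}^N$; $R^{\pm}(u)=u(u\mp h)^{-1}R(u)\in\mathrm{End}\,\mathbb{C}^N\otimes\mathrm{End}\,\mathbb{C}^N[[h/u]]$;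 $\overline{R}(u)$ denotes either one of $R^{\pm}(u)$. Subscripts indicate tensor factors. Put $\overline{R}_{[n]}(u_1,\ldots,u_n)=\prod_{i=1,\ldots,n-1}^{\longrightarrow}\prod_{j=i+1,\ldots,n}^{\longrightarrow}\overline{R}_{ij}(u_i-u_j)$ (factors in increasing order of indices from left to right). For $u=(u_1,\ldots,u_n)$, $v=(v_1,\ldots,v_m)$ and $\overline{R}_{ij}=\overline{R}_{ij}(z+u_i-v_{j-n})$ put $\overline{R}_{nm}^{12}(z+u-v)=\prod_{i=1,\ldots,n}^{\longrightarrow}\prod_{j=n+1,\ldots,n+m}^{\longleftarrow}\overline{R}_{ij}$ and $\overline{R}_{nm}^{\bar1\bar2}(z+u-v)=\prod_{i=1,\ldots,n}^{\longleftarrow}\prod_{j=n+1,\ldots,n+m}^{\longrightarrow}\overline{R}_{ij}$ ($\longleftarrow$: decreasing order of the index from left to right). $A(\overline{R})$ is the topologically free associative algebra over $\mathbb{C}[[h]]$ generated by $l_{ij}^{(-r)}$, $r\ge1$, $i,j=1,\ldots,N$, subject to $\overline{R}(-u+v)L_1^+(u)L_2^+(v)=L_2^+(v)L_1^+(u)\overline{R}(u-v)$, where $L^+(u)=\sum_{i,j}e_{ij}\otimes l_{ij}^+(u)$, $l_{ij}^+(u)=\sum_{r\geq1}l_{ij}^{(-r)}u^{r-1}$, $e_{ij}$ matrix units; $L_k^+$ is the copy whose matrix part acts on the $k$-th factor. Let $L^+_{[n]}(u)=L^+_1(u_1)\cdots L^+_n(u_n)$. The quantum vertex algebra $V(\overline{R})$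 has underlying $\mathbb{C}[[h]]$-module $A(\overline{R})$, vacuum vector the unit $\mathbf{1}$, vertex operator map determined by $Y(L^+_{[n]}(u)\mathbf{1},z)=L_{[n]}(z+u)$, $n\ge1$, where $L_{[n]}(u)=\overline{R}_{[n]}(u_1,\ldots,u_n)L_1(u_1)\cdots L_n(u_n)$ and the operator series $L(u)$ on $A(\overline{R})$ is given by $$L_0(u)L_1^+(v_1)\cdots L_n^+(v_n)=\overline{R}_{0n}(u-v_n)^{-1}\cdots\overline{R}_{01}(u-v_1)^{-1}L_0^+(u)L_1^+(v_1)\cdots L_n^+(v_n),\quad n\ge0,$$ and braiding $\mathcal{S}(z)\big(L_{[n]}^{+13}(u)L_{[m]}^{+24}(v)(\mathbf{1}\otimes\mathbf{1})\big)=\overline{R}_{nm}^{\bar1\bar2}(z+u-v)L_{[n]}^{+13}(u)L_{[m]}^{+24}(v)\overline{R}_{nm}^{12}(z+u-v)^{-1}(\mathbf{1}\otimes\mathbf{1})$, superscripts $1,\dots,4$ referring to the factors of $(\mathrm{End}\,\mathbb{C}^N)^{\otimes n}\otimes(\mathrm{End}\,\mathbb{C}^N)^{\otimes m}\otimes V(\overline{R})^{\otimes2}$. Definition. For a quantum vertex algebra $(V,Y,\mathbf{1},\mathcal{S})$, a $V$-module is a pair $(W,Y_W)$, where $W$ is a topologically free $\mathbb{C}[[h]]$-module and $Y_W(z)\colon V\otimes W\to W((z))_h$, $v\otimes w\mapsto Y_W(v,z)w$, is a $\mathbb{C}[[h]]$-module map with $Y_W(\mathbf{1},z)w=w$ for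 all $w\in W$ and satisfying weak associativity: for any $u,v\in V$, $w\in W$, $k\in\mathbb{Z}_{\ge0}$ there is $r\in\mathbb{Z}_{\ge0}$ such that $(z_0+z_2)^rY_W(u,z_0+z_2)Y_W(v,z_2)w-(z_0+z_2)^rY_W(Y(u,z_0)v,z_2)w\in h^kW[[z_0^{\pm1},z_2^{\pm1}]]$. $Y_W(L^+(0)\mathbf{1},z)$ means that $Y_W(\cdot,z)$ is applied to the matrix entries $l_{ij}^{(-1)}$ of $L^+(0)$. *)

theory Defs
  imports
    "HOL-Analysis.Analysis"
    "HOL-Computational_Algebra.Formal_Power_Series"
    "HOL-Library.Poly_Mapping"
begin

section \<open>Modules over \<open>\<complex>[[h]]\<close>\<close>

text \<open>
  The ring \<open>\<complex>[[h]]\<close> is the type \<^typ>\<open>complex fps\<close>, with \<open>h\<close> being \<^term>\<open>fps_X :: complex fps\<close>; a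
  \<open>\<complex>[[h]]\<close>-module is a type with a scaling satisfying \<^const>\<open>module\<close>.  A complex space \<open>V0\<close> with
  \<open>V \<cong> V0[[h]]\<close> embeds into \<open>V\<close> as the constant series, so \<open>V0\<close> can be sought among the complex
  subspaces of \<open>V\<close>.
\<close>

definition topologically_free :: "(complex fps \<Rightarrow> 'v::ab_group_add \<Rightarrow> 'v) \<Rightarrow> bool" where
  "topologically_free scl \<longleftrightarrow> module scl \<and>
     (\<exists>V0 (\<phi> :: 'v \<Rightarrow> 'v fps).
        module.subspace (\<lambda>c::complex. scl (fps_const c)) V0 \<and>
        bij_betw \<phi> UNIV {f. \<forall>n. fps_nth f n \<in> V0} \<and>
        (\<forall>x y. \<phi> (x + y) = \<phi> x + \<phi> y) \<and>
        (\<forall>a x n. fps_nth (\<phi> (scl a x)) n = (\<Sum>i\<le>n. scl (fps_const (fps_nth a i)) (fps_nth (\<phi> x) (n - i)))))"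

definition hpow :: "(complex fps \<Rightarrow> 'v \<Rightarrow> 'v) \<Rightarrow> nat \<Rightarrow> 'v set" where
  "hpow scl k = range (scl (fps_X ^ k))"

text \<open>Unordered sums with respect to the \<open>h\<close>-adic topology.\<close>

definition has_hsum ::
  "(complex fps \<Rightarrow> 'v::ab_group_add \<Rightarrow> 'v) \<Rightarrow> 'i set \<Rightarrow> ('i \<Rightarrow> 'v) \<Rightarrow> 'v \<Rightarrow> bool" where
  "has_hsum scl I f s \<longleftrightarrow>
     (\<forall>k. \<exists>F. finite F \<and> F \<subseteq> I \<and> (\<forall>G. finite G \<and> F \<subseteq> G \<and> G \<subseteq> I \<longrightarrow> s - sum f G \<in> hpow scl k))"

definition hsum :: "(complex fps \<Rightarrow> 'v::ab_group_add \<Rightarrow> 'v) \<Rightarrow> 'i set \<Rightarrow> ('i \<Rightarrow> 'v) \<Rightarrow> 'v" where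
  "hsum scl I f = (THE s. has_hsum scl I f s)"

text \<open>
  A formal distribution \<open>a(z)\<close> in one variable is given by the function sending \<open>m\<close> to the
  coefficient of \<open>z\<^sup>m\<close> (so \<open>a\<^sub>r\<close> is the value at \<open>m = - r - 1\<close>).  The next predicate is membership in
  \<open>V((z))\<^sub>h\<close>.
\<close>

definition laurent_h :: "(complex fps \<Rightarrow> 'v \<Rightarrow> 'v) \<Rightarrow> (int \<Rightarrow> 'v) \<Rightarrow> bool" where
  "laurent_h scl a \<longleftrightarrow> (\<forall>k. \<exists>m0. \<forall>m\<le>m0. a m \<in> hpow scl k)"

definition operator_series ::
  "(complex fps \<Rightarrow> 'v::ab_group_add \<Rightarrow> 'v) \<Rightarrow> (complex fps \<Rightarrow> 'w::ab_group_add \<Rightarrow> 'w)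
     \<Rightarrow> (int \<Rightarrow> 'v \<Rightarrow> 'w) \<Rightarrow> bool" where
  "operator_series scl1 scl2 F \<longleftrightarrow>
     (\<forall>m. module_hom scl1 scl2 (F m)) \<and> (\<forall>v. laurent_h scl2 (\<lambda>m. F m v))"

definition hbilinear ::
  "(complex fps \<Rightarrow> 'u::ab_group_add \<Rightarrow> 'u) \<Rightarrow> (complex fps \<Rightarrow> 'v::ab_group_add \<Rightarrow> 'v)
     \<Rightarrow> (complex fps \<Rightarrow> 'w::ab_group_add \<Rightarrow> 'w) \<Rightarrow> ('u \<Rightarrow> 'v \<Rightarrow> 'w) \<Rightarrow> bool" where
  "hbilinear scl1 scl2 scl3 \<beta> \<longleftrightarrow>
     (\<forall>v. module_hom scl1 scl3 (\<lambda>u. \<beta> u v)) \<and> (\<forall>u. module_hom scl2 scl3 (\<beta> u))"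

text \<open>
  The \<open>h\<close>-adically completed tensor square, through its universal property.  Since
  \<open>U = U0[[h]]\<close> and \<open>U0\<close> is determined by its linear forms, it suffices to require the universal
  property for bilinear forms with values in \<open>\<complex>[[h]]\<close>.
\<close>

definition completed_tensor_square ::
  "(complex fps \<Rightarrow> 'v::ab_group_add \<Rightarrow> 'v) \<Rightarrow> (complex fps \<Rightarrow> 't::ab_group_add \<Rightarrow> 't)
     \<Rightarrow> ('v \<Rightarrow> 'v \<Rightarrow> 't) \<Rightarrow> bool" where
  "completed_tensor_square scl sclT tens \<longleftrightarrow>
     topologically_free sclT \<and> hbilinear scl scl sclT tens \<and>
     (\<forall>\<beta>. hbilinear scl scl (*) \<beta> \<longrightarrow>
        (\<exists>!f. module_hom sclT (*) f \<and> (\<forall>x y. f (tens x y) = \<beta> x y)))"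


section \<open>Formal series in several variables\<close>

text \<open>
  Variables are numbered by natural numbers, and a formal series with coefficients in \<open>'m\<close> is a
  function from exponent vectors to \<open>'m\<close>.
\<close>

type_synonym expo = "nat \<Rightarrow> int"
type_synonym 'm series = "expo \<Rightarrow> 'm"

definition in_vars :: "nat \<Rightarrow> expo \<Rightarrow> bool" where
  "in_vars n e \<longleftrightarrow> (\<forall>k\<ge>n. e k = 0)"

definition expo_of :: "int list \<Rightarrow> expo" where
  "expo_of ps = (\<lambda>k. if k < length ps then ps ! k else 0)"

text \<open>
  The list \<open>[(a\<^sub>1, x\<^sub>1), \<dots>, (a\<^sub>m, x\<^sub>m)]\<close>, with distinct variables, is the linear form
  \<open>a\<^sub>1 x\<^sub>1 + \<dots> + a\<^sub>m x\<^sub>m\<close>; the order matters, because \<open>lin_pow \<phi> r\<close> is the expansion of its \<open>r\<close>-th power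
  in nonnegative powers of \<open>x\<^sub>2, \<dots>, x\<^sub>m\<close>:
  the sum over \<open>s \<ge> 0\<close> of \<open>(r gchoose s) (a\<^sub>1 x\<^sub>1)\<^bsup>r - s\<^esup> (a\<^sub>2 x\<^sub>2 + \<dots> + a\<^sub>m x\<^sub>m)\<^sup>s\<close>.
\<close>

type_synonym linform = "(complex \<times> nat) list"

definition total_degree :: "linform \<Rightarrow> expo \<Rightarrow> int" where
  "total_degree \<phi> e = (\<Sum>(a, x)\<leftarrow>\<phi>. e x)"

definition lin_pow :: "linform \<Rightarrow> int \<Rightarrow> complex series" where
  "lin_pow \<phi> r e =
     (let s = (\<Sum>(a, x)\<leftarrow>tl \<phi>. nat (e x)) in
      if (\<forall>x. x \<notin> snd ` set \<phi> \<longrightarrow> e x = 0) \<and> (\<forall>x \<in> snd ` set (tl \<phi>). e x \<ge> 0) \<and>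
         total_degree \<phi> e = r
      then (of_int r gchoose s) * (fst (hd \<phi>)) powi (r - int s) *
           (fact s * (\<Prod>(a, x)\<leftarrow>tl \<phi>. a ^ nat (e x) / fact (nat (e x))))
      else 0)"

text \<open>
  \<open>subst_h_over f \<phi>\<close> is the series \<open>f(h/\<phi>)\<close>, for a power series \<open>f\<close> in one variable; the exponent
  vectors contributing to \<open>(h/\<phi>)\<^sup>k\<close> are those of total degree \<open>- k\<close>.
\<close>

definition subst_h_over :: "complex fps \<Rightarrow> linform \<Rightarrow> complex fps series" where
  "subst_h_over f \<phi> e =
     (let k = nat (- total_degree \<phi> e)
      in fps_const (fps_nth f k * lin_pow \<phi> (- int k) e) * fps_X ^ k)"

definition series_mult ::
  "(complex fps \<Rightarrow> 'm::ab_group_add \<Rightarrow> 'm) \<Rightarrow> complex fps series \<Rightarrow> 'm series \<Rightarrow> 'm series" where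
  "series_mult scl c X e = hsum scl UNIV (\<lambda>d. scl (c d) (X (\<lambda>k. e k - d k)))"


section \<open>Matrices on tensor powers of \<open>\<complex>\<^sup>N\<close>\<close>

text \<open>
  \<open>N = CARD('n)\<close>.  An element of \<open>(End \<complex>\<^sup>N)\<^bsup>\<otimes>n\<^esup>\<close> with coefficients in \<open>'m\<close> is given by its entries, the
  rows and columns being lists of length \<open>n\<close>.  Tensor factors are numbered from \<open>0\<close>.
\<close>

type_synonym ('n, 'm) tmat = "'n list \<Rightarrow> 'n list \<Rightarrow> 'm"

text \<open>
  Power series matrices in \<open>(End \<complex>\<^sup>N \<otimes> End \<complex>\<^sup>N)[[h/u]]\<close>: here \<^const>\<open>fps_X\<close> stands for \<open>h/u\<close>, so that
  \<open>u (u \<mp> h)\<^bsup>-1\<^esup>\<close> is \<^term>\<open>inverse (1 - fps_X)\<close> and \<^term>\<open>inverse (1 + fps_X)\<close>, respectively.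
\<close>

type_synonym 'n rmatrix = "complex fps ^ ('n \<times> 'n) ^ ('n \<times> 'n)"

definition R_mat :: "'n::finite rmatrix" where
  "R_mat = (\<chi> p q. (if p = q then 1 else 0) - (if p = prod.swap q then fps_X else 0))"

definition R_plus :: "'n::finite rmatrix" where
  "R_plus = (\<chi> p q. inverse (1 - fps_X) * R_mat $ p $ q)"

definition R_minus :: "'n::finite rmatrix" where
  "R_minus = (\<chi> p q. inverse (1 + fps_X) * R_mat $ p $ q)"

text \<open>The series \<open>M\<^sub>i\<^sub>j(\<phi>)\<close>, acting in the tensor factors \<open>i\<close> and \<open>j\<close>.\<close>

definition leg :: "'n::finite rmatrix \<Rightarrow> linform \<Rightarrow> nat \<Rightarrow> nat \<Rightarrow> ('n, complex fps series) tmat" where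
  "leg M \<phi> i j a b =
     (if \<forall>k < length a. k \<noteq> i \<and> k \<noteq> j \<longrightarrow> a ! k = b ! k
      then subst_h_over (M $ (a ! i, a ! j) $ (b ! i, b ! j)) \<phi> else (\<lambda>e. 0))"

text \<open>The products \<open>K X\<close> and \<open>X K\<close> of a scalar matrix series \<open>K\<close> and a module-valued one \<open>X\<close>.\<close>

definition lmult ::
  "(complex fps \<Rightarrow> 'm::ab_group_add \<Rightarrow> 'm) \<Rightarrow> nat \<Rightarrow> ('n::finite, complex fps series) tmat
     \<Rightarrow> ('n, 'm series) tmat \<Rightarrow> ('n, 'm series) tmat" where
  "lmult scl n K X a b e = (\<Sum>c | length c = n. series_mult scl (K a c) (X c b) e)"

definition rmult ::
  "(complex fps \<Rightarrow> 'm::ab_group_add \<Rightarrow> 'm) \<Rightarrow> nat \<Rightarrow> ('n, 'm series) tmat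
     \<Rightarrow> ('n::finite, complex fps series) tmat \<Rightarrow> ('n, 'm series) tmat" where
  "rmult scl n X K a b e = (\<Sum>c | length c = n. series_mult scl (K c b) (X a c) e)"


section \<open>The algebra \<open>A(R)\<close>\<close>

datatype 'x word = Word (letters: "'x list")

instantiation word :: (type) monoid_add
begin

definition zero_word :: "'x word" where "zero_word = Word []"

definition plus_word :: "'x word \<Rightarrow> 'x word \<Rightarrow> 'x word" where
  "plus_word v w = Word (letters v @ letters w)"

instance by standard (simp_all add: zero_word_def plus_word_def)

end

text \<open>
  The noncommutative polynomial ring \<open>\<complex>\<langle>X\<rangle>\<close> is the monoid algebra of the words in \<open>X\<close>, and
  \<open>\<complex>\<langle>X\<rangle>[[h]]\<close> is the topologically free associative algebra without relations.  The letter
  \<open>(i, j, m)\<close> is the generator \<open>l\<^sub>i\<^sub>j\<^bsup>(-m-1)\<^esup>\<close>, that is, the coefficient of \<open>u\<^sup>m\<close> in \<open>l\<^sub>i\<^sub>j\<^sup>+(u)\<close>.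
\<close>

type_synonym 'x free_alg = "('x word \<Rightarrow>\<^sub>0 complex) fps"
type_synonym 'n gen = "'n \<times> 'n \<times> nat"

definition free_scale :: "complex fps \<Rightarrow> 'x free_alg \<Rightarrow> 'x free_alg" where
  "free_scale c f = Abs_fps (\<lambda>n. Poly_Mapping.single 0 (fps_nth c n)) * f"

definition free_gen :: "'n \<Rightarrow> 'n \<Rightarrow> nat \<Rightarrow> 'n gen free_alg" where
  "free_gen i j m = fps_const (Poly_Mapping.single (Word [(i, j, m)]) 1)"

text \<open>Coefficients of \<open>l\<^sub>i\<^sub>j\<^sup>+(u)\<close> for a family \<open>l i j m = l\<^sub>i\<^sub>j\<^bsup>(-m-1)\<^esup>\<close>.\<close>

definition l_plus :: "('n \<Rightarrow> 'n \<Rightarrow> nat \<Rightarrow> 'v::zero) \<Rightarrow> 'n \<Rightarrow> 'n \<Rightarrow> int \<Rightarrow> 'v" where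
  "l_plus l i j p = (if p \<ge> 0 then l i j (nat p) else 0)"

text \<open>\<open>L\<^sub>1\<^sup>+(u\<^sub>1) \<cdots> L\<^sub>n\<^sup>+(u\<^sub>n)\<close>, where \<open>u\<^sub>1, \<dots>, u\<^sub>n\<close> are the variables \<open>0, \<dots>, n - 1\<close>.\<close>

definition L_plus_br ::
  "('n \<Rightarrow> 'n \<Rightarrow> nat \<Rightarrow> 'v::ring_1) \<Rightarrow> nat \<Rightarrow> ('n, 'v series) tmat" where
  "L_plus_br l n a b e = prod_list (map (\<lambda>k. l_plus l (a ! k) (b ! k) (e k)) [0..<n])"

text \<open>
  The difference of the two sides of \<open>R(-u+v) L\<^sub>1\<^sup>+(u) L\<^sub>2\<^sup>+(v) = L\<^sub>2\<^sup>+(v) L\<^sub>1\<^sup>+(u) R(u-v)\<close>, with \<open>u\<close> and \<open>v\<close>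
  the variables \<open>0\<close> and \<open>1\<close>.
\<close>

definition relator :: "'n::finite rmatrix \<Rightarrow> ('n, 'n gen free_alg series) tmat" where
  "relator Rb a b e =
     lmult free_scale 2 (leg Rb [(-1, 0), (1, 1)] 0 1) (L_plus_br free_gen 2) a b e -
     rmult free_scale 2
       (\<lambda>a b e. l_plus free_gen (a ! 1) (b ! 1) (e 1) * l_plus free_gen (a ! 0) (b ! 0) (e 0))
       (leg Rb [(1, 0), (-1, 1)] 0 1) a b e"

definition two_sided_ideal :: "'r::ring_1 set \<Rightarrow> bool" where
  "two_sided_ideal I \<longleftrightarrow>
     0 \<in> I \<and> (\<forall>x\<in>I. \<forall>y\<in>I. x + y \<in> I) \<and> (\<forall>x\<in>I. \<forall>r. r * x \<in> I \<and> x * r \<in> I)"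

text \<open>
  A quotient of \<open>\<complex>\<langle>X\<rangle>[[h]]\<close> by a two-sided ideal \<open>I\<close> is topologically free if and only if \<open>I\<close> is closed
  in the \<open>h\<close>-adic topology (which is the topology of the type \<open>fps\<close>) and the quotient has no
  \<open>h\<close>-torsion.  Hence the ideal of relations of the topologically free algebra defined by the
  relators is the smallest such ideal containing them.  It is strictly larger than the closed
  ideal generated by the relators, whose quotient has \<open>h\<close>-torsion.
\<close>

definition rel_ideal :: "'n::finite rmatrix \<Rightarrow> 'n gen free_alg set" where
  "rel_ideal Rb = \<Inter> {I. two_sided_ideal I \<and> closed I \<and> (\<forall>x. fps_X * x \<in> I \<longrightarrow> x \<in> I) \<and>
     (\<forall>a b p q. length a = 2 \<longrightarrow> length b = 2 \<longrightarrow> relator Rb a b (expo_of [p, q]) \<in> I)}"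

text \<open>The algebra \<open>(scl, l)\<close> is (isomorphic to) \<open>A(R)\<close>, with \<open>l i j m = l\<^sub>i\<^sub>j\<^bsup>(-m-1)\<^esup>\<close>.\<close>

definition is_A_Rbar ::
  "'n::finite rmatrix \<Rightarrow> (complex fps \<Rightarrow> 'v::ring_1 \<Rightarrow> 'v) \<Rightarrow> ('n \<Rightarrow> 'n \<Rightarrow> nat \<Rightarrow> 'v) \<Rightarrow> bool" where
  "is_A_Rbar Rb scl l \<longleftrightarrow>
     topologically_free scl \<and>
     (\<forall>c x y. scl c (x * y) = scl c x * y \<and> scl c (x * y) = x * scl c y) \<and>
     (\<exists>\<pi> :: 'n gen free_alg \<Rightarrow> 'v.
        (\<forall>x y. \<pi> (x + y) = \<pi> x + \<pi> y) \<and> (\<forall>x y. \<pi> (x * y) = \<pi> x * \<pi> y) \<and> \<pi> 1 = 1 \<and>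
        (\<forall>c x. \<pi> (free_scale c x) = scl c (\<pi> x)) \<and>
        surj \<pi> \<and> {x. \<pi> x = 0} = rel_ideal Rb \<and>
        (\<forall>i j m. \<pi> (free_gen i j m) = l i j m))"


section \<open>The quantum vertex algebra \<open>V(R)\<close>\<close>

text \<open>
  \<open>L i j m v\<close> is the coefficient of \<open>u\<^sup>m\<close> in \<open>l\<^sub>i\<^sub>j(u) v\<close>.  In the defining formula \<open>u\<close> is the variable \<open>0\<close>
  and \<open>v\<^sub>1, \<dots>, v\<^sub>n\<close> are the variables \<open>1, \<dots>, n\<close>, numbered in the same way as the tensor factors.
\<close>

definition is_L_operator ::
  "'n::finite rmatrix \<Rightarrow> (complex fps \<Rightarrow> 'v::ring_1 \<Rightarrow> 'v) \<Rightarrow> ('n \<Rightarrow> 'n \<Rightarrow> nat \<Rightarrow> 'v)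
     \<Rightarrow> ('n \<Rightarrow> 'n \<Rightarrow> int \<Rightarrow> 'v \<Rightarrow> 'v) \<Rightarrow> bool" where
  "is_L_operator Rb scl l L \<longleftrightarrow>
     (\<forall>i j. operator_series scl scl (L i j)) \<and>
     (\<forall>n a b e. length a = Suc n \<longrightarrow> length b = Suc n \<longrightarrow> in_vars (Suc n) e \<longrightarrow>
        L (hd a) (hd b) (e 0) (L_plus_br l n (tl a) (tl b) (\<lambda>k. e (Suc k))) =
        foldr (\<lambda>k. lmult scl (Suc n) (leg (matrix_inv Rb) [(1, 0), (-1, k)] 0 k))
          (rev [1..<Suc n]) (L_plus_br l (Suc n)) a b e)"

text \<open>\<open>L\<^bsub>[n]\<^esub>(u) v = R\<^bsub>[n]\<^esub>(u\<^sub>1, \<dots>, u\<^sub>n) L\<^sub>1(u\<^sub>1) \<cdots> L\<^sub>n(u\<^sub>n) v\<close>\<close>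

definition L_br ::
  "'n::finite rmatrix \<Rightarrow> (complex fps \<Rightarrow> 'v::ring_1 \<Rightarrow> 'v) \<Rightarrow> ('n \<Rightarrow> 'n \<Rightarrow> int \<Rightarrow> 'v \<Rightarrow> 'v)
     \<Rightarrow> nat \<Rightarrow> 'v \<Rightarrow> ('n, 'v series) tmat" where
  "L_br Rb scl L n v =
     foldr (\<lambda>(i, j). lmult scl n (leg Rb [(1, i), (-1, j)] i j))
       [(i, j). i \<leftarrow> [0..<n], j \<leftarrow> [Suc i..<n]]
       (\<lambda>a b e. foldr (\<lambda>k. L (a ! k) (b ! k) (e k)) [0..<n] v)"

text \<open>
  The last clause compares the coefficients of \<open>z\<^sup>m u\<^sub>1\<^bsup>e 0\<^esup> \<cdots> u\<^sub>n\<^bsup>e (n-1)\<^esup>\<close> on the two sides of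
  \<open>Y(L\<^sup>+\<^bsub>[n]\<^esub>(u)1, z) v = L\<^bsub>[n]\<^esub>(z + u) v\<close>: first \<open>L\<^bsub>[n]\<^esub>(x\<^sub>1, \<dots>, x\<^sub>n) v\<close> is formed as an element of
  \<open>V((x\<^sub>1, \<dots>, x\<^sub>n))\<^sub>h\<close>, and then \<open>x\<^sub>k = z + u\<^sub>k\<close> is substituted and expanded in nonnegative powers of
  \<open>u\<^sub>k\<close>.
\<close>

definition is_vertex_map ::
  "'n::finite rmatrix \<Rightarrow> (complex fps \<Rightarrow> 'v::ring_1 \<Rightarrow> 'v) \<Rightarrow> ('n \<Rightarrow> 'n \<Rightarrow> nat \<Rightarrow> 'v)
     \<Rightarrow> ('n \<Rightarrow> 'n \<Rightarrow> int \<Rightarrow> 'v \<Rightarrow> 'v) \<Rightarrow> ('v \<Rightarrow> 'v \<Rightarrow> int \<Rightarrow> 'v) \<Rightarrow> bool" where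
  "is_vertex_map Rb scl l L Y \<longleftrightarrow>
     (\<forall>m. hbilinear scl scl scl (\<lambda>x y. Y x y m)) \<and> (\<forall>x y. laurent_h scl (Y x y)) \<and>
     (\<forall>v m. Y 1 v m = (if m = 0 then v else 0)) \<and>
     (\<forall>n\<ge>1. \<forall>a b v m (e :: nat \<Rightarrow> nat). length a = n \<longrightarrow> length b = n \<longrightarrow>
        Y (L_plus_br l n a b (\<lambda>k. int (e k))) v m =
        hsum scl {f. in_vars n f \<and> (\<Sum>k<n. f k - int (e k)) = m}
          (\<lambda>f. scl (fps_const (\<Prod>k<n. of_int (f k) gchoose e k)) (L_br Rb scl L n v a b f)))"

text \<open>
  The tensor factors and the variables \<open>u\<^sub>1, \<dots>, u\<^sub>n, v\<^sub>1, \<dots>, v\<^sub>m\<close> have the numbers \<open>0, \<dots>, n + m - 1\<close>,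
  and \<open>z\<close> is the variable \<open>n + m\<close>.  The inner \<open>foldr\<close> multiplies on the right by the inverse
  \<open>F\<^sub>q\<^bsup>-1\<^esup> \<cdots> F\<^sub>1\<^bsup>-1\<^esup>\<close> of \<open>R\<^sub>n\<^sub>m\<^bsup>12\<^esup> = F\<^sub>1 \<cdots> F\<^sub>q\<close>, the outer one on the left by the product with both orders
  reversed.
\<close>

definition is_braiding ::
  "'n::finite rmatrix \<Rightarrow> ('n \<Rightarrow> 'n \<Rightarrow> nat \<Rightarrow> 'v::ring_1) \<Rightarrow> (complex fps \<Rightarrow> 't::ab_group_add \<Rightarrow> 't)
     \<Rightarrow> ('v \<Rightarrow> 'v \<Rightarrow> 't) \<Rightarrow> ('t \<Rightarrow> int \<Rightarrow> 't) \<Rightarrow> bool" where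
  "is_braiding Rb l sclT tens S \<longleftrightarrow>
     operator_series sclT sclT (\<lambda>m t. S t m) \<and>
     (\<forall>n m a b e. length a = n + m \<longrightarrow> length b = n + m \<longrightarrow> in_vars (Suc (n + m)) e \<longrightarrow>
        (let X = (\<lambda>a b e. tens (L_plus_br l n (take n a) (take n b) e)
                               (L_plus_br l m (drop n a) (drop n b) (\<lambda>k. e (n + k))));
             \<phi> = (\<lambda>i j. [(1, n + m), (1, i), (-1, j)])
         in S (X a b e) (e (n + m)) =
            foldr (\<lambda>(i, j). lmult sclT (n + m) (leg Rb (\<phi> i j) i j))
              [(i, j). i \<leftarrow> rev [0..<n], j \<leftarrow> [n..<n + m]]
              (foldr (\<lambda>(i, j) Z. rmult sclT (n + m) Z (leg (matrix_inv Rb) (\<phi> i j) i j))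
                [(i, j). i \<leftarrow> [0..<n], j \<leftarrow> rev [n..<n + m]]
                (\<lambda>a b e. if e (n + m) = 0 then X a b e else 0)) a b e))"

text \<open>The data \<open>(V, Y, 1, S)\<close> of a quantum vertex algebra; \<open>'t\<close> is the completed tensor square of \<open>'v\<close>.\<close>

record ('v, 't) qva_data =
  scale :: "complex fps \<Rightarrow> 'v \<Rightarrow> 'v"
  vertex :: "'v \<Rightarrow> 'v \<Rightarrow> int \<Rightarrow> 'v"
  vacuum :: 'v
  scale_tensor :: "complex fps \<Rightarrow> 't \<Rightarrow> 't"
  tensor :: "'v \<Rightarrow> 'v \<Rightarrow> 't"
  braiding :: "'t \<Rightarrow> int \<Rightarrow> 't"

definition is_V_Rbar ::
  "'n::finite rmatrix \<Rightarrow> ('v::ring_1, 't::ab_group_add) qva_data \<Rightarrow> ('n \<Rightarrow> 'n \<Rightarrow> nat \<Rightarrow> 'v) \<Rightarrow> bool" where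
  "is_V_Rbar Rb V l \<longleftrightarrow>
     is_A_Rbar Rb (scale V) l \<and>
     vacuum V = 1 \<and>
     (\<exists>L. is_L_operator Rb (scale V) l L \<and> is_vertex_map Rb (scale V) l L (vertex V)) \<and>
     completed_tensor_square (scale V) (scale_tensor V) (tensor V) \<and>
     is_braiding Rb l (scale_tensor V) (tensor V) (braiding V)"


section \<open>Modules over a quantum vertex algebra\<close>

text \<open>
  A \<open>\<complex>[[h]]\<close>-module map on \<open>V \<otimes> W\<close> is given by the corresponding bilinear map: \<open>YW v w m\<close> is the
  coefficient of \<open>z\<^sup>m\<close> in \<open>Y\<^sub>W(v, z) w\<close>.  In weak associativity \<open>z\<^sub>0\<close> and \<open>z\<^sub>2\<close> are the variables \<open>0\<close> and \<open>1\<close>,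
  and \<open>YW_shift_comp\<close> is \<open>Y\<^sub>W(u, z\<^sub>0 + z\<^sub>2) Y\<^sub>W(v, z\<^sub>2) w\<close>.
\<close>

definition YW_shift_comp ::
  "(complex fps \<Rightarrow> 'w::ab_group_add \<Rightarrow> 'w) \<Rightarrow> ('v \<Rightarrow> 'w \<Rightarrow> int \<Rightarrow> 'w)
     \<Rightarrow> 'v \<Rightarrow> 'v \<Rightarrow> 'w \<Rightarrow> 'w series" where
  "YW_shift_comp sclW YW u v w e =
     hsum sclW UNIV (\<lambda>(m, p).
       sclW (fps_const (lin_pow [(1, 0), (1, 1)] m (e(1 := e 1 - p)))) (YW u (YW v w p) m))"

definition weak_associativity ::
  "('v \<Rightarrow> 'v \<Rightarrow> int \<Rightarrow> 'v) \<Rightarrow> (complex fps \<Rightarrow> 'w::ab_group_add \<Rightarrow> 'w)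
     \<Rightarrow> ('v \<Rightarrow> 'w \<Rightarrow> int \<Rightarrow> 'w) \<Rightarrow> bool" where
  "weak_associativity Y sclW YW \<longleftrightarrow>
     (\<forall>u v w k. \<exists>r::nat. \<forall>p q.
        let P = (\<lambda>d. fps_const (lin_pow [(1, 0), (1, 1)] (int r) d))
        in series_mult sclW P (YW_shift_comp sclW YW u v w) (expo_of [p, q]) -
           series_mult sclW P (\<lambda>e. YW (Y u v (e 0)) w (e 1)) (expo_of [p, q]) \<in> hpow sclW k)"

definition qva_module ::
  "('v::ab_group_add, 't) qva_data \<Rightarrow> (complex fps \<Rightarrow> 'w::ab_group_add \<Rightarrow> 'w)
     \<Rightarrow> ('v \<Rightarrow> 'w \<Rightarrow> int \<Rightarrow> 'w) \<Rightarrow> bool" where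
  "qva_module V sclW YW \<longleftrightarrow>
     topologically_free sclW \<and>
     (\<forall>m. hbilinear (scale V) sclW sclW (\<lambda>v w. YW v w m)) \<and>
     (\<forall>v w. laurent_h sclW (YW v w)) \<and>
     (\<forall>w m. YW (vacuum V) w m = (if m = 0 then w else 0)) \<and>
     weak_associativity (vertex V) sclW YW"

text \<open>
  \<open>R(u-v) L\<^sub>1(u) L\<^sub>2(v) = L\<^sub>2(v) L\<^sub>1(u) R(-v+u)\<close>, applied to vectors of \<open>W\<close>, with \<open>u\<close> and \<open>v\<close> the variables
  \<open>0\<close> and \<open>1\<close>.  The sums converge: modulo \<open>h\<^sup>k\<close> the exponents of \<open>v\<close> in \<open>L\<^sub>2(v) w\<close> and those of \<open>u\<close>
  in \<open>L\<^sub>1(u) w\<close> are bounded below, and the two expansions have nonnegative powers of the same variable.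
\<close>

definition RLL_relation ::
  "'n::finite rmatrix \<Rightarrow> (complex fps \<Rightarrow> 'w::ab_group_add \<Rightarrow> 'w)
     \<Rightarrow> ('n \<Rightarrow> 'n \<Rightarrow> int \<Rightarrow> 'w \<Rightarrow> 'w) \<Rightarrow> bool" where
  "RLL_relation Rb sclW L \<longleftrightarrow>
     (\<forall>w a b p q. length a = 2 \<longrightarrow> length b = 2 \<longrightarrow>
        lmult sclW 2 (leg Rb [(1, 0), (-1, 1)] 0 1)
          (\<lambda>a b e. L (a ! 0) (b ! 0) (e 0) (L (a ! 1) (b ! 1) (e 1) w)) a b (expo_of [p, q]) =
        rmult sclW 2
          (\<lambda>a b e. L (a ! 1) (b ! 1) (e 1) (L (a ! 0) (b ! 0) (e 0) w))
          (leg Rb [(-1, 1), (1, 0)] 0 1) a b (expo_of [p, q]))"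

end

theory Submission
  imports Defs
begin

text \<open>
  Let \<open>w \<in> W\<close>.  Identities in \<open>W\<close> are tested by complex linear forms on \<open>W\<close> that vanish on \<open>h\<^sup>k W\<close>.  These
  forms, for all \<open>k\<close>, separate the points of a topologically free module, and they turn an \<open>h\<close>-adically
  convergent sum into a finite sum of complex numbers (\<open>hfunctionals_separate\<close>, \<open>hfunctional_hsum\<close>).  So
  everything below happens for complex coefficients, modulo a fixed power of \<open>h\<close>.

  Put \<open>\<Phi>(x\<^sub>1, x\<^sub>2; z) = Y\<^sub>W(L\<^sub>1\<^sup>+(x\<^sub>1) L\<^sub>2\<^sup>+(x\<^sub>2) 1, z) w\<close>, a power series in \<open>x\<^sub>1\<close> and \<open>x\<^sub>2\<close>, and let \<open>X(z\<^sub>1, z\<^sub>2)\<close> and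
  \<open>Y(z\<^sub>1, z\<^sub>2)\<close> be the two sides of the \<open>RLL\<close>-relation applied to \<open>w\<close>.  Heuristically both are
  \<open>\<Phi>(z\<^sub>1, z\<^sub>2; 0)\<close>; the proof makes sense of this as follows.

  The formula defining \<open>L(z)\<close> gives \<open>R(z) Y(L\<^sub>1\<^sup>+(0) 1, z) L\<^sub>2\<^sup>+(0) 1 = L\<^sub>1\<^sup>+(z) L\<^sub>2\<^sup>+(0) 1\<close>, so weak associativity
  says that \<open>X(z\<^sub>0 + z\<^sub>2, z\<^sub>2)\<close> and \<open>\<Phi>(z\<^sub>0, 0; z\<^sub>2)\<close> agree after multiplication by some \<open>(z\<^sub>0 + z\<^sub>2)\<^sup>r\<close>.  Now
  \<open>\<Phi>(z\<^sub>0, 0; z\<^sub>2)\<close> has no negative powers of \<open>z\<^sub>0\<close>.  Hence \<open>X\<close> has no pole along \<open>z\<^sub>1 = z\<^sub>2\<close>: the exponents of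
  both variables in \<open>X\<close> are bounded below, and \<open>\<Phi>(z\<^sub>0, 0; z\<^sub>2)\<close> is exactly the Taylor expansion of \<open>X\<close>
  along the diagonal, in nonnegative powers of \<open>z\<^sub>0 = z\<^sub>1 - z\<^sub>2\<close> (\<open>expansion_around_diagonal\<close>).  In the same
  way the defining relation of \<open>A(R)\<close> and unitarity \<open>R(z) R(-z) = 1\<close> give
  \<open>(Y(L\<^sub>2\<^sup>+(0) 1, z) L\<^sub>1\<^sup>+(0) 1) R(-z) = L\<^sub>1\<^sup>+(0) L\<^sub>2\<^sup>+(z) 1\<close>, so the Taylor expansion of \<open>Y\<close> along the diagonal
  is \<open>\<Phi>(0, z\<^sub>0; z\<^sub>1)\<close> with \<open>z\<^sub>0 = z\<^sub>2 - z\<^sub>1\<close>.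

  Weak associativity for a vector and the vacuum yields the translation covariance
  \<open>\<Phi>(x\<^sub>1 + y, x\<^sub>2 + y; z) = \<Phi>(x\<^sub>1, x\<^sub>2; z + y)\<close> (\<open>translation\<close>).  Thus \<open>\<Phi>(0, y; z) = \<Phi>(-y, 0; z + y)\<close>, which says
  that \<open>X\<close> and \<open>Y\<close> have the same Taylor expansion along the diagonal.  In every total degree both are
  Laurent polynomials in \<open>z\<^sub>1 / z\<^sub>2\<close>, and a Laurent polynomial is determined by its Taylor coefficients at \<open>1\<close>,
  so \<open>X = Y\<close> (\<open>equal_by_expansion_around_diagonal\<close>).
\<close>

section \<open>Substitutions in formal series of two variables\<close>

text \<open>
  Functions \<open>int \<Rightarrow> int \<Rightarrow> complex\<close> are formal series in two variables, given by their coefficients.  The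
  three operations below are \<open>(z\<^sub>0 + z\<^sub>2) D(z\<^sub>0, z\<^sub>2)\<close>, then \<open>X(z\<^sub>0 + z\<^sub>2, z\<^sub>2)\<close> and \<open>(z\<^sub>1 - z\<^sub>2)\<^bsup>-j\<^esup> X(z\<^sub>1, z\<^sub>2)\<close>,
  the last two expanded in nonnegative powers of \<open>z\<^sub>2\<close>.  The expansions are meant for series \<open>X\<close> in which
  the exponents of \<open>z\<^sub>2\<close> are at least \<open>M\<close>, and then only \<open>s \<le> q - M\<close> contributes to the coefficient of
  \<open>z\<^sub>2\<^sup>q\<close>.
\<close>

definition mult_by_sum :: "(int \<Rightarrow> int \<Rightarrow> complex) \<Rightarrow> int \<Rightarrow> int \<Rightarrow> complex" where
  "mult_by_sum D p q = D (p - 1) q + D p (q - 1)"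

definition subst_sum :: "int \<Rightarrow> (int \<Rightarrow> int \<Rightarrow> complex) \<Rightarrow> int \<Rightarrow> int \<Rightarrow> complex" where
  "subst_sum M X p q =
     (\<Sum>s<nat (q - M + 1). (of_int (p + int s) gchoose s) * X (p + int s) (q - int s))"

definition diff_pow :: "int \<Rightarrow> nat \<Rightarrow> (int \<Rightarrow> int \<Rightarrow> complex) \<Rightarrow> int \<Rightarrow> int \<Rightarrow> complex" where
  "diff_pow M j X p q =
     (\<Sum>s<nat (q - M + 1). (- 1) ^ s * (- of_nat j gchoose s) * X (p + int j + int s) (q - int s))"

lemma mult_by_sum_power:
  "(mult_by_sum ^^ r) D p q = (\<Sum>i\<le>r. of_nat (r choose i) * D (p - int r + int i) (q - int i))"
proof (induction r arbitrary: p q)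
  case (Suc r)
  have "(mult_by_sum ^^ Suc r) D p q =
      (\<Sum>i\<le>r. of_nat (r choose i) * D (p - 1 - int r + int i) (q - int i)) +
      (\<Sum>i\<le>r. of_nat (r choose i) * D (p - int r + int i) (q - 1 - int i))"
    by (simp add: mult_by_sum_def Suc)
  also have "(\<Sum>i\<le>r. of_nat (r choose i) * D (p - 1 - int r + int i) (q - int i)) =
      (\<Sum>i\<le>Suc r. of_nat (r choose i) * D (p - int (Suc r) + int i) (q - int i))"
    by (simp add: algebra_simps)
  also have "\<dots> = D (p - int (Suc r)) q +
      (\<Sum>i\<le>r. of_nat (r choose Suc i) * D (p - int r + int i) (q - 1 - int i))"
    by (subst sum.atMost_Suc_shift) (simp add: algebra_simps)
  also have "\<dots> + (\<Sum>i\<le>r. of_nat (r choose i) * D (p - int r + int i) (q - 1 - int i)) =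
      D (p - int (Suc r)) q +
      (\<Sum>i\<le>r. of_nat (Suc r choose Suc i) * D (p - int r + int i) (q - 1 - int i))"
    by (simp add: distrib_right sum.distrib)
  also have "\<dots> = (\<Sum>i\<le>Suc r. of_nat (Suc r choose i) * D (p - int (Suc r) + int i) (q - int i))"
    by (subst sum.atMost_Suc_shift) (simp add: algebra_simps del: binomial_Suc_Suc)
  finally show ?case .
qed simp

lemma mult_by_sum_power_combination:
  "(mult_by_sum ^^ r) (\<lambda>p q. \<Sum>c\<in>A. \<Sum>j<k. \<kappa> c j * F c j (p + int j) q) =
    (\<lambda>p q. \<Sum>c\<in>A. \<Sum>j<k. \<kappa> c j * (mult_by_sum ^^ r) (F c j) (p + int j) q)"
proof (induction r)
  case (Suc r)
  have step: "(mult_by_sum ^^ Suc r) D p q = (mult_by_sum ^^ r) D (p - 1) q + (mult_by_sum ^^ r) D p (q - 1)"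
    for D p q by (simp add: mult_by_sum_def)
  have shift: "p - 1 + int j = p + int j - 1" for p j by simp
  show ?case
    by (intro ext) (simp only: step Suc shift distrib_left sum.distrib)
qed simp

lemma subst_sum_sum:
  "subst_sum M (\<lambda>m n. \<Sum>c\<in>A. F c m n) p q = (\<Sum>c\<in>A. subst_sum M (F c) p q)"
  unfolding subst_sum_def sum_distrib_left by (rule sum.swap)

lemma subst_sum_scale: "subst_sum M (\<lambda>m n. r * F m n) p q = r * subst_sum M F p q"
  by (simp add: subst_sum_def sum_distrib_left mult_ac)

lemma diff_pow_vanish:
  assumes "q < M" shows "diff_pow M j X p q = 0"
  using assms by (simp add: diff_pow_def)

text \<open>
  Composing \<open>diff_pow\<close> with another expansion convolves the coefficients of the two expansions; by the
  Vandermonde identity below the result is again a single expansion.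
\<close>

lemma diff_pow_conv:
  assumes conv: "\<And>n. (\<Sum>s\<le>n. \<alpha> s * ((- 1) ^ (n - s) * (- of_nat j gchoose (n - s)))) = \<gamma> n"
  shows "(\<Sum>s<nat (q - M + 1). \<alpha> s * diff_pow M j G (p + int s) (q - int s)) =
    (\<Sum>n<nat (q - M + 1). \<gamma> n * G (p + int j + int n) (q - int n))"
proof -
  define N where "N = nat (q - M + 1)"
  have N: "nat (q - int s - M + 1) = N - s" for s by (auto simp: N_def)
  have "(\<Sum>s<N. \<alpha> s * diff_pow M j G (p + int s) (q - int s)) =
      (\<Sum>s<N. \<Sum>t<N - s. \<alpha> s * ((- 1) ^ t * (- of_nat j gchoose t)) *
         G (p + int j + int (s + t)) (q - int (s + t)))"
    unfolding diff_pow_def N by (simp add: sum_distrib_left mult.assoc algebra_simps)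
  also have "\<dots> = (\<Sum>(s, t)\<in>{(s, t). s + t < N}. \<alpha> s * ((- 1) ^ t * (- of_nat j gchoose t)) *
         G (p + int j + int (s + t)) (q - int (s + t)))"
    by (subst sum.Sigma) (auto intro!: sum.cong)
  also have "\<dots> = (\<Sum>n<N. \<Sum>s\<le>n. \<alpha> s * ((- 1) ^ (n - s) * (- of_nat j gchoose (n - s))) *
         G (p + int j + int (s + (n - s))) (q - int (s + (n - s))))"
    by (rule sum.triangle_reindex)
  also have "\<dots> = (\<Sum>n<N. (\<Sum>s\<le>n. \<alpha> s * ((- 1) ^ (n - s) * (- of_nat j gchoose (n - s)))) *
         G (p + int j + int n) (q - int n))"
    by (simp add: sum_distrib_right)
  finally show ?thesis unfolding conv N_def .
qed

lemma signed_Vandermonde: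
  "(\<Sum>s\<le>n. ((- 1) ^ s * (x gchoose s)) * ((- 1) ^ (n - s) * (y gchoose (n - s)))) =
    (- 1) ^ n * (x + y gchoose n :: complex)"
proof -
  have "((- 1) ^ s * (x gchoose s)) * ((- 1) ^ (n - s) * (y gchoose (n - s))) =
      (- 1) ^ n * ((x gchoose s) * (y gchoose (n - s)))" if "s \<le> n" for s
  proof -
    have "(- 1) ^ s * (- 1) ^ (n - s) = ((- 1) ^ n :: complex)"
      using that by (simp flip: power_add)
    then show ?thesis by (metis (no_types, lifting) mult.assoc mult.left_commute)
  qed
  then have "(\<Sum>s\<le>n. ((- 1) ^ s * (x gchoose s)) * ((- 1) ^ (n - s) * (y gchoose (n - s)))) =
      (\<Sum>s\<le>n. (- 1) ^ n * ((x gchoose s) * (y gchoose (n - s))))"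
    by (intro sum.cong) auto
  then show ?thesis
    by (simp only: sum_distrib_left[symmetric] atMost_atLeast0 gbinomial_Vandermonde)
qed

lemma diff_pow_diff_pow: "diff_pow M i (diff_pow M j G) = diff_pow M (i + j) G"
proof (intro ext)
  fix p q
  have "diff_pow M i (diff_pow M j G) p q = (\<Sum>s<nat (q - M + 1). ((- 1) ^ s * (- of_nat i gchoose s)) *
      diff_pow M j G (p + int i + int s) (q - int s))"
    by (simp add: diff_pow_def[of M i])
  also have "\<dots> = (\<Sum>n<nat (q - M + 1). ((- 1) ^ n * (- of_nat i + - of_nat j gchoose n)) *
      G (p + int i + int j + int n) (q - int n))"
    by (rule diff_pow_conv, rule signed_Vandermonde)
  finally show "diff_pow M i (diff_pow M j G) p q = diff_pow M (i + j) G p q"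
    by (simp add: diff_pow_def[of M "i + j"] algebra_simps)
qed

text \<open>
  After \<open>z\<^sub>1 = z\<^sub>0 + z\<^sub>2\<close> the factor \<open>(z\<^sub>1 - z\<^sub>2)\<^bsup>-j\<^esup>\<close> becomes \<open>z\<^sub>0\<^bsup>-j\<^esup>\<close>, which only moves the exponent.
\<close>

lemma subst_sum_diff_pow:
  "subst_sum M (diff_pow M j G) p q = subst_sum M G (p + int j) q"
proof -
  have neg: "(of_int (x + int s) gchoose s :: complex) = (- 1) ^ s * (- of_int x - 1 gchoose s)" for x s
    by (subst gbinomial_negated_upper) (simp add: algebra_simps)
  have "subst_sum M (diff_pow M j G) p q = (\<Sum>s<nat (q - M + 1). ((- 1) ^ s * (- of_int p - 1 gchoose s)) *
      diff_pow M j G (p + int s) (q - int s))"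
    by (simp add: subst_sum_def neg del: of_int_add)
  also have "\<dots> = (\<Sum>n<nat (q - M + 1). ((- 1) ^ n * (- of_int p - 1 + - of_nat j gchoose n)) *
      G (p + int j + int n) (q - int n))"
    by (rule diff_pow_conv, rule signed_Vandermonde)
  finally show ?thesis
    unfolding subst_sum_def neg by (simp add: algebra_simps)
qed

lemma diff_pow_lowest: "diff_pow q j G p q = G (p + int j) q"
  by (simp add: diff_pow_def)

lemma diff_pow_0:
  assumes "q < M \<Longrightarrow> G p q = 0" shows "diff_pow M 0 G p q = G p q"
proof (cases "q < M")
  case False
  then have "diff_pow M 0 G p q = (\<Sum>s<nat (q - M + 1). if s = 0 then G p q else 0)"
    unfolding diff_pow_def by (intro sum.cong) (auto simp: gbinomial_0_left)
  with False show ?thesis by simp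
qed (use assms in \<open>simp add: diff_pow_def\<close>)

lemma diff_pow_sum: "diff_pow M j (\<lambda>m n. \<Sum>c\<in>A. F c m n) p q = (\<Sum>c\<in>A. diff_pow M j (F c) p q)"
  unfolding diff_pow_def sum_distrib_left by (rule sum.swap)

lemma diff_pow_scale: "diff_pow M j (\<lambda>m n. r * F m n) p q = r * diff_pow M j F p q"
  by (simp add: diff_pow_def sum_distrib_left mult_ac)

lemma subst_sum_mult_fst:
  "subst_sum M (\<lambda>p q. X (p - 1) q) = mult_by_sum (subst_sum M X)"
proof (intro ext)
  fix p q :: int
  show "subst_sum M (\<lambda>p q. X (p - 1) q) p q = mult_by_sum (subst_sum M X) p q"
  proof (cases "q < M")
    case True
    then show ?thesis by (simp add: subst_sum_def mult_by_sum_def)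
  next
    case False
    define n where "n = nat (q - M)"
    have N: "nat (q - M + 1) = Suc n" "nat (q - 1 - M + 1) = n"
      using False by (auto simp: n_def)
    have pascal: "(of_int (p + int (Suc s)) gchoose Suc s :: complex) =
        (of_int (p + int s) gchoose s) + (of_int (p - 1 + int (Suc s)) gchoose Suc s)" for s
      using gbinomial_Suc_Suc[of "of_int (p + int s) :: complex" s] by (simp add: add_ac)
    have "subst_sum M (\<lambda>p q. X (p - 1) q) p q =
        X (p - 1) q + (\<Sum>s<n. (of_int (p + int (Suc s)) gchoose Suc s) *
          X (p + int s) (q - 1 - int s))"
      unfolding subst_sum_def N sum.lessThan_Suc_shift by (simp add: algebra_simps)
    also have "\<dots> = X (p - 1) q +
        ((\<Sum>s<n. (of_int (p + int s) gchoose s) * X (p + int s) (q - 1 - int s)) +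
         (\<Sum>s<n. (of_int (p - 1 + int (Suc s)) gchoose Suc s) * X (p + int s) (q - 1 - int s)))"
      unfolding pascal by (simp only: distrib_right sum.distrib)
    also have "\<dots> = mult_by_sum (subst_sum M X) p q"
      unfolding mult_by_sum_def subst_sum_def N sum.lessThan_Suc_shift
      by (simp add: algebra_simps)
    finally show ?thesis .
  qed
qed

lemma subst_sum_mult_fst_power:
  "subst_sum M (\<lambda>p q. X (p - int r) q) = (mult_by_sum ^^ r) (subst_sum M X)"
proof (induction r)
  case (Suc r)
  have "subst_sum M (\<lambda>p q. X (p - int (Suc r)) q) =
      subst_sum M (\<lambda>p q. (\<lambda>p q. X (p - int r) q) (p - 1) q)"
    by (simp add: algebra_simps)
  also have "\<dots> = mult_by_sum (subst_sum M (\<lambda>p q. X (p - int r) q))"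
    by (rule subst_sum_mult_fst)
  finally show ?case using Suc by simp
qed simp

lemma gbinomial_int_eq_0:
  assumes "0 \<le> m" "m < int n"
  shows "(of_int m gchoose n :: complex) = 0"
proof -
  have "(of_int m :: complex) = of_nat (nat m)" using assms by simp
  then show ?thesis using assms
    by (metis binomial_eq_0 binomial_gbinomial nat_less_iff of_nat_0)
qed

lemma gbinomial_int_symmetric:
  "(of_int (int n + int s) gchoose s :: complex) = (of_int (int n + int s) gchoose n)"
proof -
  have "(of_int (int n + int s) :: complex) = of_nat (n + s)" by simp
  then show ?thesis using gbinomial_of_nat_symmetric[of s "n + s", where 'a = complex] by simp
qed

text \<open>
  The substitution \<open>z\<^sub>1 = z\<^sub>0 + z\<^sub>2\<close> has the inverse \<open>z\<^sub>0 = z\<^sub>1 - z\<^sub>2\<close>, which creates no negative powers of \<open>z\<^sub>1\<close>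
  out of nonnegative powers of \<open>z\<^sub>0\<close>.  In coefficients: for \<open>p < 0\<close> the binomial coefficients of the terms
  with nonnegative exponent \<open>p + s\<close> vanish, so the equation can be solved by induction on \<open>q\<close>.
\<close>

lemma subst_sum_nonneg:
  assumes "\<And>p q. p < 0 \<Longrightarrow> subst_sum M X p q = 0"
    and "\<And>p q. q < M \<Longrightarrow> X p q = 0"
    and "p < 0"
  shows "X p q = 0"
  using \<open>p < 0\<close>
proof (induction "nat (q - M + 1)" arbitrary: p q rule: less_induct)
  case less
  show ?case
  proof (cases "q < M")
    case False
    define n where "n = nat (q - M)"
    have N: "nat (q - M + 1) = Suc n" using False by (auto simp: n_def)
    have "(of_int (p + int (Suc s)) gchoose Suc s) * X (p + int (Suc s)) (q - int (Suc s)) = 0"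
      if "s < n" for s
    proof (cases "p + int (Suc s) < 0")
      case True
      then show ?thesis using less.hyps[of "q - int (Suc s)" "p + int (Suc s)"] that N
        by (simp add: n_def)
    next
      case False
      then have "(of_int (p + int (Suc s)) gchoose Suc s :: complex) = 0"
        using less.prems by (intro gbinomial_int_eq_0) auto
      then show ?thesis by simp
    qed
    then have "(\<Sum>s<n. (of_int (p + int (Suc s)) gchoose Suc s) *
        X (p + int (Suc s)) (q - int (Suc s))) = 0"
      by (intro sum.neutral ballI) (simp only: lessThan_iff)
    moreover have "subst_sum M X p q = X p q + (\<Sum>s<n. (of_int (p + int (Suc s)) gchoose Suc s) *
        X (p + int (Suc s)) (q - int (Suc s)))"
      unfolding subst_sum_def N sum.lessThan_Suc_shift by simp
    ultimately show ?thesis using assms(1) less.prems by simp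
  qed (use assms in simp)
qed

text \<open>
  For nonnegative exponents of \<open>z\<^sub>1\<close> the two expansions of \<open>(z\<^sub>0 + z\<^sub>2)\<^sup>m\<close> coincide.
\<close>

lemma subst_sum_nonneg_eq:
  assumes "\<And>p q. q < M \<Longrightarrow> X p q = 0"
  shows "subst_sum M X (int n) q =
    (\<Sum>m\<in>{0..int n + q - M}. (of_int m gchoose n) * X m (int n + q - m))"
proof -
  have "(\<Sum>m\<in>{0..int n + q - M}. (of_int m gchoose n) * X m (int n + q - m)) =
      (\<Sum>m\<in>{int n..int n + q - M}. (of_int m gchoose n) * X m (int n + q - m))"
    by (rule sum.mono_neutral_right) (auto simp: gbinomial_int_eq_0)
  also have "\<dots> = (\<Sum>s<nat (q - M + 1). (of_int (int n + int s) gchoose n) *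
      X (int n + int s) (q - int s))"
    by (rule sum.reindex_bij_witness[of _ "\<lambda>s. int n + int s" "\<lambda>m. nat (m - int n)"])
      (auto simp: algebra_simps)
  also have "\<dots> = subst_sum M X (int n) q"
    unfolding subst_sum_def
    by (intro sum.cong refl) (metis gbinomial_int_symmetric)
  finally show ?thesis by (rule sym)
qed

text \<open>
  On series without negative powers of \<open>z\<^sub>0\<close>, multiplication by \<open>z\<^sub>0 + z\<^sub>2\<close> is injective, as the
  coefficients can be recovered by increasing exponent of \<open>z\<^sub>0\<close>.
\<close>

lemma mult_by_sum_inj:
  assumes "mult_by_sum D = mult_by_sum E"
    and "\<And>p q. p < 0 \<Longrightarrow> D p q = 0" "\<And>p q. p < 0 \<Longrightarrow> E p q = 0"
  shows "D = E"
proof -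
  have "D (int n) q = E (int n) q" for n q
  proof (induction n arbitrary: q)
    case 0
    show ?case using fun_cong[OF fun_cong[OF assms(1)], of 0 "q + 1"] assms(2,3)
      by (simp add: mult_by_sum_def)
  next
    case (Suc n)
    show ?case using fun_cong[OF fun_cong[OF assms(1)], of "int (Suc n)" "q + 1"] Suc[of "q + 1"]
      by (simp add: mult_by_sum_def)
  qed
  then have "D p q = E p q" for p q
    using assms(2,3) by (cases "p < 0") (auto dest: nonneg_int_cases simp: not_less)
  then show ?thesis by (intro ext)
qed

lemma mult_by_sum_power_nonneg:
  assumes "\<And>p q. p < 0 \<Longrightarrow> D p q = 0"
  shows "p < 0 \<Longrightarrow> (mult_by_sum ^^ r) D p q = 0"
  using assms by (induction r arbitrary: p q) (auto simp: mult_by_sum_def)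

lemma mult_by_sum_power_inj:
  assumes "(mult_by_sum ^^ r) D = (mult_by_sum ^^ r) E"
    and "\<And>p q. p < 0 \<Longrightarrow> D p q = 0" "\<And>p q. p < 0 \<Longrightarrow> E p q = 0"
  shows "D = E"
  using assms(1)
proof (induction r)
  case (Suc r)
  show ?case
    by (rule Suc.IH, rule mult_by_sum_inj) (use Suc.prems assms(2,3) in \<open>auto simp: mult_by_sum_power_nonneg\<close>)
qed simp

text \<open>
  The key step.  The hypothesis compares the expansion of \<open>X(z\<^sub>0 + z\<^sub>2, z\<^sub>2)\<close> in nonnegative powers of \<open>z\<^sub>2\<close>
  with a series \<open>D\<close> in nonnegative powers of \<open>z\<^sub>0\<close>, up to a factor \<open>(z\<^sub>0 + z\<^sub>2)\<^sup>r\<close>.  Then \<open>z\<^sub>1\<^sup>r X\<close> has no negative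
  powers of \<open>z\<^sub>1\<close>, so that its expansion does not depend on the choice of the variable, and the factor can
  be cancelled among series in nonnegative powers of \<open>z\<^sub>0\<close>.  So \<open>D(z\<^sub>0, z\<^sub>2)\<close> is \<open>X(z\<^sub>2 + z\<^sub>0, z\<^sub>2)\<close>, expanded
  in nonnegative powers of \<open>z\<^sub>0\<close>.
\<close>

lemma expansion_around_diagonal:
  fixes X D :: "int \<Rightarrow> int \<Rightarrow> complex"
  assumes X: "\<And>p q. q < M \<Longrightarrow> X p q = 0"
    and D: "\<And>p q. p < 0 \<Longrightarrow> D p q = 0"
    and eq: "(mult_by_sum ^^ r) (subst_sum M X) = (mult_by_sum ^^ r) D"
  shows "p < - int r \<Longrightarrow> X p q = 0"
    and "D (int n) q = (\<Sum>m\<in>{- int r..int n + q - M}. (of_int m gchoose n) * X m (int n + q - m))"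
proof -
  define X' where "X' = (\<lambda>p q. X (p - int r) q)"
  have eq': "subst_sum M X' = (mult_by_sum ^^ r) D"
    unfolding X'_def subst_sum_mult_fst_power by (rule eq)
  have X'M: "\<And>p q. q < M \<Longrightarrow> X' p q = 0" by (simp add: X'_def X)
  have X'0: "X' p q = 0" if "p < 0" for p q
    by (rule subst_sum_nonneg[OF _ X'M that])
      (simp_all add: eq' mult_by_sum_power_nonneg D)
  show "X p q = 0" if "p < - int r" for p q
    using X'0[of "p + int r" q] that by (simp add: X'_def)
  \<comment> \<open>\<open>U i\<close> is \<open>(z\<^sub>2 + z\<^sub>0)\<^sup>i X(z\<^sub>2 + z\<^sub>0, z\<^sub>2)\<close>, expanded in nonnegative powers of \<open>z\<^sub>0\<close>.\<close>
  define U where "U = (\<lambda>i p q. if p < 0 then 0 else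
     (\<Sum>m\<in>{- int r..p + q - int i - M}. (of_int (m + int i) gchoose nat p) * X m (p + q - int i - m)))"
  have U_step: "mult_by_sum (U i) = U (Suc i)" for i
  proof (intro ext)
    fix p q :: int
    consider "p < 0" | "p = 0" | "p > 0" by linarith
    then show "mult_by_sum (U i) p q = U (Suc i) p q"
    proof cases
      case 3
      have pascal: "(of_int (m + int i) gchoose nat (p - 1)) + (of_int (m + int i) gchoose nat p) =
          (of_int (m + int (Suc i)) gchoose nat p :: complex)" for m
        using gbinomial_Suc_Suc[of "of_int (m + int i) :: complex" "nat (p - 1)"] 3
        by (simp add: Suc_nat_eq_nat_zadd1 add_ac)
      have "p - 1 + q - int i = p + q - int (Suc i)" "p + (q - 1) - int i = p + q - int (Suc i)"
        by auto
      with 3 show ?thesis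
        unfolding U_def mult_by_sum_def
        by (simp only: pascal[symmetric] distrib_right sum.distrib) auto
    qed (auto simp: U_def mult_by_sum_def algebra_simps)
  qed
  have U_power: "(mult_by_sum ^^ i) (U 0) = U i" for i
    by (induction i) (simp_all add: U_step)
  have "U r = subst_sum M X'"
  proof (intro ext)
    fix p q :: int
    show "U r p q = subst_sum M X' p q"
    proof (cases "p < 0")
      case True
      then show ?thesis by (simp add: U_def eq' mult_by_sum_power_nonneg D)
    next
      case False
      then obtain n where n: "p = int n" using nonneg_int_cases by (metis not_less)
      have "U r p q = (\<Sum>m\<in>{0..int n + q - M}. (of_int m gchoose n) * X' m (int n + q - m))"
        unfolding U_def n X'_def
        by (simp, rule sum.reindex_bij_witness[of _ "\<lambda>m. m - int r" "\<lambda>m. m + int r"])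
          (auto simp: algebra_simps)
      then show ?thesis using subst_sum_nonneg_eq[OF X'M] n by simp
    qed
  qed
  then have "(mult_by_sum ^^ r) (U 0) = (mult_by_sum ^^ r) D" by (simp add: U_power eq')
  then have "U 0 = D"
    by (rule mult_by_sum_power_inj) (auto simp: U_def D)
  then have "D (int n) q = U 0 (int n) q" by simp
  then show "D (int n) q = (\<Sum>m\<in>{- int r..int n + q - M}. (of_int m gchoose n) * X m (int n + q - m))"
    by (simp add: U_def)
qed

section \<open>Comparing expansions along the diagonal\<close>

text \<open>
  With \<open>\<psi> a b\<close> the coefficient of \<open>x\<^sub>1\<^sup>a x\<^sub>2\<^sup>b\<close> in \<open>\<Phi>(x\<^sub>1, x\<^sub>2; z)\<close>, the hypothesis is the part
  \<open>\<Phi>(x + y, y; z) = \<Phi>(x, 0; z + y)\<close> of translation covariance, and the conclusion is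
  \<open>\<Phi>(0, y; z) = \<Phi>(-y, 0; z + y)\<close>.
\<close>

lemma translation_recurrence:
  fixes \<psi> :: "nat \<Rightarrow> nat \<Rightarrow> int \<Rightarrow> complex"
  assumes "\<And>a n q. (\<Sum>i\<le>n. (of_nat (a + i) gchoose a) * \<psi> (a + i) (n - i) q) =
      (of_int (int n + q) gchoose n) * \<psi> a 0 (int n + q)"
  shows "\<psi> 0 n q = (\<Sum>a\<le>n. (- 1) ^ a * (of_int (int n + q - int a) gchoose (n - a)) *
     \<psi> a 0 (int n + q - int a))"
proof -
  have "(\<Sum>a\<le>n. (- 1) ^ a * (of_int (int n + q - int a) gchoose (n - a)) * \<psi> a 0 (int n + q - int a)) =
      (\<Sum>a\<le>n. (- 1) ^ a * (\<Sum>i\<le>n - a. (of_nat (a + i) gchoose a) * \<psi> (a + i) (n - a - i) q))"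
  proof (intro sum.cong refl)
    fix a assume "a \<in> {..n}"
    then have "int n + q - int a = int (n - a) + q" by simp
    then show "(- 1) ^ a * (of_int (int n + q - int a) gchoose (n - a)) * \<psi> a 0 (int n + q - int a) =
        (- 1) ^ a * (\<Sum>i\<le>n - a. (of_nat (a + i) gchoose a) * \<psi> (a + i) (n - a - i) q)"
      by (simp only: assms mult.assoc)
  qed
  also have "\<dots> = (\<Sum>a\<le>n. \<Sum>i\<le>n - a. (- 1) ^ a * (of_nat (a + i) gchoose a) * \<psi> (a + i) (n - (a + i)) q)"
    by (simp add: sum_distrib_left mult.assoc)
  also have "\<dots> = (\<Sum>(a, i)\<in>{(a, i). a + i \<le> n}. (- 1) ^ a * (of_nat (a + i) gchoose a) * \<psi> (a + i) (n - (a + i)) q)"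
    by (subst sum.Sigma) (auto intro!: sum.cong)
  also have "\<dots> = (\<Sum>k\<le>n. \<Sum>a\<le>k. (- 1) ^ a * (of_nat (a + (k - a)) gchoose a) *
      \<psi> (a + (k - a)) (n - (a + (k - a))) q)"
    by (rule sum.triangle_reindex_eq)
  also have "\<dots> = (\<Sum>k\<le>n. (\<Sum>a\<le>k. (- 1) ^ a * of_nat (k choose a)) * \<psi> k (n - k) q)"
    by (intro sum.cong refl) (simp add: sum_distrib_right binomial_gbinomial)
  also have "\<dots> = (\<Sum>k\<le>n. if k = 0 then \<psi> k (n - k) q else 0)"
    by (intro sum.cong refl) (auto simp: choose_alternating_sum)
  also have "\<dots> = \<psi> 0 n q" by simp
  finally show ?thesis by simp
qed

text \<open>
  The sums in the hypothesis are the Taylor coefficients at \<open>1\<close> of the Laurent polynomial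
  \<open>\<Sum>\<^sub>q z q t\<^sup>q\<close>.  Multiplying it by a power of \<open>t\<close> keeps them zero, and for a polynomial of degree \<open>n\<close> the
  \<open>n\<close>-th Taylor coefficient is the leading coefficient.
\<close>

lemma binomial_moments_eq_0:
  fixes z :: "int \<Rightarrow> complex"
  assumes A: "finite A" and moments: "\<And>n. (\<Sum>q\<in>A. (of_int q gchoose n) * z q) = 0" and "q0 \<in> A"
  shows "z q0 = 0"
proof (rule ccontr)
  assume "z q0 \<noteq> 0"
  define B where "B = {q \<in> A. z q \<noteq> 0}"
  have B: "finite B" "B \<noteq> {}" using A \<open>q0 \<in> A\<close> \<open>z q0 \<noteq> 0\<close> by (auto simp: B_def)
  define b where "b = Min B"
  define c where "c = Max B"
  have bc: "b \<le> q" "q \<le> c" if "q \<in> B" for q using B that by (auto simp: b_def c_def)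
  have "c \<in> B" using B by (simp add: c_def)
  define n where "n = nat (c - b)"
  \<comment> \<open>Divide the Laurent polynomial by its lowest power \<open>t\<^sup>b\<close>; the quotient has degree \<open>n\<close>.\<close>
  have "(\<Sum>q\<in>B. (of_int (q - b) gchoose n) * z q) = 0"
  proof -
    have "(of_int (q - b) gchoose n :: complex) =
        (\<Sum>k=0..n. (of_int (- b) gchoose (n - k)) * (of_int q gchoose k))" for q
      using gbinomial_Vandermonde[of "of_int q :: complex" "of_int (- b)" n] by (simp add: mult.commute)
    then have "(\<Sum>q\<in>B. (of_int (q - b) gchoose n) * z q) =
        (\<Sum>q\<in>B. \<Sum>k=0..n. (of_int (- b) gchoose (n - k)) * ((of_int q gchoose k) * z q))"
      by (simp add: sum_distrib_right mult.assoc)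
    also have "\<dots> = (\<Sum>k=0..n. (of_int (- b) gchoose (n - k)) * (\<Sum>q\<in>B. (of_int q gchoose k) * z q))"
      by (subst sum.swap) (simp add: sum_distrib_left)
    also have "(\<lambda>k. \<Sum>q\<in>B. (of_int q gchoose k) * z q) = (\<lambda>k. \<Sum>q\<in>A. (of_int q gchoose k) * z q)"
      by (intro ext sum.mono_neutral_left) (auto simp: A B_def)
    finally show ?thesis by (simp add: moments)
  qed
  also have "(\<Sum>q\<in>B. (of_int (q - b) gchoose n) * z q) = (\<Sum>q\<in>{c}. (of_int (q - b) gchoose n) * z q)"
  proof (rule sum.mono_neutral_right)
    show "\<forall>q\<in>B - {c}. (of_int (q - b) gchoose n) * z q = 0"
    proof
      fix q assume "q \<in> B - {c}"
      then have "0 \<le> q - b" "q - b < int n" using bc[of q] by (auto simp: n_def)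
      then show "(of_int (q - b) gchoose n) * z q = 0" by (simp only: gbinomial_int_eq_0) simp
    qed
  qed (use B \<open>c \<in> B\<close> in auto)
  finally have "(of_int (c - b) gchoose n) * z c = 0" by simp
  moreover have "of_int (c - b) = (of_nat n :: complex)" using bc[OF \<open>c \<in> B\<close>] by (simp add: n_def)
  ultimately show False using \<open>c \<in> B\<close> by (simp add: B_def flip: binomial_gbinomial)
qed

text \<open>
  For a monomial \<open>z\<^sub>1\<^sup>p z\<^sub>2\<^bsup>d-p\<^esup>\<close> this relates its Taylor coefficients along the diagonal in
  the two charts \<open>z\<^sub>2 = 1\<close> (with parameter \<open>z\<^sub>1 - 1\<close>) and \<open>z\<^sub>1 = 1\<close> (with parameter \<open>z\<^sub>2 - 1\<close>).
\<close>

lemma binomial_change_of_chart: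
  fixes p d :: int
  shows "(\<Sum>a\<le>n. (- 1) ^ a * (of_int (d - int a) gchoose (n - a)) * (of_int p gchoose a)) =
    (of_int (d - p) gchoose n :: complex)"
proof -
  have neg: "(of_int (d - int a) gchoose (n - a) :: complex) =
      (- 1) ^ (n - a) * (of_int (int n - d - 1) gchoose (n - a))" if "a \<le> n" for a
    using that by (subst gbinomial_negated_upper) (simp add: of_nat_diff algebra_simps)
  have "(\<Sum>a\<le>n. (- 1) ^ a * (of_int (d - int a) gchoose (n - a)) * (of_int p gchoose a)) =
      (\<Sum>a\<le>n. (- 1) ^ n * ((of_int p gchoose a) * (of_int (int n - d - 1) gchoose (n - a)) :: complex))"
  proof (intro sum.cong refl)
    fix a assume "a \<in> {..n}"
    then have "(- 1) ^ a * (- 1) ^ (n - a) = ((- 1) ^ n :: complex)" by (simp flip: power_add)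
    then show "(- 1) ^ a * (of_int (d - int a) gchoose (n - a)) * (of_int p gchoose a) =
      (- 1) ^ n * ((of_int p gchoose a) * (of_int (int n - d - 1) gchoose (n - a)) :: complex)"
      using neg[of a] \<open>a \<in> {..n}\<close> by (simp add: mult_ac)
  qed
  also have "\<dots> = (- 1) ^ n * (of_int p + of_int (int n - d - 1) gchoose n)"
    by (simp only: sum_distrib_left[symmetric] atMost_atLeast0 gbinomial_Vandermonde)
  also have "\<dots> = (of_int (d - p) gchoose n)"
    by (subst (2) gbinomial_negated_upper) (simp add: algebra_simps)
  finally show ?thesis .
qed

text \<open>
  In a fixed total degree \<open>d\<close>, the bounds on the exponents leave only finitely many coefficients of \<open>X\<close>
  and \<open>Y\<close>.  The first family \<open>\<psi> n 0\<close> consists of the Taylor coefficients of \<open>X\<close> in the chart \<open>z\<^sub>2 = 1\<close>, the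
  second one \<open>\<psi> 0 n\<close> of those of \<open>Y\<close> in the chart \<open>z\<^sub>1 = 1\<close>, and the last hypothesis is the change of charts.
\<close>

lemma equal_by_expansion_around_diagonal:
  fixes X Y :: "int \<Rightarrow> int \<Rightarrow> complex"
  assumes X: "\<And>p q. q < M \<Longrightarrow> X p q = 0" "\<And>p q. p < - int r \<Longrightarrow> X p q = 0"
    and Y: "\<And>p q. p < M' \<Longrightarrow> Y p q = 0" "\<And>p q. q < - int r' \<Longrightarrow> Y p q = 0"
    and eqX: "\<And>n q. \<psi> n 0 q =
      (\<Sum>m\<in>{- int r..int n + q - M}. (of_int m gchoose n) * X m (int n + q - m))"
    and eqY: "\<And>n q. \<psi> 0 n q =
      (\<Sum>m\<in>{- int r'..int n + q - M'}. (of_int m gchoose n) * Y (int n + q - m) m)"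
    and trans: "\<And>n q. \<psi> 0 n q = (\<Sum>a\<le>n. (- 1) ^ a * (of_int (int n + q - int a) gchoose (n - a)) *
        \<psi> a 0 (int n + q - int a))"
  shows "X p q = Y p q"
proof -
  define d where "d = p + q"
  \<comment> \<open>An interval that contains all exponents of \<open>z\<^sub>2\<close> in total degree \<open>d\<close>, and \<open>q\<close>.\<close>
  define K where "K = \<bar>M\<bar> + \<bar>M'\<bar> + int r + int r' + \<bar>d\<bar> + \<bar>q\<bar>"
  define A where "A = {- K..K}"
  have eqX': "\<psi> n 0 (d - int n) = (\<Sum>m\<in>A. (of_int (d - m) gchoose n) * X (d - m) m)" for n
  proof -
    have "\<psi> n 0 (d - int n) = (\<Sum>m\<in>{- int r..d - M}. (of_int m gchoose n) * X m (d - m))"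
      using eqX[of n "d - int n"] by simp
    also have "\<dots> = (\<Sum>m\<in>{M..d + int r}. (of_int (d - m) gchoose n) * X (d - m) m)"
      by (rule sum.reindex_bij_witness[of _ "\<lambda>m. d - m" "\<lambda>m. d - m"]) auto
    also have "\<dots> = (\<Sum>m\<in>A. (of_int (d - m) gchoose n) * X (d - m) m)"
      by (rule sum.mono_neutral_left) (auto simp: A_def K_def X not_le)
    finally show ?thesis .
  qed
  have eqY': "\<psi> 0 n (d - int n) = (\<Sum>m\<in>A. (of_int m gchoose n) * Y (d - m) m)" for n
  proof -
    have "\<psi> 0 n (d - int n) = (\<Sum>m\<in>{- int r'..d - M'}. (of_int m gchoose n) * Y (d - m) m)"
      using eqY[of n "d - int n"] by simp
    also have "\<dots> = (\<Sum>m\<in>A. (of_int m gchoose n) * Y (d - m) m)"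
      by (rule sum.mono_neutral_left) (auto simp: A_def K_def Y not_le)
    finally show ?thesis .
  qed
  have moments: "(\<Sum>m\<in>A. (of_int m gchoose n) * (X (d - m) m - Y (d - m) m)) = 0" for n
  proof -
    have "(\<Sum>m\<in>A. (of_int m gchoose n) * Y (d - m) m) =
        (\<Sum>a\<le>n. (- 1) ^ a * (of_int (d - int a) gchoose (n - a)) * \<psi> a 0 (d - int a))"
      using trans[of n "d - int n"] by (simp add: eqY' algebra_simps)
    also have "\<dots> = (\<Sum>m\<in>A. (\<Sum>a\<le>n. (- 1) ^ a * (of_int (d - int a) gchoose (n - a)) *
        (of_int (d - m) gchoose a)) * X (d - m) m)"
      unfolding eqX' sum_distrib_left sum_distrib_right by (subst sum.swap) (simp add: mult.assoc)
    also have "\<dots> = (\<Sum>m\<in>A. (of_int m gchoose n) * X (d - m) m)"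
      unfolding binomial_change_of_chart by simp
    finally show ?thesis by (simp add: right_diff_distrib sum_subtractf)
  qed
  have "finite A" "q \<in> A" by (auto simp: A_def K_def)
  from binomial_moments_eq_0[OF this(1) moments this(2)]
  show ?thesis by (simp add: d_def)
qed

section \<open>Sums and linear forms in the \<open>h\<close>-adic topology\<close>

lemma topologically_free_module: "topologically_free scl \<Longrightarrow> module scl"
  by (simp add: topologically_free_def)

lemma hpow_0: assumes "module scl" shows "0 \<in> hpow scl k"
proof -
  interpret module scl by fact
  show ?thesis unfolding hpow_def by (rule range_eqI[of _ _ 0]) simp
qed

lemma hpow_add:
  assumes "module scl" "x \<in> hpow scl k" "y \<in> hpow scl k" shows "x + y \<in> hpow scl k"
proof -
  interpret module scl by fact
  show ?thesis using assms(2,3) unfolding hpow_def by (auto simp flip: scale_right_distrib)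
qed

lemma hpow_scale:
  assumes "module scl" "x \<in> hpow scl k" shows "scl c x \<in> hpow scl k"
proof -
  interpret module scl by fact
  obtain y where "x = scl (fps_X ^ k) y" using assms(2) by (auto simp: hpow_def)
  then have "scl c x = scl (fps_X ^ k) (scl c y)" by (simp only: scale_left_commute)
  then show ?thesis by (simp only: hpow_def rangeI)
qed

lemma hpow_diff:
  assumes "module scl" "x \<in> hpow scl k" "y \<in> hpow scl k" shows "x - y \<in> hpow scl k"
proof -
  interpret module scl by fact
  show ?thesis using assms(2,3) unfolding hpow_def by (auto simp flip: scale_right_diff_distrib)
qed

lemma hpow_scale_power:
  assumes "module scl" "k \<le> j" shows "scl (c * fps_X ^ j) x \<in> hpow scl k"
proof -
  interpret module scl by fact
  have "fps_X ^ j = fps_X ^ k * (fps_X ^ (j - k) :: complex fps)"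
    using assms(2) by (simp flip: power_add)
  then have "c * fps_X ^ j = fps_X ^ k * (c * fps_X ^ (j - k))" by (metis mult.left_commute)
  then have "scl (c * fps_X ^ j) x = scl (fps_X ^ k) (scl (c * fps_X ^ (j - k)) x)" by (simp only: scale_scale)
  then show ?thesis by (simp only: hpow_def rangeI)
qed

lemma module_hom_hpow:
  assumes "module_hom scl scl' F" "x \<in> hpow scl k" shows "F x \<in> hpow scl' k"
proof -
  interpret module_hom scl scl' F by fact
  show ?thesis using assms(2) by (auto simp: hpow_def scale)
qed

text \<open>
  In the coordinates \<open>\<phi>\<close> with values in \<open>V0[[h]]\<close>, divisibility by \<open>h\<^sup>k\<close> means that the first \<open>k\<close>
  coefficients vanish.
\<close>

lemma topologically_free_coordinates:
  fixes scl :: "complex fps \<Rightarrow> 'v::ab_group_add \<Rightarrow> 'v"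
  assumes "topologically_free scl"
  obtains V0 and \<phi> :: "'v \<Rightarrow> 'v fps"
  where "module.subspace (\<lambda>c::complex. scl (fps_const c)) V0"
    "bij_betw \<phi> UNIV {f. \<forall>n. fps_nth f n \<in> V0}" "Modules.additive \<phi>"
    "\<And>k x. x \<in> hpow scl k \<longleftrightarrow> (\<forall>n<k. fps_nth (\<phi> x) n = 0)"
proof -
  interpret module scl using assms by (rule topologically_free_module)
  obtain V0 and \<phi> :: "'v \<Rightarrow> 'v fps" where V0: "module.subspace (\<lambda>c::complex. scl (fps_const c)) V0"
    and bij: "bij_betw \<phi> UNIV {f. \<forall>n. fps_nth f n \<in> V0}"
    and add: "\<And>x y. \<phi> (x + y) = \<phi> x + \<phi> y"
    and mult: "\<And>a x n. fps_nth (\<phi> (scl a x)) n =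
      (\<Sum>i\<le>n. scl (fps_const (fps_nth a i)) (fps_nth (\<phi> x) (n - i)))"
    using assms unfolding topologically_free_def by auto
  have shift: "fps_nth (\<phi> (scl (fps_X ^ k) x)) n = (if k \<le> n then fps_nth (\<phi> x) (n - k) else 0)" for k x n
  proof -
    have "fps_nth (\<phi> (scl (fps_X ^ k) x)) n = (\<Sum>i\<le>n. if i = k then fps_nth (\<phi> x) (n - i) else 0)"
      unfolding mult by (intro sum.cong refl) auto
    then show ?thesis by simp
  qed
  have "x \<in> hpow scl k \<longleftrightarrow> (\<forall>n<k. fps_nth (\<phi> x) n = 0)" for k x
  proof
    assume zero: "\<forall>n<k. fps_nth (\<phi> x) n = 0"
    have "\<phi> x \<in> {f. \<forall>n. fps_nth f n \<in> V0}" using bij by (auto simp: bij_betw_def)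
    then have "Abs_fps (\<lambda>n. fps_nth (\<phi> x) (n + k)) \<in> {f. \<forall>n. fps_nth f n \<in> V0}" by simp
    then obtain y where y: "\<phi> y = Abs_fps (\<lambda>n. fps_nth (\<phi> x) (n + k))"
      using bij unfolding bij_betw_def by (metis (no_types, lifting) imageE)
    have "\<phi> (scl (fps_X ^ k) y) = \<phi> x"
      using zero by (intro fps_ext) (auto simp: shift y)
    then have "x = scl (fps_X ^ k) y" using bij by (auto simp: bij_betw_def inj_def)
    then show "x \<in> hpow scl k" by (auto simp: hpow_def)
  qed (auto simp: hpow_def shift)
  then show thesis using that V0 bij add by (auto simp: Modules.additive_def)
qed

lemma topologically_free_separated:
  assumes "topologically_free scl" "\<And>k. x \<in> hpow scl k" shows "x = 0"
  using assms(1)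
proof (rule topologically_free_coordinates)
  fix V0 and \<phi> :: "'a \<Rightarrow> 'a fps"
  assume bij: "bij_betw \<phi> UNIV {f. \<forall>n. fps_nth f n \<in> V0}" and add: "Modules.additive \<phi>"
    and hpow: "\<And>k x. x \<in> hpow scl k \<longleftrightarrow> (\<forall>n<k. fps_nth (\<phi> x) n = 0)"
  have "\<phi> x = \<phi> 0" unfolding Modules.additive.zero[OF add]
    using hpow assms(2) by (intro fps_ext) (metis fps_zero_nth lessI)
  then show "x = 0" using bij by (auto simp: bij_betw_def inj_def)
qed

lemma has_hsum_unique:
  assumes tf: "topologically_free scl" and "has_hsum scl I t x" "has_hsum scl I t y"
  shows "x = y"
proof -
  note m = topologically_free_module[OF tf]
  have "x - y \<in> hpow scl k" for k
  proof -
    obtain F F' where "finite F" "F \<subseteq> I" "\<And>G. finite G \<Longrightarrow> F \<subseteq> G \<Longrightarrow> G \<subseteq> I \<Longrightarrow> x - sum t G \<in> hpow scl k"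
      and "finite F'" "F' \<subseteq> I" "\<And>G. finite G \<Longrightarrow> F' \<subseteq> G \<Longrightarrow> G \<subseteq> I \<Longrightarrow> y - sum t G \<in> hpow scl k"
      using assms(2,3) unfolding has_hsum_def by metis
    then have "x - sum t (F \<union> F') \<in> hpow scl k" "y - sum t (F \<union> F') \<in> hpow scl k" by auto
    from hpow_diff[OF m this] show ?thesis by simp
  qed
  from topologically_free_separated[OF tf this] show ?thesis by simp
qed

text \<open>
  In a topologically free module this condition is sufficient for convergence, by completeness.
\<close>

definition hsummable :: "(complex fps \<Rightarrow> 'v::ab_group_add \<Rightarrow> 'v) \<Rightarrow> 'i set \<Rightarrow> ('i \<Rightarrow> 'v) \<Rightarrow> bool" where
  "hsummable scl I t \<longleftrightarrow> (\<forall>k. finite {i \<in> I. t i \<notin> hpow scl k})"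

lemma has_hsum_hsum:
  assumes tf: "topologically_free scl" and t: "hsummable scl I t"
  shows "has_hsum scl I t (hsum scl I t)"
proof -
  interpret module scl using tf by (rule topologically_free_module)
  obtain V0 and \<phi> :: "'a \<Rightarrow> 'a fps" where V0: "module.subspace (\<lambda>c::complex. scl (fps_const c)) V0"
    and bij: "bij_betw \<phi> UNIV {f. \<forall>n. fps_nth f n \<in> V0}" and add: "Modules.additive \<phi>"
    and hpow: "\<And>k x. x \<in> hpow scl k \<longleftrightarrow> (\<forall>n<k. fps_nth (\<phi> x) n = 0)"
    by (rule topologically_free_coordinates[OF tf]) blast
  interpret C: module "\<lambda>c::complex. scl (fps_const c)"
    by standard (simp_all add: scale_right_distrib scale_left_distrib flip: fps_const_add fps_const_mult)
  define F where "F = (\<lambda>k. {i \<in> I. t i \<notin> hpow scl k})"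
  have F: "finite (F k)" "F k \<subseteq> I" for k using t by (auto simp: F_def hsummable_def)
  have "fps_nth (\<phi> y) n \<in> V0" for y n using bij by (auto simp: bij_betw_def)
  then have "Abs_fps (\<lambda>n. \<Sum>i\<in>F (Suc n). fps_nth (\<phi> (t i)) n) \<in> {f. \<forall>n. fps_nth f n \<in> V0}"
    by (auto intro!: C.subspace_sum[OF V0])
  then obtain x where x: "\<phi> x = Abs_fps (\<lambda>n. \<Sum>i\<in>F (Suc n). fps_nth (\<phi> (t i)) n)"
    using bij unfolding bij_betw_def by (metis (no_types, lifting) imageE)
  have "x - sum t G \<in> hpow scl k" if G: "finite G" "F k \<subseteq> G" "G \<subseteq> I" for k G
    unfolding hpow
  proof (intro allI impI)
    fix n assume "n < k"
    have "(\<Sum>i\<in>F (Suc n). fps_nth (\<phi> (t i)) n) = (\<Sum>i\<in>G. fps_nth (\<phi> (t i)) n)"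
    proof (rule sum.mono_neutral_left)
      have "F (Suc n) \<subseteq> F k"
        unfolding F_def hpow using less_le_trans[OF _ Suc_leI[OF \<open>n < k\<close>]] by auto
      then show "F (Suc n) \<subseteq> G" using G(2) by blast
    qed (use G F in \<open>auto simp: F_def hpow\<close>)
    then show "fps_nth (\<phi> (x - sum t G)) n = 0"
      by (simp add: Modules.additive.diff[OF add] Modules.additive.sum[OF add] x fps_sum_nth)
  qed
  then have x: "has_hsum scl I t x"
    unfolding has_hsum_def
    by (intro allI, rule_tac x = "F k" in exI) (simp add: F)
  then have "hsum scl I t = x"
    unfolding hsum_def by (rule the_equality) (rule has_hsum_unique[OF tf _ x])
  with x show ?thesis by simp
qed

text \<open>
  Complex linear forms on \<open>V / h\<^sup>k V\<close>.  They are not linear over \<open>\<complex>[[h]]\<close>; multiplication by \<open>h\<^sup>j\<close> is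
  accounted for by passing from \<open>g\<close> to \<open>\<lambda>x. g (h\<^sup>j x)\<close>, which is a form of the same kind.
\<close>

definition hfunctional :: "(complex fps \<Rightarrow> 'v::ab_group_add \<Rightarrow> 'v) \<Rightarrow> nat \<Rightarrow> ('v \<Rightarrow> complex) \<Rightarrow> bool" where
  "hfunctional scl k g \<longleftrightarrow> Modules.additive g \<and> (\<forall>c x. g (scl (fps_const c) x) = c * g x) \<and>
     (\<forall>x\<in>hpow scl k. g x = 0)"

lemma hfunctional_simps:
  assumes "hfunctional scl k g"
  shows "g (x + y) = g x + g y" "g (x - y) = g x - g y" "g 0 = 0" "g (sum t A) = (\<Sum>i\<in>A. g (t i))"
    "g (scl (fps_const c) x) = c * g x" "x \<in> hpow scl k \<Longrightarrow> g x = 0"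
  using assms by (auto simp: hfunctional_def Modules.additive.add Modules.additive.diff Modules.additive.zero Modules.additive.sum)

lemma hfunctional_hom:
  assumes "hfunctional scl' k g" "module_hom scl scl' F" shows "hfunctional scl k (\<lambda>x. g (F x))"
proof -
  interpret module_hom scl scl' F by fact
  show ?thesis
    using assms module_hom_hpow[OF assms(2), of _ k] by (auto simp: hfunctional_def Modules.additive_def add scale)
qed

lemma module_hom_scale:
  assumes "module scl" shows "module_hom scl scl (scl c)"
proof -
  interpret module scl by fact
  show ?thesis by unfold_locales (simp_all add: scale_right_distrib mult.commute)
qed

lemma hfunctional_hsum:
  assumes tf: "topologically_free scl" and g: "hfunctional scl k g" and t: "hsummable scl I t"
    and F: "finite F" "F \<subseteq> I" "\<And>i. i \<in> I - F \<Longrightarrow> g (t i) = 0"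
  shows "g (hsum scl I t) = (\<Sum>i\<in>F. g (t i))"
proof -
  obtain F' where F': "finite F'" "F' \<subseteq> I"
    "\<And>G. finite G \<Longrightarrow> F' \<subseteq> G \<Longrightarrow> G \<subseteq> I \<Longrightarrow> hsum scl I t - sum t G \<in> hpow scl k"
    using has_hsum_hsum[OF tf t] unfolding has_hsum_def by meson
  have "g (hsum scl I t - sum t (F \<union> F')) = 0"
    by (rule hfunctional_simps(6)[OF g], rule F'(3)) (use F F' in auto)
  then have "g (hsum scl I t) = (\<Sum>i\<in>F \<union> F'. g (t i))" by (simp add: hfunctional_simps[OF g])
  also have "\<dots> = (\<Sum>i\<in>F. g (t i))" by (rule sum.mono_neutral_right) (use F F' in auto)
  finally show ?thesis .
qed

text \<open>
  A basis of \<open>h\<^sup>k V\<close> over \<open>\<complex>\<close> stays independent after adding \<open>x\<close>, so a linear form can be \<open>0\<close> on it and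
  \<open>1\<close> at \<open>x\<close>.
\<close>

lemma hfunctional_exists:
  assumes "module scl" "x \<notin> hpow scl k"
  shows "\<exists>g. hfunctional scl k g \<and> g x \<noteq> 0"
proof -
  interpret module scl by fact
  interpret C: vector_space_pair "\<lambda>c::complex. scl (fps_const c)" "(*) :: complex \<Rightarrow> complex \<Rightarrow> complex"
    by unfold_locales (simp_all add: scale_right_distrib scale_left_distrib algebra_simps flip: fps_const_add fps_const_mult)
  have S: "C.vs1.subspace (hpow scl k)"
    by (rule C.vs1.subspaceI) (use assms in \<open>auto intro: hpow_0 hpow_add hpow_scale\<close>)
  obtain B where B: "B \<subseteq> hpow scl k" "C.vs1.independent B" "hpow scl k \<subseteq> C.vs1.span B"
    by (rule C.vs1.maximal_independent_subset)
  have "C.vs1.span B = hpow scl k" using B S by (simp add: C.vs1.span_minimal antisym)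
  then have "C.vs1.independent (insert x B)"
    using B assms(2) by (intro C.vs1.independent_insertI) auto
  then obtain g where lin: "Vector_Spaces.linear (\<lambda>c::complex. scl (fps_const c)) (*) g"
    and g: "\<And>y. y \<in> insert x B \<Longrightarrow> g y = (if y = x then 1 else 0 :: complex)"
    using C.linear_independent_extend[of "insert x B" "\<lambda>y. if y = x then 1 else 0"] by metis
  interpret g: Vector_Spaces.linear "\<lambda>c::complex. scl (fps_const c)" "(*)" g by fact
  have "g y = 0" if "y \<in> hpow scl k" for y
  proof (rule C.linear_eq_0_on_span[OF lin, of B])
    show "g b = 0" if "b \<in> B" for b using g[of b] that B assms(2) by auto
    show "y \<in> C.vs1.span B" using that B(3) by blast
  qed
  then have "hfunctional scl k g" by (auto simp: hfunctional_def Modules.additive_def g.add g.scale)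
  then show ?thesis using g[of x] by auto
qed

lemma hfunctionals_separate:
  assumes tf: "topologically_free scl" and "\<And>k g. hfunctional scl k g \<Longrightarrow> g x = g y"
  shows "x = y"
proof -
  have "x - y \<in> hpow scl k" for k
    using hfunctional_exists[OF topologically_free_module[OF tf], of "x - y" k] assms(2)
      hfunctional_simps(2) by (metis eq_iff_diff_eq_0)
  from topologically_free_separated[OF tf this] show ?thesis by simp
qed

lemma hsum_finite:
  assumes tf: "topologically_free scl" and F: "finite F" "F \<subseteq> I" "\<And>i. i \<in> I - F \<Longrightarrow> t i = 0"
  shows "hsum scl I t = sum t F"
proof -
  note m = topologically_free_module[OF tf]
  have "has_hsum scl I t (sum t F)"
    unfolding has_hsum_def
  proof (intro allI, rule exI[of _ F], intro conjI allI impI)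
    fix k G assume "finite G \<and> F \<subseteq> G \<and> G \<subseteq> I"
    then have "sum t F = sum t G" by (intro sum.mono_neutral_left) (use F in auto)
    then show "sum t F - sum t G \<in> hpow scl k" by (simp add: hpow_0[OF m])
  qed (use F in auto)
  then show ?thesis
    unfolding hsum_def by (auto intro!: the_equality intro: has_hsum_unique[OF tf])
qed

lemma hsum_cong:
  assumes "\<And>i. i \<in> I \<Longrightarrow> t i = t' i" shows "hsum scl I t = hsum scl I t'"
proof -
  have "sum t G = sum t' G" if "G \<subseteq> I" for G
    using that assms by (intro sum.cong) auto
  then have "has_hsum scl I t = has_hsum scl I t'"
    by (simp add: has_hsum_def fun_eq_iff cong: conj_cong imp_cong)
  then show ?thesis by (simp add: hsum_def)
qed

text \<open>
  The bounds in weak associativity and in membership in \<open>W((z))\<^sub>h\<close> depend on the vector; the \<open>RLL\<close>-relation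
  involves finitely many vectors, to which this is applied.
\<close>

lemma finite_uniform_bound:
  fixes P :: "'c \<Rightarrow> nat \<Rightarrow> bool"
  assumes "finite A" "\<And>c. c \<in> A \<Longrightarrow> \<exists>r. P c r" "\<And>c r r'. P c r \<Longrightarrow> r \<le> r' \<Longrightarrow> P c r'"
  shows "\<exists>r. \<forall>c\<in>A. P c r"
proof -
  obtain R where R: "\<And>c. c \<in> A \<Longrightarrow> P c (R c)" using assms(2) by metis
  have "R c \<le> sum R A" if "c \<in> A" for c
    using assms(1) that by (simp add: member_le_sum)
  then show ?thesis using assms(3) R by blast
qed

lemma laurent_h_uniform:
  assumes "finite A" "\<And>c. c \<in> A \<Longrightarrow> laurent_h scl (F c)"
  shows "\<exists>M. \<forall>c\<in>A. \<forall>n<M. F c n \<in> hpow scl k"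
proof -
  have "\<exists>r. \<forall>c\<in>A. \<forall>n < - int r. F c n \<in> hpow scl k"
  proof (rule finite_uniform_bound[OF assms(1)])
    fix c assume "c \<in> A"
    then obtain m0 where m0: "\<And>m. m \<le> m0 \<Longrightarrow> F c m \<in> hpow scl k"
      using assms(2) unfolding laurent_h_def by blast
    show "\<exists>r. \<forall>n < - int r. F c n \<in> hpow scl k"
      by (rule exI[of _ "nat (- m0)"]) (auto intro!: m0)
  qed auto
  then show ?thesis by blast
qed

section \<open>Multiplication by expanded \<open>R\<close>-matrix entries\<close>

lemma expo_of_2: "in_vars 2 f \<Longrightarrow> f = expo_of [f 0, f 1]"
  by (rule ext) (auto simp: in_vars_def expo_of_def less_Suc_eq not_less)

lemma in_vars_expo_of: "in_vars (length ps) (expo_of ps)"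
  by (simp add: in_vars_def expo_of_def)

text \<open>
  The exponent vectors of the expansion of \<open>f(h/\<phi>)\<close> for \<open>\<phi> = \<plusminus>(x - y)\<close>: the term
  \<open>x\<^bsup>-j-s\<^esup> y\<^sup>s\<close> comes from \<open>(h/\<phi>)\<^sup>j\<close>.
\<close>

definition expo_step :: "nat \<Rightarrow> nat \<Rightarrow> nat \<Rightarrow> nat \<Rightarrow> expo" where
  "expo_step x y j s = (\<lambda>v. if v = x then - int j - int s else if v = y then int s else 0)"

lemma subst_h_over_expo_step:
  assumes "x \<noteq> y" "\<epsilon> = 1 \<or> \<epsilon> = -1"
  shows "subst_h_over c [(\<epsilon>, x), (- \<epsilon>, y)] (expo_step x y j s) =
    fps_const (fps_nth c j * (\<epsilon> ^ j * ((- 1) ^ s * (- of_nat j gchoose s)))) * fps_X ^ j"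
proof -
  have deg: "total_degree [(\<epsilon>, x), (- \<epsilon>, y)] (expo_step x y j s) = - int j"
    using assms(1) by (simp add: total_degree_def expo_step_def)
  have sign: "\<epsilon> powi (- int j - int s) * (- \<epsilon>) ^ s = \<epsilon> ^ j * (- 1) ^ s"
  proof -
    have "\<epsilon> powi (- int j - int s) = \<epsilon> ^ j * \<epsilon> ^ s"
      using assms(2) by (auto simp: power_int_diff power_int_minus power_int_minus_left)
    then show ?thesis
      using assms(2) by (auto simp: mult.assoc simp flip: power_mult_distrib)
  qed
  have "lin_pow [(\<epsilon>, x), (- \<epsilon>, y)] (- int j) (expo_step x y j s) =
      (- of_nat j gchoose s) * \<epsilon> powi (- int j - int s) * (- \<epsilon>) ^ s"
    using assms(1) deg by (simp add: lin_pow_def Let_def) (simp add: expo_step_def)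
  also have "\<dots> = \<epsilon> ^ j * ((- 1) ^ s * (- of_nat j gchoose s))"
    by (simp only: sign mult.assoc) (metis sign mult.commute mult.left_commute)
  finally show ?thesis unfolding subst_h_over_def by (simp add: deg)
qed

lemma subst_h_over_support:
  assumes "x \<noteq> y" "subst_h_over c [(\<alpha>, x), (\<beta>, y)] e \<noteq> 0"
  obtains j s where "e = expo_step x y j s"
proof -
  define k where "k = nat (- total_degree [(\<alpha>, x), (\<beta>, y)] e)"
  have "lin_pow [(\<alpha>, x), (\<beta>, y)] (- int k) e \<noteq> 0"
    using assms(2) unfolding subst_h_over_def by (auto simp: k_def)
  then have e: "\<And>v. v \<noteq> x \<Longrightarrow> v \<noteq> y \<Longrightarrow> e v = 0" "e y \<ge> 0" "e x + e y = - int k"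
    unfolding lin_pow_def Let_def by (auto simp: total_degree_def split: if_splits)
  then have "e = expo_step x y k (nat (e y))" by (auto simp: expo_step_def)
  then show thesis by (rule that)
qed

lemma expo_step_inject:
  assumes "x \<noteq> y"
  shows "expo_step x y j s = expo_step x y j' s' \<longleftrightarrow> j = j' \<and> s = s'"
proof
  assume eq: "expo_step x y j s = expo_step x y j' s'"
  show "j = j' \<and> s = s'"
    using fun_cong[OF eq, of x] fun_cong[OF eq, of y] assms by (simp add: expo_step_def)
qed simp

text \<open>
  Modulo \<open>h\<^sup>k\<close> only the powers \<open>(h/\<phi>)\<^sup>j\<close> with \<open>j < k\<close> matter, and the lower bound on the exponents of \<open>y\<close>
  in \<open>X\<close> leaves finitely many terms of each expansion.
\<close>

lemma hfunctional_series_mult: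
  assumes tf: "topologically_free scl" and g: "hfunctional scl k g"
    and xy: "x \<noteq> y" and \<epsilon>: "\<epsilon> = 1 \<or> \<epsilon> = -1"
    and lower: "\<And>k. \<exists>M. \<forall>e'. e' y < M \<longrightarrow> X e' \<in> hpow scl k"
    and S: "\<And>e'. e' y \<le> e y - int S \<Longrightarrow> X e' \<in> hpow scl k"
  shows "g (series_mult scl (subst_h_over c [(\<epsilon>, x), (- \<epsilon>, y)]) X e) =
    (\<Sum>j<k. \<Sum>s<S. fps_nth c j * (\<epsilon> ^ j * ((- 1) ^ s * (- of_nat j gchoose s))) *
       g (scl (fps_X ^ j) (X (\<lambda>v. e v - expo_step x y j s v))))"
proof -
  note m = topologically_free_module[OF tf]
  interpret module scl by (rule m)
  define K where "K = subst_h_over c [(\<epsilon>, x), (- \<epsilon>, y)]"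
  define t where "t = (\<lambda>d. scl (K d) (X (\<lambda>v. e v - d v)))"
  have t_step: "t (expo_step x y j s) = scl (fps_const (fps_nth c j * (\<epsilon> ^ j * ((- 1) ^ s * (- of_nat j gchoose s))))
      * fps_X ^ j) (X (\<lambda>v. e v - expo_step x y j s v))" for j s
    unfolding t_def K_def subst_h_over_expo_step[OF xy \<epsilon>] ..
  have t_hpow: "t d \<in> hpow scl k'"
    if low: "\<And>e'. e' y \<le> e y - int S' \<Longrightarrow> X e' \<in> hpow scl k'"
      and out: "d \<notin> (\<lambda>(j, s). expo_step x y j s) ` ({..<k'} \<times> {..<S'})" for d k' S'
  proof (cases "K d = 0")
    case True
    then show ?thesis by (simp add: t_def hpow_0[OF m])
  next
    case False
    then obtain j s where d: "d = expo_step x y j s"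
      unfolding K_def by (rule subst_h_over_support[OF xy])
    then consider "k' \<le> j" | "S' \<le> s" using out by force
    then show ?thesis
    proof cases
      case 1
      then show ?thesis unfolding d t_step by (rule hpow_scale_power[OF m])
    next
      case 2
      then show ?thesis unfolding t_def d
        using xy by (intro hpow_scale[OF m] low) (simp add: expo_step_def)
    qed
  qed
  have "finite {d \<in> UNIV. t d \<notin> hpow scl k'}" for k'
  proof -
    obtain M where M: "\<And>e'. e' y < M \<Longrightarrow> X e' \<in> hpow scl k'" using lower by blast
    have "{d \<in> UNIV. t d \<notin> hpow scl k'} \<subseteq>
        (\<lambda>(j, s). expo_step x y j s) ` ({..<k'} \<times> {..<nat (e y - M + 1)})"
    proof (rule subsetI, rule ccontr)
      fix d
      assume "d \<in> {d \<in> UNIV. t d \<notin> hpow scl k'}"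
        and out: "d \<notin> (\<lambda>(j, s). expo_step x y j s) ` ({..<k'} \<times> {..<nat (e y - M + 1)})"
      moreover have "t d \<in> hpow scl k'"
        by (rule t_hpow[OF _ out], rule M) (simp split: if_splits)
      ultimately show False by simp
    qed
    then show ?thesis by (rule finite_subset) auto
  qed
  then have summable: "hsummable scl UNIV t" by (auto simp: hsummable_def)
  have "g (series_mult scl K X e) = g (hsum scl UNIV t)" by (simp add: series_mult_def t_def)
  also have "\<dots> = (\<Sum>d\<in>(\<lambda>(j, s). expo_step x y j s) ` ({..<k} \<times> {..<S}). g (t d))"
    by (rule hfunctional_hsum[OF tf g summable])
      (use t_hpow[OF S] hfunctional_simps(6)[OF g] in auto)
  also have "\<dots> = (\<Sum>(j, s)\<in>{..<k} \<times> {..<S}. g (t (expo_step x y j s)))"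
    by (subst sum.reindex) (auto simp: inj_on_def expo_step_inject[OF xy] intro!: sum.cong)
  also have "\<dots> = (\<Sum>j<k. \<Sum>s<S. g (t (expo_step x y j s)))"
    by (simp add: sum.cartesian_product)
  finally show ?thesis
    by (simp only: K_def t_step scale_scale[symmetric] hfunctional_simps(5)[OF g])
qed

lemma hfunctional_series_mult_01:
  assumes tf: "topologically_free scl" and g: "hfunctional scl k g"
    and \<epsilon>: "\<epsilon> = 1 \<or> \<epsilon> = -1"
    and lower: "\<And>k. \<exists>M. \<forall>m n. n < M \<longrightarrow> Z m n \<in> hpow scl k"
    and M: "\<And>m n. n < M \<Longrightarrow> Z m n \<in> hpow scl k"
  shows "g (series_mult scl (subst_h_over c [(\<epsilon>, 0), (- \<epsilon>, 1)]) (\<lambda>e. Z (e 0) (e 1)) (expo_of [p, q])) =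
    (\<Sum>j<k. \<epsilon> ^ j * fps_nth c j * diff_pow M j (\<lambda>m n. g (scl (fps_X ^ j) (Z m n))) p q)"
proof -
  have "g (series_mult scl (subst_h_over c [(\<epsilon>, 0), (- \<epsilon>, 1)]) (\<lambda>e. Z (e 0) (e 1)) (expo_of [p, q])) =
    (\<Sum>j<k. \<Sum>s<nat (q - M + 1). fps_nth c j * (\<epsilon> ^ j * ((- 1) ^ s * (- of_nat j gchoose s))) *
       g (scl (fps_X ^ j) (Z (p + int j + int s) (q - int s))))"
  proof (subst hfunctional_series_mult[OF tf g _ \<epsilon>, where S = "nat (q - M + 1)"])
    show "\<exists>M. \<forall>e'. e' 1 < M \<longrightarrow> Z (e' 0) (e' 1) \<in> hpow scl k" for k using lower[of k] by auto
    show "Z (e' 0) (e' 1) \<in> hpow scl k" if "e' 1 \<le> expo_of [p, q] 1 - int (nat (q - M + 1))" for e' :: expo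
      using that by (intro M) (simp add: expo_of_def split: if_splits)
  qed (simp_all add: expo_of_def expo_step_def algebra_simps)
  then show ?thesis by (simp add: diff_pow_def sum_distrib_left mult_ac)
qed

lemma hfunctional_series_mult_10:
  assumes tf: "topologically_free scl" and g: "hfunctional scl k g"
    and \<epsilon>: "\<epsilon> = 1 \<or> \<epsilon> = -1"
    and lower: "\<And>k. \<exists>M. \<forall>m n. m < M \<longrightarrow> Z m n \<in> hpow scl k"
    and M: "\<And>m n. m < M \<Longrightarrow> Z m n \<in> hpow scl k"
  shows "g (series_mult scl (subst_h_over c [(\<epsilon>, 1), (- \<epsilon>, 0)]) (\<lambda>e. Z (e 0) (e 1)) (expo_of [p, q])) =
    (\<Sum>j<k. \<epsilon> ^ j * fps_nth c j * diff_pow M j (\<lambda>n m. g (scl (fps_X ^ j) (Z m n))) q p)"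
proof -
  have "g (series_mult scl (subst_h_over c [(\<epsilon>, 1), (- \<epsilon>, 0)]) (\<lambda>e. Z (e 0) (e 1)) (expo_of [p, q])) =
    (\<Sum>j<k. \<Sum>s<nat (p - M + 1). fps_nth c j * (\<epsilon> ^ j * ((- 1) ^ s * (- of_nat j gchoose s))) *
       g (scl (fps_X ^ j) (Z (p - int s) (q + int j + int s))))"
  proof (subst hfunctional_series_mult[OF tf g _ \<epsilon>, where S = "nat (p - M + 1)"])
    show "\<exists>M. \<forall>e'. e' 0 < M \<longrightarrow> Z (e' 0) (e' 1) \<in> hpow scl k" for k using lower[of k] by auto
    show "Z (e' 0) (e' 1) \<in> hpow scl k" if "e' 0 \<le> expo_of [p, q] 0 - int (nat (p - M + 1))" for e' :: expo
      using that by (intro M) (simp add: expo_of_def split: if_splits)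
  qed (simp_all add: expo_of_def expo_step_def algebra_simps)
  then show ?thesis by (simp add: diff_pow_def sum_distrib_left mult_ac)
qed

lemma lin_pow_sum:
  "lin_pow [(1, 0), (1, 1)] m (expo_of [x, y]) =
    (if 0 \<le> y \<and> x + y = m then of_int m gchoose nat y else 0)"
  by (auto simp: lin_pow_def Let_def total_degree_def expo_of_def)

lemma lin_pow_sum_vars:
  assumes "lin_pow [(1, 0), (1, 1)] m d \<noteq> 0" shows "in_vars 2 d"
proof -
  have "\<forall>v. v \<notin> {0, 1} \<longrightarrow> d v = 0"
    using assms unfolding lin_pow_def Let_def by (auto split: if_splits)
  then show ?thesis by (auto simp: in_vars_def)
qed

lemma expo_of_diff: "(\<lambda>v. expo_of [p, q] v - expo_of [x, y] v) = expo_of [p - x, q - y]"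
  by (rule ext) (auto simp: expo_of_def less_Suc_eq)

text \<open>
  For a polynomial factor the sum is finite, whatever the series \<open>X\<close> is.
\<close>

lemma hfunctional_mult_power_of_sum:
  assumes tf: "topologically_free scl" and g: "hfunctional scl k g"
  shows "g (series_mult scl (\<lambda>d. fps_const (lin_pow [(1, 0), (1, 1)] (int r) d)) X (expo_of [p, q])) =
    (mult_by_sum ^^ r) (\<lambda>p q. g (X (expo_of [p, q]))) p q"
proof -
  interpret module scl by (rule topologically_free_module[OF tf])
  define t where "t = (\<lambda>d. scl (fps_const (lin_pow [(1, 0), (1, 1)] (int r) d)) (X (\<lambda>v. expo_of [p, q] v - d v)))"
  define h where "h = (\<lambda>i. expo_of [int r - int i, int i])"
  have t: "t (h i) = scl (fps_const (of_nat (r choose i))) (X (expo_of [p - int r + int i, q - int i]))" for i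
    unfolding t_def h_def lin_pow_sum expo_of_diff by (simp add: binomial_gbinomial algebra_simps)
  have "hsum scl UNIV t = (\<Sum>d\<in>h ` {..r}. t d)"
  proof (rule hsum_finite[OF tf])
    fix d assume d: "d \<in> UNIV - h ` {..r}"
    show "t d = 0"
    proof (rule ccontr)
      assume "t d \<noteq> 0"
      then have nz: "lin_pow [(1, 0), (1, 1)] (int r) d \<noteq> 0" by (auto simp: t_def)
      then have d01: "d = expo_of [d 0, d 1]" by (intro expo_of_2 lin_pow_sum_vars)
      with nz have "lin_pow [(1, 0), (1, 1)] (int r) (expo_of [d 0, d 1]) \<noteq> 0" by simp
      then have "0 \<le> d 1" "d 0 + d 1 = int r" by (auto simp: lin_pow_sum simp del: One_nat_def split: if_splits)
      then have "d 0 = int r - int (nat (d 1))" "d 1 = int (nat (d 1))" by auto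
      with d01 have dh: "d = h (nat (d 1))" by (simp only: h_def)
      with d have "nat (d 1) > r" by (metis DiffD2 atMost_iff image_eqI not_le)
      then have "t (h (nat (d 1))) = 0" unfolding t by (simp only: binomial_eq_0) simp
      then show False using \<open>t d \<noteq> 0\<close> by (simp only: dh[symmetric])
    qed
  qed auto
  moreover have "inj_on h {..r}"
  proof (rule inj_onI)
    fix i j assume "h i = h j"
    from fun_cong[OF this, of 1] show "i = j" by (simp add: h_def expo_of_def)
  qed
  ultimately have "hsum scl UNIV t = (\<Sum>i\<le>r. t (h i))" by (simp add: sum.reindex)
  then show ?thesis
    unfolding series_mult_def t_def[symmetric] mult_by_sum_power
    by (simp add: t hfunctional_simps(4,5)[OF g])
qed

section \<open>Matrices over \<open>\<complex>[[h]]\<close> and unitarity of \<open>R\<close>\<close>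

definition entry :: "'n::finite rmatrix \<Rightarrow> 'n list \<Rightarrow> 'n list \<Rightarrow> complex fps" where
  "entry M a b = M $ (a ! 0, a ! 1) $ (b ! 0, b ! 1)"

lemma leg_01: "length a = 2 \<Longrightarrow> leg M \<phi> 0 1 a b = subst_h_over (entry M a b) \<phi>"
  by (auto simp: leg_def entry_def)

lemma length_2_conv: "length c = 2 \<longleftrightarrow> (\<exists>x y. c = [x, y])"
  by (auto simp: length_Suc_conv numeral_2_eq_2)

lemma bij_betw_lists_2: "bij_betw (\<lambda>(x, y). [x, y]) UNIV {c. length c = 2}"
  by (rule bij_betwI[of _ _ _ "\<lambda>c. (c ! 0, c ! 1)"]) (auto simp: length_2_conv)

lemma finite_lists_2 [simp]: "finite {c :: 'n::finite list. length c = 2}"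
  using finite_lists_length_eq[of "UNIV :: 'n set" 2] by simp

lemma entry_mult:
  "entry (A ** B) a b = (\<Sum>c | length c = 2. entry A a c * entry B c b)"
proof -
  have "(\<Sum>c | length c = 2. entry A a c * entry B c b) =
      (\<Sum>xy\<in>UNIV. entry A a (case xy of (x, y) \<Rightarrow> [x, y]) * entry B (case xy of (x, y) \<Rightarrow> [x, y]) b)"
    by (rule sum.reindex_bij_betw[OF bij_betw_lists_2, symmetric])
  then show ?thesis by (simp add: matrix_matrix_mult_def entry_def case_prod_beta)
qed

lemma entry_mat_1:
  assumes "length a = 2" "length b = 2"
  shows "entry (mat 1) a b = (if a = b then 1 else 0)"
  using assms by (auto simp: entry_def mat_def length_2_conv)

lemma sum_lists_2_rev: "(\<Sum>c | length c = 2. F (rev c)) = (\<Sum>c | length c = 2. F c)"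
  by (rule sum.reindex_bij_witness[of _ rev rev]) auto

text \<open>
  Coefficientwise form of \<open>A B U = U\<close> for mutually inverse matrices over \<open>\<complex>[[h/u]]\<close>.  Here \<open>G c n\<close> is what
  the form gives for \<open>(h/u)\<^sup>n\<close> times the component \<open>c\<close> of \<open>U\<close>; it vanishes for \<open>n \<ge> k\<close> since the form kills
  \<open>h\<^sup>k\<close>.
\<close>

lemma matrix_cancel:
  fixes G :: "'n::finite list \<Rightarrow> nat \<Rightarrow> complex"
  assumes AB: "A ** B = mat 1" and a: "length a = 2" and "k > 0"
    and G: "\<And>c i. i \<ge> k \<Longrightarrow> G c i = 0"
  shows "(\<Sum>c | length c = 2. \<Sum>j<k. fps_nth (entry A a c) j *
      (\<Sum>c' | length c' = 2. \<Sum>i<k. fps_nth (entry B c c') i * G c' (i + j))) = G a 0"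
proof -
  have inner: "(\<Sum>j<k. \<Sum>i<k. u j * v i * G c' (i + j)) =
      (\<Sum>n<k. (\<Sum>j\<le>n. u j * v (n - j)) * G c' n)" for c' and u v :: "nat \<Rightarrow> complex"
  proof -
    have "(\<Sum>j<k. \<Sum>i<k. u j * v i * G c' (i + j)) = (\<Sum>(j, i)\<in>{..<k} \<times> {..<k}. u j * v i * G c' (j + i))"
      by (simp add: sum.cartesian_product add.commute)
    also have "\<dots> = (\<Sum>(j, i)\<in>{(j, i). j + i < k}. u j * v i * G c' (j + i))"
      by (rule sum.mono_neutral_right) (auto, metis G not_less)
    also have "\<dots> = (\<Sum>n<k. \<Sum>j\<le>n. u j * v (n - j) * G c' (j + (n - j)))"
      by (rule sum.triangle_reindex)
    finally show ?thesis by (simp add: sum_distrib_right)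
  qed
  have "(\<Sum>c | length c = 2. \<Sum>j<k. fps_nth (entry A a c) j *
      (\<Sum>c' | length c' = 2. \<Sum>i<k. fps_nth (entry B c c') i * G c' (i + j))) =
    (\<Sum>c | length c = 2. \<Sum>c' | length c' = 2. \<Sum>j<k. \<Sum>i<k.
       fps_nth (entry A a c) j * fps_nth (entry B c c') i * G c' (i + j))"
    by (rule sum.cong[OF refl], subst sum.swap) (simp add: sum_distrib_left mult.assoc)
  also have "\<dots> = (\<Sum>c' | length c' = 2. \<Sum>c | length c = 2.
      (\<Sum>n<k. fps_nth (entry A a c * entry B c c') n * G c' n))"
    by (subst sum.swap) (simp add: inner fps_mult_nth atMost_atLeast0)
  also have "\<dots> = (\<Sum>c' | length c' = 2. \<Sum>n<k. fps_nth (entry (mat 1) a c') n * G c' n)"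
    unfolding AB[symmetric] entry_mult
    by (rule sum.cong[OF refl], subst sum.swap) (simp add: fps_sum_nth sum_distrib_right)
  also have "\<dots> = (\<Sum>c' | length c' = 2. if c' = a then (\<Sum>n<k. if n = 0 then G a n else 0) else 0)"
    by (intro sum.cong refl)
      (auto simp: entry_mat_1 a if_distrib[of "\<lambda>x. x * _"] cong: if_cong)
  also have "\<dots> = G a 0" using a \<open>k > 0\<close> by simp
  finally show ?thesis .
qed

text \<open>
  As \<open>fps_X\<close> stands for \<open>h/u\<close>, this is \<open>M(-u)\<close>.
\<close>

definition h_negate :: "'n::finite rmatrix \<Rightarrow> 'n rmatrix" where
  "h_negate M = (\<chi> p q. M $ p $ q oo (- fps_X))"

lemma entry_h_negate: "fps_nth (entry (h_negate M) a b) j = (- 1) ^ j * fps_nth (entry M a b) j"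
  by (simp add: entry_def h_negate_def fps_compose_uminus')

definition R_norm :: "complex \<Rightarrow> 'n::finite rmatrix" where
  "R_norm \<eta> = (\<chi> p q. inverse (1 - fps_const \<eta> * fps_X) * R_mat $ p $ q)"

lemma R_plus_eq: "R_plus = R_norm 1" and R_minus_eq: "R_minus = R_norm (- 1)"
  by (simp_all add: R_plus_def R_minus_def R_norm_def flip: fps_const_neg)

lemma h_negate_R_norm:
  "h_negate (R_norm \<eta>) = (\<chi> p q. inverse (1 + fps_const \<eta> * fps_X) *
     ((if p = q then 1 else 0) + (if p = prod.swap q then fps_X else 0)))"
proof -
  have mult: "(f * g) oo (- fps_X) = (f oo (- fps_X)) * (g oo (- fps_X))" for f g :: "complex fps"
    by (rule fps_compose_mult_distrib) simp
  have "(1 - fps_const \<eta> * fps_X) oo (- fps_X) = (1 + fps_const \<eta> * fps_X :: complex fps)"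
    by (simp only: fps_compose_sub_distrib mult) simp
  then have "inverse (1 - fps_const \<eta> * fps_X) oo (- fps_X) = inverse (1 + fps_const \<eta> * fps_X :: complex fps)"
    by (subst fps_inverse_compose) simp_all
  moreover have "((if P then 1 else 0) - (if Q then fps_X else 0)) oo (- fps_X) =
      (if P then 1 else 0) + (if Q then fps_X else (0 :: complex fps))" for P Q
    by (simp add: fps_compose_sub_distrib)
  ultimately show ?thesis
    unfolding h_negate_def R_norm_def R_mat_def by (simp only: mult vec_eq_iff vec_lambda_beta simp_thms)
qed

text \<open>
  Unitarity of the \<open>R\<close>-matrix: as \<open>P\<^sup>2 = 1\<close>, one has \<open>(1 - P h/u) (1 + P h/u) = 1 - h\<^sup>2/u\<^sup>2\<close>, which is
  cancelled by the normalizing factors.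
\<close>

lemma R_norm_h_negate_inverse:
  assumes "\<eta> = 1 \<or> \<eta> = - 1"
  shows "R_norm \<eta> ** h_negate (R_norm \<eta>) = mat 1" "h_negate (R_norm \<eta>) ** R_norm \<eta> = mat 1"
proof -
  have unit: "inverse (1 - fps_const \<eta> * fps_X) * inverse (1 + fps_const \<eta> * fps_X) * (1 - fps_X\<^sup>2) = (1 :: complex fps)"
  proof -
    let ?f = "1 - fps_const \<eta> * fps_X :: complex fps" and ?g = "1 + fps_const \<eta> * fps_X :: complex fps"
    have "inverse ?f * inverse ?g * (1 - fps_X\<^sup>2) = (inverse ?f * ?f) * (inverse ?g * ?g)"
      using assms by (auto simp: algebra_simps power2_eq_square simp flip: fps_const_neg)
    moreover have "inverse ?f * ?f = 1" "inverse ?g * ?g = 1"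
      by (rule inverse_mult_eq_1, simp)+
    ultimately show ?thesis by simp
  qed
  define P :: "'n::finite rmatrix" where "P = (\<chi> p q. if p = prod.swap q then fps_X else 0)"
  have PP: "(\<Sum>r\<in>UNIV. P $ p $ r * P $ r $ q) = (if p = q then fps_X\<^sup>2 else 0)" for p q
  proof -
    have "(\<Sum>r\<in>UNIV. P $ p $ r * P $ r $ q) = (\<Sum>r\<in>UNIV. if r = prod.swap q then P $ p $ r * fps_X else 0)"
      by (intro sum.cong refl) (simp add: P_def)
    then show ?thesis by (simp add: P_def power2_eq_square)
  qed
  let ?I = "\<lambda>p q. if p = q then 1 else 0 :: complex fps"
  have prod: "(\<Sum>r\<in>UNIV. (?I p r - P $ p $ r) * (?I r q + P $ r $ q)) = (1 - fps_X\<^sup>2) * ?I p q"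
    "(\<Sum>r\<in>UNIV. (?I p r + P $ p $ r) * (?I r q - P $ r $ q)) = (1 - fps_X\<^sup>2) * ?I p q" for p q
    by (simp_all add: distrib_left distrib_right left_diff_distrib right_diff_distrib sum.distrib sum_subtractf PP if_distrib[of "\<lambda>x. _ * x"]
        if_distrib[of "\<lambda>x. x * _"] cong: if_cong)
  have R: "R_norm \<eta> $ p $ q = inverse (1 - fps_const \<eta> * fps_X) * (?I p q - P $ p $ q)"
    and R': "h_negate (R_norm \<eta>) $ p $ q = inverse (1 + fps_const \<eta> * fps_X) * (?I p q + P $ p $ q)"
    for p q :: "'n \<times> 'n"
    by (simp_all add: h_negate_R_norm) (simp_all add: R_norm_def R_mat_def P_def)
  show "R_norm \<eta> ** h_negate (R_norm \<eta>) = (mat 1 :: 'n rmatrix)"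
    "h_negate (R_norm \<eta>) ** R_norm \<eta> = (mat 1 :: 'n rmatrix)"
  proof -
    have "(\<Sum>r\<in>UNIV. R_norm \<eta> $ p $ r * h_negate (R_norm \<eta>) $ r $ q) = ?I p q"
      "(\<Sum>r\<in>UNIV. h_negate (R_norm \<eta>) $ p $ r * R_norm \<eta> $ r $ q) = ?I p q" for p q :: "'n \<times> 'n"
    proof -
      have "(\<Sum>r\<in>UNIV. R_norm \<eta> $ p $ r * h_negate (R_norm \<eta>) $ r $ q) =
          inverse (1 - fps_const \<eta> * fps_X) * inverse (1 + fps_const \<eta> * fps_X) *
          (\<Sum>r\<in>UNIV. (?I p r - P $ p $ r) * (?I r q + P $ r $ q))"
        unfolding R R' sum_distrib_left by (intro sum.cong refl) (simp only: mult_ac)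
      then show "(\<Sum>r\<in>UNIV. R_norm \<eta> $ p $ r * h_negate (R_norm \<eta>) $ r $ q) = ?I p q"
        by (simp only: prod mult.assoc[symmetric] unit mult_1)
      have "(\<Sum>r\<in>UNIV. h_negate (R_norm \<eta>) $ p $ r * R_norm \<eta> $ r $ q) =
          inverse (1 - fps_const \<eta> * fps_X) * inverse (1 + fps_const \<eta> * fps_X) *
          (\<Sum>r\<in>UNIV. (?I p r + P $ p $ r) * (?I r q - P $ r $ q))"
        unfolding R R' sum_distrib_left by (intro sum.cong refl) (simp only: mult_ac)
      then show "(\<Sum>r\<in>UNIV. h_negate (R_norm \<eta>) $ p $ r * R_norm \<eta> $ r $ q) = ?I p q"
        by (simp only: prod mult.assoc[symmetric] unit mult_1)
    qed
    then show "R_norm \<eta> ** h_negate (R_norm \<eta>) = (mat 1 :: 'n rmatrix)"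
      "h_negate (R_norm \<eta>) ** R_norm \<eta> = (mat 1 :: 'n rmatrix)"
      by (simp_all add: matrix_matrix_mult_def mat_def vec_eq_iff)
  qed
qed

text \<open>
  The last statement is \<open>P R(u) P = R(u)\<close>, that is, \<open>R\<^sub>2\<^sub>1(u) = R\<^sub>1\<^sub>2(u)\<close>.
\<close>

lemma matrix_inv_R:
  fixes Rb :: "'n::finite rmatrix"
  assumes "Rb = R_plus \<or> Rb = R_minus"
  shows "Rb ** h_negate Rb = mat 1" "h_negate Rb ** Rb = mat 1" "matrix_inv Rb = h_negate Rb"
    "entry Rb [x1, x2] [y1, y2] = entry Rb [x2, x1] [y2, y1]"
proof -
  obtain \<eta> where \<eta>: "\<eta> = 1 \<or> \<eta> = - 1" and Rb: "Rb = R_norm \<eta>"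
    using assms
  proof
    assume "Rb = R_plus" then show thesis using that[of 1] by (simp add: R_plus_eq)
  next
    assume "Rb = R_minus" then show thesis using that[of "- 1"] by (simp add: R_minus_eq)
  qed
  show 1: "Rb ** h_negate Rb = mat 1" and 2: "h_negate Rb ** Rb = mat 1"
    unfolding Rb by (rule R_norm_h_negate_inverse[OF \<eta>])+
  have inv: "Rb ** matrix_inv Rb = mat 1 \<and> matrix_inv Rb ** Rb = mat 1"
    unfolding matrix_inv_def by (rule someI[of _ "h_negate Rb"]) (use 1 2 in simp)
  have "matrix_inv Rb = (h_negate Rb ** Rb) ** matrix_inv Rb" by (simp add: 2)
  also have "\<dots> = h_negate Rb" using inv by (simp flip: matrix_mul_assoc)
  finally show "matrix_inv Rb = h_negate Rb" .
  show "entry Rb [x1, x2] [y1, y2] = entry Rb [x2, x1] [y2, y1]"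
    by (simp add: Rb entry_def R_norm_def R_mat_def conj_commute)
qed

lemma hfunctional_lmult_01:
  assumes tf: "topologically_free scl" and g: "hfunctional scl k g" and \<epsilon>: "\<epsilon> = 1 \<or> \<epsilon> = -1"
    and lower: "\<And>c k. length c = 2 \<Longrightarrow> \<exists>M. \<forall>m n. n < M \<longrightarrow> Z c b m n \<in> hpow scl k"
    and M: "\<And>c m n. length c = 2 \<Longrightarrow> n < M \<Longrightarrow> Z c b m n \<in> hpow scl k"
    and a: "length a = 2"
  shows "g (lmult scl 2 (leg R [(\<epsilon>, 0), (- \<epsilon>, 1)] 0 1) (\<lambda>a b e. Z a b (e 0) (e 1)) a b (expo_of [p, q])) =
    (\<Sum>c | length c = 2. \<Sum>j<k. \<epsilon> ^ j * fps_nth (entry R a c) j *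
       diff_pow M j (\<lambda>m n. g (scl (fps_X ^ j) (Z c b m n))) p q)"
  unfolding lmult_def hfunctional_simps(4)[OF g] leg_01[OF a]
  by (intro sum.cong refl hfunctional_series_mult_01[OF tf g \<epsilon>] lower M) simp_all

lemma hfunctional_rmult_01:
  assumes tf: "topologically_free scl" and g: "hfunctional scl k g" and \<epsilon>: "\<epsilon> = 1 \<or> \<epsilon> = -1"
    and lower: "\<And>c k. length c = 2 \<Longrightarrow> \<exists>M. \<forall>m n. n < M \<longrightarrow> Z a c m n \<in> hpow scl k"
    and M: "\<And>c m n. length c = 2 \<Longrightarrow> n < M \<Longrightarrow> Z a c m n \<in> hpow scl k"
  shows "g (rmult scl 2 (\<lambda>a b e. Z a b (e 0) (e 1)) (leg R [(\<epsilon>, 0), (- \<epsilon>, 1)] 0 1) a b (expo_of [p, q])) =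
    (\<Sum>c | length c = 2. \<Sum>j<k. \<epsilon> ^ j * fps_nth (entry R c b) j *
       diff_pow M j (\<lambda>m n. g (scl (fps_X ^ j) (Z a c m n))) p q)"
proof -
  have "g (rmult scl 2 (\<lambda>a b e. Z a b (e 0) (e 1)) (leg R [(\<epsilon>, 0), (- \<epsilon>, 1)] 0 1) a b (expo_of [p, q])) =
    (\<Sum>c | length c = 2. g (series_mult scl (subst_h_over (entry R c b) [(\<epsilon>, 0), (- \<epsilon>, 1)])
       (\<lambda>e. Z a c (e 0) (e 1)) (expo_of [p, q])))"
    unfolding rmult_def hfunctional_simps(4)[OF g] by (intro sum.cong refl) (simp only: leg_01 mem_Collect_eq)
  also have "\<dots> = (\<Sum>c | length c = 2. \<Sum>j<k. \<epsilon> ^ j * fps_nth (entry R c b) j *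
       diff_pow M j (\<lambda>m n. g (scl (fps_X ^ j) (Z a c m n))) p q)"
    by (intro sum.cong refl hfunctional_series_mult_01[OF tf g \<epsilon>] lower M) simp_all
  finally show ?thesis .
qed

lemma hfunctional_rmult_10:
  assumes tf: "topologically_free scl" and g: "hfunctional scl k g" and \<epsilon>: "\<epsilon> = 1 \<or> \<epsilon> = -1"
    and lower: "\<And>c k. length c = 2 \<Longrightarrow> \<exists>M. \<forall>m n. m < M \<longrightarrow> Z a c m n \<in> hpow scl k"
    and M: "\<And>c m n. length c = 2 \<Longrightarrow> m < M \<Longrightarrow> Z a c m n \<in> hpow scl k"
  shows "g (rmult scl 2 (\<lambda>a b e. Z a b (e 0) (e 1)) (leg R [(\<epsilon>, 1), (- \<epsilon>, 0)] 0 1) a b (expo_of [p, q])) =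
    (\<Sum>c | length c = 2. \<Sum>j<k. \<epsilon> ^ j * fps_nth (entry R c b) j *
       diff_pow M j (\<lambda>n m. g (scl (fps_X ^ j) (Z a c m n))) q p)"
proof -
  have "g (rmult scl 2 (\<lambda>a b e. Z a b (e 0) (e 1)) (leg R [(\<epsilon>, 1), (- \<epsilon>, 0)] 0 1) a b (expo_of [p, q])) =
    (\<Sum>c | length c = 2. g (series_mult scl (subst_h_over (entry R c b) [(\<epsilon>, 1), (- \<epsilon>, 0)])
       (\<lambda>e. Z a c (e 0) (e 1)) (expo_of [p, q])))"
    unfolding rmult_def hfunctional_simps(4)[OF g] by (intro sum.cong refl) (simp only: leg_01 mem_Collect_eq)
  also have "\<dots> = (\<Sum>c | length c = 2. \<Sum>j<k. \<epsilon> ^ j * fps_nth (entry R c b) j *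
       diff_pow M j (\<lambda>n m. g (scl (fps_X ^ j) (Z a c m n))) q p)"
    by (intro sum.cong refl hfunctional_series_mult_10[OF tf g \<epsilon>] lower M) simp_all
  finally show ?thesis .
qed

section \<open>The operators \<open>L(z)\<close> on \<open>V(R)\<close>\<close>

lemma sum_single: "(\<Sum>i\<in>A. Poly_Mapping.single x (f i)) = Poly_Mapping.single x (\<Sum>i\<in>A. f i :: complex)"
  by (induction A rule: infinite_finite_induct) (simp_all add: single_add)

lemma fps_const_sum: "fps_const (\<Sum>i\<in>A. f i) = (\<Sum>i\<in>A. fps_const (f i :: 'a::comm_monoid_add))"
  by (rule fps_ext) (simp add: fps_sum_nth)

lemma free_scale_nth:
  "fps_nth (free_scale c x) n = (\<Sum>i\<le>n. Poly_Mapping.single 0 (fps_nth c i) * fps_nth x (n - i))"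
  by (simp add: free_scale_def fps_mult_nth atMost_atLeast0)

lemma free_scale_const: "free_scale (fps_const c) x = fps_const (Poly_Mapping.single 0 c) * x"
  unfolding free_scale_def by (rule arg_cong[of _ _ "\<lambda>y. y * x"]) (rule fps_ext, simp)

text \<open>
  The relators are convergent sums in the free algebra, so the evaluation of such sums is needed there
  as well.
\<close>

lemma topologically_free_free_scale: "topologically_free (free_scale :: complex fps \<Rightarrow> 'x free_alg \<Rightarrow> _)"
proof -
  define \<iota> :: "complex fps \<Rightarrow> 'x free_alg" where
    "\<iota> c = Abs_fps (\<lambda>n. Poly_Mapping.single 0 (fps_nth c n))" for c
  have scale: "free_scale c x = \<iota> c * x" for c and x :: "'x free_alg"
    by (simp add: free_scale_def \<iota>_def)
  have \<iota>: "\<iota> (c + d) = \<iota> c + \<iota> d" "\<iota> (c * d) = \<iota> c * \<iota> d" "\<iota> 1 = 1" for c d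
    by (rule fps_ext, simp add: \<iota>_def single_add fps_mult_nth mult_single sum_single)+
  have module: "module (free_scale :: complex fps \<Rightarrow> 'x free_alg \<Rightarrow> _)"
    by unfold_locales (simp_all add: scale \<iota> algebra_simps)
  interpret C: module "\<lambda>c::complex. free_scale (fps_const c) :: 'x free_alg \<Rightarrow> _"
    by unfold_locales (simp_all add: scale \<iota> algebra_simps flip: fps_const_add fps_const_mult)
  define \<phi> :: "'x free_alg \<Rightarrow> 'x free_alg fps" where "\<phi> x = Abs_fps (\<lambda>n. fps_const (fps_nth x n))" for x
  have "C.subspace (range fps_const)"
    by (rule C.subspaceI) (auto simp: free_scale_const simp flip: fps_const_0_eq_0)
  moreover have "bij_betw \<phi> UNIV {f. \<forall>n. fps_nth f n \<in> range fps_const}"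
  proof (rule bij_betwI[of _ _ _ "\<lambda>f. Abs_fps (\<lambda>n. fps_nth (fps_nth f n) 0)"])
    fix f :: "'x free_alg fps" assume "f \<in> {f. \<forall>n. fps_nth f n \<in> range fps_const}"
    then have "fps_const (fps_nth (fps_nth f n) 0) = fps_nth f n" for n
      by (metis (no_types, lifting) fps_nth_fps_const imageE mem_Collect_eq)
    then show "\<phi> (Abs_fps (\<lambda>n. fps_nth (fps_nth f n) 0)) = f"
      by (intro fps_ext) (simp add: \<phi>_def)
  qed (auto simp: \<phi>_def fps_eq_iff)
  moreover have "\<phi> (x + y) = \<phi> x + \<phi> y" for x y
    by (rule fps_ext) (simp add: \<phi>_def)
  moreover have "fps_nth (\<phi> (free_scale a x)) n =
      (\<Sum>i\<le>n. free_scale (fps_const (fps_nth a i)) (fps_nth (\<phi> x) (n - i)))" for a x n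
    by (simp add: \<phi>_def free_scale_nth fps_const_sum free_scale_const)
  ultimately show ?thesis unfolding topologically_free_def using module by blast
qed

lemma L_plus_br_2:
  "L_plus_br l 2 = (\<lambda>a b e. l_plus l (a ! 0) (b ! 0) (e 0) * l_plus l (a ! 1) (b ! 1) (e 1))"
  by (intro ext) (simp add: L_plus_br_def numeral_2_eq_2)

lemma L_br_2:
  "L_br Rb scl L 2 v = lmult scl 2 (leg Rb [(1, 0), (-1, 1)] 0 1)
     (\<lambda>a b e. L (a ! 0) (b ! 0) (e 0) (L (a ! 1) (b ! 1) (e 1) v))"
  by (simp add: L_br_def numeral_2_eq_2)

text \<open>
  The part of the structure of \<open>V(R)\<close> that enters the argument: the algebra \<open>A(R)\<close>, the operators \<open>L(z)\<close>
  and the vertex operator map.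
\<close>

locale Rbar_algebra =
  fixes Rb :: "'n::finite rmatrix"
    and scl :: "complex fps \<Rightarrow> 'v::ring_1 \<Rightarrow> 'v"
    and l :: "'n \<Rightarrow> 'n \<Rightarrow> nat \<Rightarrow> 'v"
    and L :: "'n \<Rightarrow> 'n \<Rightarrow> int \<Rightarrow> 'v \<Rightarrow> 'v"
    and Y :: "'v \<Rightarrow> 'v \<Rightarrow> int \<Rightarrow> 'v"
  assumes R: "Rb = R_plus \<or> Rb = R_minus"
    and A: "is_A_Rbar Rb scl l"
    and L: "is_L_operator Rb scl l L"
    and Y: "is_vertex_map Rb scl l L Y"
begin

lemma tf: "topologically_free scl"
  using A by (simp add: is_A_Rbar_def)

sublocale module scl
  using tf by (rule topologically_free_module)

lemmas mod = module_axioms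

lemma L_hom: "module_hom scl scl (L i j m)"
  using L by (simp add: is_L_operator_def operator_series_def)

lemma l_plus_neg: "m < 0 \<Longrightarrow> l_plus l i j m = 0" and l_plus_nat: "l_plus l i j (int n) = l i j n"
  by (simp_all add: l_plus_def)

lemma l_plus_0: "l_plus l i j 0 = l i j 0"
  by (simp add: l_plus_def)

lemma hfunctional_h_shift: "hfunctional scl k g \<Longrightarrow> hfunctional scl k (\<lambda>x. g (scl c x))"
  by (rule hfunctional_hom[OF _ module_hom_scale[OF mod]])

lemma hfunctional_h_high: "hfunctional scl k g \<Longrightarrow> k \<le> j \<Longrightarrow> g (scl (fps_X ^ j) x) = 0"
  using hfunctional_simps(6) hpow_scale_power[OF mod, of k j 1] by fastforce

text \<open>
  Both expansions in the defining relation of \<open>A(R)\<close> are in nonnegative powers of \<open>v\<close>, so that one may set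
  \<open>v = 0\<close>.  This is the result, \<open>R(-u) L\<^sub>1\<^sup>+(u) L\<^sub>2\<^sup>+(0) = L\<^sub>2\<^sup>+(0) L\<^sub>1\<^sup>+(u) R(u)\<close>, at \<open>u\<^sup>p\<close>.
\<close>

lemma relation_at_0:
  assumes g: "hfunctional scl k g" and a: "length a = 2" and b: "length b = 2"
  shows "(\<Sum>c | length c = 2. \<Sum>j<k. (- 1) ^ j * fps_nth (entry Rb a c) j *
      g (scl (fps_X ^ j) (l_plus l (c ! 0) (b ! 0) (p + int j) * l (c ! 1) (b ! 1) 0))) =
    (\<Sum>c | length c = 2. \<Sum>j<k. fps_nth (entry Rb c b) j *
      g (scl (fps_X ^ j) (l (a ! 1) (c ! 1) 0 * l_plus l (a ! 0) (c ! 0) (p + int j))))"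
proof -
  obtain \<pi> :: "'n gen free_alg \<Rightarrow> 'v" where
    add: "\<And>x y. \<pi> (x + y) = \<pi> x + \<pi> y" and mult: "\<And>x y. \<pi> (x * y) = \<pi> x * \<pi> y"
    and scale: "\<And>c x. \<pi> (free_scale c x) = scl c (\<pi> x)"
    and ker: "{x. \<pi> x = 0} = rel_ideal Rb" and gen: "\<And>i j m. \<pi> (free_gen i j m) = l i j m"
    using A unfolding is_A_Rbar_def by blast
  note tfF = topologically_free_free_scale
  have \<pi>: "module_hom free_scale scl \<pi>"
    by (intro module_hom.intro module_hom_axioms.intro mod topologically_free_module[OF tfF] add scale)
  have g\<pi>: "hfunctional free_scale k (\<lambda>x. g (\<pi> x))"
    by (rule hfunctional_hom[OF g \<pi>])
  have \<pi>0: "\<pi> 0 = 0" using add[of 0 0] by simp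
  have \<pi>l: "\<pi> (l_plus free_gen i j m) = l_plus l i j m" for i j m
    by (simp add: l_plus_def gen \<pi>0)
  have neg: "l_plus free_gen i j m = 0" if "m < 0" for i j m using that by (simp add: l_plus_def)
  have zero: "0 \<in> hpow free_scale k" for k
    by (rule hpow_0[OF topologically_free_module[OF tfF]])
  let ?Z = "\<lambda>a b m n. l_plus free_gen (a ! 0) (b ! 0) m * l_plus free_gen (a ! 1) (b ! 1) n"
  let ?Z' = "\<lambda>a b m n. l_plus free_gen (a ! 1) (b ! 1) n * l_plus free_gen (a ! 0) (b ! 0) m"
  have "relator Rb a b (expo_of [p, 0]) \<in> rel_ideal Rb"
    unfolding rel_ideal_def using a b by blast
  then have "g (\<pi> (relator Rb a b (expo_of [p, 0]))) = 0"
    unfolding ker[symmetric] by (simp add: hfunctional_simps(3)[OF g])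
  then have "g (\<pi> (lmult free_scale 2 (leg Rb [(- 1, 0), (- (- 1), 1)] 0 1)
        (\<lambda>a b e. ?Z a b (e 0) (e 1)) a b (expo_of [p, 0]))) =
      g (\<pi> (rmult free_scale 2 (\<lambda>a b e. ?Z' a b (e 0) (e 1))
        (leg Rb [(1, 0), (- 1, 1)] 0 1) a b (expo_of [p, 0])))"
    unfolding relator_def hfunctional_simps(2)[OF g\<pi>] L_plus_br_2 by simp
  also have "g (\<pi> (lmult free_scale 2 (leg Rb [(- 1, 0), (- (- 1), 1)] 0 1)
        (\<lambda>a b e. ?Z a b (e 0) (e 1)) a b (expo_of [p, 0]))) =
     (\<Sum>c | length c = 2. \<Sum>j<k. (- 1) ^ j * fps_nth (entry Rb a c) j *
       diff_pow 0 j (\<lambda>m n. g (\<pi> (free_scale (fps_X ^ j) (?Z c b m n)))) p 0)"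
    by (rule hfunctional_lmult_01[OF tfF g\<pi> _ _ _ a, where Z = ?Z])
      (auto intro!: exI[of _ 0] simp: neg zero)
  also have "g (\<pi> (rmult free_scale 2 (\<lambda>a b e. ?Z' a b (e 0) (e 1))
        (leg Rb [(1, 0), (- 1, 1)] 0 1) a b (expo_of [p, 0]))) =
     (\<Sum>c | length c = 2. \<Sum>j<k. 1 ^ j * fps_nth (entry Rb c b) j *
       diff_pow 0 j (\<lambda>m n. g (\<pi> (free_scale (fps_X ^ j) (?Z' a c m n)))) p 0)"
    by (rule hfunctional_rmult_01[OF tfF g\<pi>, where Z = ?Z'])
      (auto intro!: exI[of _ 0] simp: neg zero)
  finally show ?thesis
    by (simp add: diff_pow_lowest scale mult \<pi>l l_plus_0)
qed

lemma L_eq: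
  "length a = Suc n \<Longrightarrow> length b = Suc n \<Longrightarrow> in_vars (Suc n) e \<Longrightarrow>
    L (hd a) (hd b) (e 0) (L_plus_br l n (tl a) (tl b) (\<lambda>k. e (Suc k))) =
    foldr (\<lambda>k. lmult scl (Suc n) (leg (h_negate Rb) [(1, 0), (-1, k)] 0 k))
      (rev [1..<Suc n]) (L_plus_br l (Suc n)) a b e"
  using L unfolding is_L_operator_def matrix_inv_R(3)[OF R] by blast

text \<open>
  The case \<open>n = 0\<close> of the formula defining \<open>L(u)\<close>.
\<close>

lemma L_vacuum: "L i j m 1 = l_plus l i j m"
  using L_eq[of "[i]" 0 "[j]" "expo_of [m]"] in_vars_expo_of[of "[m]"]
  by (simp add: L_plus_br_def expo_of_def)

lemma L_on_l_plus:
  assumes "length a = 2" "length b = 2"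
  shows "L (a ! 0) (b ! 0) m (l_plus l (a ! 1) (b ! 1) n) =
    lmult scl 2 (leg (h_negate Rb) [(1, 0), (-1, 1)] 0 1)
      (\<lambda>a b e. l_plus l (a ! 0) (b ! 0) (e 0) * l_plus l (a ! 1) (b ! 1) (e 1)) a b (expo_of [m, n])"
proof -
  obtain a0 a1 b0 b1 where ab: "a = [a0, a1]" "b = [b0, b1]"
    using assms by (auto simp: length_2_conv)
  have "L (hd a) (hd b) (expo_of [m, n] 0) (L_plus_br l 1 (tl a) (tl b) (\<lambda>k. expo_of [m, n] (Suc k))) =
    foldr (\<lambda>k. lmult scl (Suc 1) (leg (h_negate Rb) [(1, 0), (-1, k)] 0 k))
      (rev [1..<Suc 1]) (L_plus_br l (Suc 1)) a b (expo_of [m, n])"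
    using in_vars_expo_of[of "[m, n]"] by (intro L_eq) (simp_all add: ab)
  moreover have "rev [1..<Suc 1] = [1]" by simp
  moreover have "L_plus_br l 1 [a1] [b1] (\<lambda>k. expo_of [m, n] (Suc k)) = l_plus l a1 b1 n"
    by (simp add: L_plus_br_def expo_of_def)
  ultimately show ?thesis
    unfolding ab L_plus_br_2[symmetric] by (simp add: expo_of_def flip: numeral_2_eq_2)
qed

text \<open>
  The formula defining \<open>L(u)\<close> is \<open>L\<^sub>1(u) L\<^sub>2\<^sup>+(v) 1 = R(u-v)\<^bsup>-1\<^esup> L\<^sub>1\<^sup>+(u) L\<^sub>2\<^sup>+(v) 1\<close>.  Its \<open>R\<close>-matrix is expanded
  in nonnegative powers of \<open>v\<close>, as is \<open>R(u-v)\<close> here, so the two cancel.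
\<close>

lemma R_L_on_l_plus:
  assumes a: "length a = 2" and b: "length b = 2"
  shows "lmult scl 2 (leg Rb [(1, 0), (-1, 1)] 0 1)
      (\<lambda>a b e. L (a ! 0) (b ! 0) (e 0) (l_plus l (a ! 1) (b ! 1) (e 1))) a b (expo_of [p, q]) =
    l_plus l (a ! 0) (b ! 0) p * l_plus l (a ! 1) (b ! 1) q"
proof (rule hfunctionals_separate[OF tf])
  fix k g assume g: "hfunctional scl k g"
  define U where "U = (\<lambda>c m n. l_plus l (c ! 0) (b ! 0) m * l_plus l (c ! 1) (b ! 1) n)"
  have zero: "0 \<in> hpow scl k" for k by (rule hpow_0[OF mod])
  define H where "H = (\<lambda>c i m n. g (scl (fps_X ^ i) (U c m n)))"
  show "g (lmult scl 2 (leg Rb [(1, 0), (-1, 1)] 0 1)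
      (\<lambda>a b e. L (a ! 0) (b ! 0) (e 0) (l_plus l (a ! 1) (b ! 1) (e 1))) a b (expo_of [p, q])) =
    g (l_plus l (a ! 0) (b ! 0) p * l_plus l (a ! 1) (b ! 1) q)"
  proof (cases "k = 0")
    case True
    then show ?thesis using hfunctional_h_high[OF g, of 0] by simp
  next
    case False
    let ?Z = "\<lambda>a b m n. L (a ! 0) (b ! 0) m (l_plus l (a ! 1) (b ! 1) n)"
    have inner: "g (scl (fps_X ^ j) (?Z c b m n)) =
        (\<Sum>c' | length c' = 2. \<Sum>i<k. fps_nth (entry (h_negate Rb) c c') i * diff_pow 0 i (H c' (i + j)) m n)"
      if c: "length c = 2" for c j m n
    proof -
      let ?W = "\<lambda>a b m n. l_plus l (a ! 0) (b ! 0) m * l_plus l (a ! 1) (b ! 1) n"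
      have "g (scl (fps_X ^ j) (lmult scl 2 (leg (h_negate Rb) [(1, 0), (- 1, 1)] 0 1)
          (\<lambda>a b e. ?W a b (e 0) (e 1)) c b (expo_of [m, n]))) =
        (\<Sum>c' | length c' = 2. \<Sum>i<k. 1 ^ i * fps_nth (entry (h_negate Rb) c c') i *
          diff_pow 0 i (\<lambda>m n. g (scl (fps_X ^ j) (scl (fps_X ^ i) (?W c' b m n)))) m n)"
        by (rule hfunctional_lmult_01[OF tf hfunctional_h_shift[OF g] _ _ _ c, where Z = ?W])
          (auto intro!: exI[of _ 0] simp: l_plus_neg zero)
      then show ?thesis
        unfolding L_on_l_plus[OF c b] by (simp add: H_def U_def power_add mult.commute)
    qed
    have "g (lmult scl 2 (leg Rb [(1, 0), (- 1, 1)] 0 1)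
        (\<lambda>a b e. ?Z a b (e 0) (e 1)) a b (expo_of [p, q])) =
       (\<Sum>c | length c = 2. \<Sum>j<k. 1 ^ j * fps_nth (entry Rb a c) j *
       diff_pow 0 j (\<lambda>m n. g (scl (fps_X ^ j) (?Z c b m n))) p q)"
      by (rule hfunctional_lmult_01[OF tf g _ _ _ a, where Z = ?Z])
        (auto intro!: exI[of _ 0] simp: l_plus_neg zero module_hom.zero[OF L_hom])
    also have "\<dots> = (\<Sum>c | length c = 2. \<Sum>j<k. fps_nth (entry Rb a c) j *
       (\<Sum>c' | length c' = 2. \<Sum>i<k. fps_nth (entry (h_negate Rb) c c') i *
         diff_pow 0 (i + j) (H c' (i + j)) p q))"
      by (intro sum.cong refl)
        (simp only: mem_Collect_eq inner diff_pow_sum diff_pow_scale diff_pow_diff_pow power_one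
          mult_1 add.commute)
    also have "\<dots> = diff_pow 0 0 (H a 0) p q"
      by (rule matrix_cancel[OF matrix_inv_R(1)[OF R] a, where G = "\<lambda>c' n. diff_pow 0 n (H c' n) p q"])
        (use False in \<open>simp_all add: H_def hfunctional_h_high[OF g] diff_pow_def\<close>)
    also have "\<dots> = H a 0 p q"
      by (rule diff_pow_0) (simp add: H_def U_def l_plus_neg hfunctional_simps(3)[OF g])
    finally show ?thesis by (simp add: H_def U_def)
  qed
qed

text \<open>
  The case \<open>v = 0\<close> of the previous identity; it supplies the left side of the \<open>RLL\<close>-relation.
\<close>

lemma R_L_on_generator:
  assumes g: "hfunctional scl k g" and a: "length a = 2" and b: "length b = 2"
  shows "(\<Sum>c | length c = 2. \<Sum>j<k. fps_nth (entry Rb a c) j *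
      g (scl (fps_X ^ j) (L (c ! 0) (b ! 0) (p + int j) (l (c ! 1) (b ! 1) 0)))) =
    g (l_plus l (a ! 0) (b ! 0) p * l (a ! 1) (b ! 1) 0)"
proof -
  let ?Z = "\<lambda>a b m n. L (a ! 0) (b ! 0) m (l_plus l (a ! 1) (b ! 1) n)"
  have zero: "0 \<in> hpow scl k" for k by (rule hpow_0[OF mod])
  have "g (lmult scl 2 (leg Rb [(1, 0), (- 1, 1)] 0 1)
      (\<lambda>a b e. ?Z a b (e 0) (e 1)) a b (expo_of [p, 0])) =
     (\<Sum>c | length c = 2. \<Sum>j<k. 1 ^ j * fps_nth (entry Rb a c) j *
       diff_pow 0 j (\<lambda>m n. g (scl (fps_X ^ j) (?Z c b m n))) p 0)"
    by (rule hfunctional_lmult_01[OF tf g _ _ _ a, where Z = ?Z])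
      (auto intro!: exI[of _ 0] simp: l_plus_neg zero module_hom.zero[OF L_hom])
  then show ?thesis
    unfolding R_L_on_l_plus[OF a b] by (simp add: diff_pow_lowest l_plus_0)
qed

text \<open>
  The counterpart for the right side, \<open>(L\<^sub>2(z) L\<^sub>1\<^sup>+(0) 1) R(-z) = L\<^sub>1\<^sup>+(0) L\<^sub>2\<^sup>+(z) 1\<close>.  By the formula defining \<open>L(z)\<close>, with the two tensor factors
  exchanged, \<open>L\<^sub>2(z) L\<^sub>1\<^sup>+(0) 1 = R\<^sub>2\<^sub>1(-z) L\<^sub>2\<^sup>+(z) L\<^sub>1\<^sup>+(0) 1\<close>.  The relation of \<open>A(R)\<close> moves the
  \<open>R\<close>-matrix to the right, giving \<open>L\<^sub>1\<^sup>+(0) L\<^sub>2\<^sup>+(z) R\<^sub>2\<^sub>1(z) 1\<close>, where it is cancelled by \<open>R\<^sub>1\<^sub>2(-z)\<close>.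
\<close>

lemma L_on_generator_R:
  assumes g: "hfunctional scl k g" and a: "length a = 2" and b: "length b = 2"
  shows "(\<Sum>c | length c = 2. \<Sum>j<k. fps_nth (entry (h_negate Rb) c b) j *
      g (scl (fps_X ^ j) (L (a ! 1) (c ! 1) (m + int j) (l (a ! 0) (c ! 0) 0)))) =
    g (l (a ! 0) (b ! 0) 0 * l_plus l (a ! 1) (b ! 1) m)"
proof (cases "k = 0")
  case True
  then show ?thesis using hfunctional_h_high[OF g, of 0] by simp
next
  case False
  have zero: "0 \<in> hpow scl k" for k by (rule hpow_0[OF mod])
  obtain a0 a1 where aa: "a = [a0, a1]" using a by (auto simp: length_2_conv)
  define G where "G = (\<lambda>c' n. g (scl (fps_X ^ n) (l a0 (c' ! 0) 0 * l_plus l a1 (c' ! 1) (m + int n))))"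
  have inner: "g (scl (fps_X ^ j) (L a1 (c ! 1) (m + int j) (l a0 (c ! 0) 0))) =
      (\<Sum>c' | length c' = 2. \<Sum>i<k. fps_nth (entry Rb c' c) i * G c' (i + j))"
    if c: "length c = 2" for c j
  proof -
    obtain c0 c1 where cc: "c = [c0, c1]" using c by (auto simp: length_2_conv)
    let ?g = "\<lambda>x. g (scl (fps_X ^ j) x)"
    note g' = hfunctional_h_shift[OF g, of "fps_X ^ j"]
    let ?Z = "\<lambda>a b m n. l_plus l (a ! 0) (b ! 0) m * l_plus l (a ! 1) (b ! 1) n"
    have len: "length [a1, a0] = 2" "length [c1, c0] = 2" by simp_all
    have "?g (L a1 c1 (m + int j) (l a0 c0 0)) =
      ?g (lmult scl 2 (leg (h_negate Rb) [(1, 0), (- 1, 1)] 0 1)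
        (\<lambda>a b e. ?Z a b (e 0) (e 1)) [a1, a0] [c1, c0] (expo_of [m + int j, 0]))"
      using L_on_l_plus[OF len, of "m + int j" 0] by (simp add: l_plus_0)
    also have "\<dots> = (\<Sum>c' | length c' = 2. \<Sum>i<k. 1 ^ i * fps_nth (entry (h_negate Rb) [a1, a0] c') i *
       diff_pow 0 i (\<lambda>m n. ?g (scl (fps_X ^ i) (?Z c' [c1, c0] m n))) (m + int j) 0)"
      by (rule hfunctional_lmult_01[OF tf g' _ _ _ len(1), where Z = ?Z])
        (auto intro!: exI[of _ 0] simp: l_plus_neg zero)
    also have "\<dots> = (\<Sum>c' | length c' = 2. \<Sum>i<k. (- 1) ^ i * fps_nth (entry Rb [a1, a0] c') i *
       ?g (scl (fps_X ^ i) (l_plus l (c' ! 0) ([c1, c0] ! 0) (m + int j + int i) * l (c' ! 1) ([c1, c0] ! 1) 0)))"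
      by (simp add: diff_pow_lowest l_plus_0 entry_h_negate)
    also have "\<dots> = (\<Sum>c' | length c' = 2. \<Sum>i<k. fps_nth (entry Rb c' [c1, c0]) i *
       ?g (scl (fps_X ^ i) (l ([a1, a0] ! 1) (c' ! 1) 0 * l_plus l ([a1, a0] ! 0) (c' ! 0) (m + int j + int i))))"
      by (rule relation_at_0[OF g' len])
    also have "\<dots> = (\<Sum>c' | length c' = 2. \<Sum>i<k. fps_nth (entry Rb (rev c') [c1, c0]) i *
       ?g (scl (fps_X ^ i) (l ([a1, a0] ! 1) (rev c' ! 1) 0 * l_plus l ([a1, a0] ! 0) (rev c' ! 0) (m + int j + int i))))"
      by (rule sum_lists_2_rev[symmetric])
    also have "\<dots> = (\<Sum>c' | length c' = 2. \<Sum>i<k. fps_nth (entry Rb c' c) i * G c' (i + j))"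
    proof (intro sum.cong refl)
      fix c' :: "'n list" and i assume "c' \<in> {c'. length c' = 2}"
      then obtain x y where "c' = [x, y]" by (auto simp: length_2_conv)
      then show "fps_nth (entry Rb (rev c') [c1, c0]) i *
         ?g (scl (fps_X ^ i) (l ([a1, a0] ! 1) (rev c' ! 1) 0 * l_plus l ([a1, a0] ! 0) (rev c' ! 0) (m + int j + int i))) =
        fps_nth (entry Rb c' c) i * G c' (i + j)"
        using matrix_inv_R(4)[OF R, of y x c1 c0] by (simp add: G_def cc power_add mult.commute add_ac)
    qed
    finally show ?thesis by (simp add: cc)
  qed
  have aa01: "a ! 0 = a0" "a ! 1 = a1" by (simp_all add: aa)
  have tr: "entry (transpose M) x y = entry M y x" for M :: "'n rmatrix" and x y
    by (simp add: entry_def transpose_def)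
  \<comment> \<open>Multiplication from the right is multiplication by the transposed matrix from the left.\<close>
  have T: "transpose (h_negate Rb) ** transpose Rb = mat 1"
    by (simp add: matrix_inv_R(1)[OF R] transpose_mat flip: matrix_transpose_mul)
  have "(\<Sum>c | length c = 2. \<Sum>j<k. fps_nth (entry (h_negate Rb) c b) j *
      g (scl (fps_X ^ j) (L (a ! 1) (c ! 1) (m + int j) (l (a ! 0) (c ! 0) 0)))) =
    (\<Sum>c | length c = 2. \<Sum>j<k. fps_nth (entry (transpose (h_negate Rb)) b c) j *
      (\<Sum>c' | length c' = 2. \<Sum>i<k. fps_nth (entry (transpose Rb) c c') i * G c' (i + j)))"
    by (intro sum.cong refl) (simp only: mem_Collect_eq aa01 inner tr)
  also have "\<dots> = G b 0"
    by (rule matrix_cancel[OF T b]) (use False in \<open>simp_all add: G_def hfunctional_h_high[OF g]\<close>)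
  finally show ?thesis by (simp add: G_def aa)
qed

lemma Y_eq:
  "n \<ge> 1 \<Longrightarrow> length a = n \<Longrightarrow> length b = n \<Longrightarrow> Y (L_plus_br l n a b (\<lambda>k. int (e k))) v m =
    hsum scl {f. in_vars n f \<and> (\<Sum>k<n. f k - int (e k)) = m}
      (\<lambda>f. scl (fps_const (\<Prod>k<n. of_int (f k) gchoose e k)) (L_br Rb scl L n v a b f))"
  using Y unfolding is_vertex_map_def by blast

lemma vertex_generator: "Y (l i j 0) v m = L i j m v"
proof -
  have "Y (L_plus_br l 1 [i] [j] (\<lambda>k. int 0)) v m =
      hsum scl {f. in_vars 1 f \<and> (\<Sum>k<1. f k - int 0) = m}
        (\<lambda>f. scl (fps_const (\<Prod>k<1. of_int (f k) gchoose 0)) (L_br Rb scl L 1 v [i] [j] f))"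
    by (rule Y_eq) simp_all
  also have "{f. in_vars 1 f \<and> (\<Sum>k<1. f k - int 0) = m} = {expo_of [m]}"
    by (auto simp: in_vars_def expo_of_def)
  also have "hsum scl {expo_of [m]} (\<lambda>f. scl (fps_const (\<Prod>k<1. of_int (f k) gchoose 0))
      (L_br Rb scl L 1 v [i] [j] f)) = L i j m v"
    by (subst hsum_finite[OF tf, of "{expo_of [m]}"]) (auto simp: L_br_def expo_of_def)
  finally show ?thesis by (simp add: L_plus_br_def l_plus_0)
qed

text \<open>
  On the vacuum \<open>L\<^bsub>[2]\<^esub>(x\<^sub>1, x\<^sub>2)\<close> equals \<open>L\<^sub>1\<^sup>+(x\<^sub>1) L\<^sub>2\<^sup>+(x\<^sub>2) 1\<close> by the cancellation above, hence
  \<open>Y(L\<^sub>1\<^sup>+(x\<^sub>1) L\<^sub>2\<^sup>+(x\<^sub>2) 1, z) 1 = L\<^sub>1\<^sup>+(z + x\<^sub>1) L\<^sub>2\<^sup>+(z + x\<^sub>2) 1\<close>.  The case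
  \<open>x\<^sub>2 = 0\<close> is enough to express \<open>\<Phi>(0, y; z)\<close> by \<open>\<Phi>(x\<^sub>1, 0; z)\<close>.
\<close>

lemma vertex_creation:
  assumes a: "length a = 2" and b: "length b = 2"
  shows "Y (l (a ! 0) (b ! 0) \<alpha> * l (a ! 1) (b ! 1) 0) 1 m =
    (if m < 0 then 0 else \<Sum>i\<le>nat m. scl (fps_const (of_nat (\<alpha> + i) gchoose \<alpha>))
       (l (a ! 0) (b ! 0) (\<alpha> + i) * l (a ! 1) (b ! 1) (nat m - i)))"
proof -
  \<comment> \<open>The exponents of \<open>x\<^sub>1\<close> and \<open>x\<^sub>2\<close>.\<close>
  define e where "e = (\<lambda>k::nat. if k = 0 then \<alpha> else 0)"
  define I where "I = {f. in_vars 2 f \<and> (\<Sum>k<2. f k - int (e k)) = m}"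
  define t where "t = (\<lambda>f::expo. scl (fps_const (of_int (f 0) gchoose \<alpha>))
      (l_plus l (a ! 0) (b ! 0) (f 0) * l_plus l (a ! 1) (b ! 1) (f 1)))"
  have "Y (L_plus_br l 2 a b (\<lambda>k. int (e k))) 1 m =
      hsum scl I (\<lambda>f. scl (fps_const (\<Prod>k<2. of_int (f k) gchoose e k)) (L_br Rb scl L 2 1 a b f))"
    unfolding I_def by (rule Y_eq) (simp_all add: a b)
  also have "\<dots> = hsum scl I t"
  proof -
    have "L_br Rb scl L 2 1 a b f = l_plus l (a ! 0) (b ! 0) (f 0) * l_plus l (a ! 1) (b ! 1) (f 1)"
      if "in_vars 2 f" for f
      using R_L_on_l_plus[OF a b, of "f 0" "f 1"] unfolding L_br_2 L_vacuum expo_of_2[OF that, symmetric] .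
    then show ?thesis
      by (intro hsum_cong) (simp add: I_def t_def e_def numeral_2_eq_2)
  qed
  also have "\<dots> = (\<Sum>f\<in>(if m < 0 then {} else (\<lambda>i. expo_of [int (\<alpha> + i), m - int i]) ` {..nat m}). t f)"
  proof (rule hsum_finite[OF tf])
    fix f assume f: "f \<in> I - (if m < 0 then {} else (\<lambda>i. expo_of [int (\<alpha> + i), m - int i]) ` {..nat m})"
    then have vars: "in_vars 2 f" and deg: "f 0 + f 1 = int \<alpha> + m"
      by (auto simp: I_def e_def numeral_2_eq_2)
    consider "f 0 < 0" | "f 1 < 0" | "0 \<le> f 0" "f 0 < int \<alpha>" | "int \<alpha> \<le> f 0" "0 \<le> f 1" by linarith
    then show "t f = 0"
    proof cases
      case 4
      define i where "i = nat (f 0 - int \<alpha>)"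
      have "f 0 = int (\<alpha> + i)" "f 1 = m - int i" "i \<le> nat m" "\<not> m < 0"
        using 4 deg by (auto simp: i_def)
      moreover from this(1,2) have "f = expo_of [int (\<alpha> + i), m - int i]"
        using expo_of_2[OF vars] by simp
      ultimately show ?thesis using f by (auto split: if_splits)
    qed (simp_all add: t_def l_plus_neg gbinomial_int_eq_0)
  qed (auto simp: I_def e_def in_vars_def expo_of_def numeral_2_eq_2)
  also have "\<dots> = (if m < 0 then 0 else \<Sum>i\<le>nat m. t (expo_of [int (\<alpha> + i), m - int i]))"
  proof -
    have "inj_on (\<lambda>i. expo_of [int (\<alpha> + i), m - int i]) {..nat m}"
    proof (rule inj_onI)
      fix i i' assume "expo_of [int (\<alpha> + i), m - int i] = expo_of [int (\<alpha> + i'), m - int i']"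
      from fun_cong[OF this, of 0] show "i = i'" by (simp add: expo_of_def)
    qed
    then show ?thesis by (simp add: sum.reindex)
  qed
  also have "\<dots> = (if m < 0 then 0 else \<Sum>i\<le>nat m. scl (fps_const (of_nat (\<alpha> + i) gchoose \<alpha>))
       (l (a ! 0) (b ! 0) (\<alpha> + i) * l (a ! 1) (b ! 1) (nat m - i)))"
    by (auto simp: t_def expo_of_def l_plus_def nat_diff_distrib nat_add_distrib intro!: sum.cong)
  finally show ?thesis by (simp add: L_plus_br_2 e_def l_plus_def)
qed

end

section \<open>Modules over \<open>V(R)\<close>\<close>

locale Rbar_module = Rbar_algebra Rb scl l L Y
  for Rb :: "'n::finite rmatrix" and scl :: "complex fps \<Rightarrow> 'v::ring_1 \<Rightarrow> 'v" and l L Y +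
  fixes sclW :: "complex fps \<Rightarrow> 'w::ab_group_add \<Rightarrow> 'w"
    and YW :: "'v \<Rightarrow> 'w \<Rightarrow> int \<Rightarrow> 'w"
  assumes tfW: "topologically_free sclW"
    and YW_bilinear: "\<And>m. hbilinear scl sclW sclW (\<lambda>v w. YW v w m)"
    and YW_laurent: "\<And>v w. laurent_h sclW (YW v w)"
    and YW_vacuum: "\<And>w m. YW 1 w m = (if m = 0 then w else 0)"
    and YW_associative: "weak_associativity Y sclW YW"
begin

lemmas modW = topologically_free_module[OF tfW]

lemma YW_hom_left: "module_hom scl sclW (\<lambda>v. YW v w m)"
  and YW_hom_right: "module_hom sclW sclW (\<lambda>w. YW v w m)"
  using YW_bilinear[of m] by (simp_all add: hbilinear_def)

lemma hfunctional_YW: "hfunctional sclW k f \<Longrightarrow> hfunctional scl k (\<lambda>v. f (YW v w m))"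
  by (rule hfunctional_hom[OF _ YW_hom_left])

text \<open>
  The sum over all pairs \<open>(m, n)\<close> reduces to the line \<open>m + n = p + q\<close>, \<open>n \<le> q\<close>, and modulo \<open>h\<^sup>k\<close> to its
  finite part \<open>M \<le> n\<close>.
\<close>

lemma hfunctional_YW_shift_comp:
  assumes f: "hfunctional sclW k f" and M: "\<And>n. n < M \<Longrightarrow> YW v w n \<in> hpow sclW k"
  shows "f (YW_shift_comp sclW YW u v w (expo_of [p, q])) =
    subst_sum M (\<lambda>m n. f (YW u (YW v w n) m)) p q"
proof -
  interpret W: module sclW by (rule modW)
  define t where "t = (\<lambda>(m, n). sclW (fps_const (lin_pow [(1, 0), (1, 1)] m ((expo_of [p, q])(1 := q - n))))
    (YW u (YW v w n) m))"
  define h where "h = (\<lambda>s. (p + int s, q - int s))"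
  have upd: "(expo_of [p, q])(1 := q - n) = expo_of [p, q - n]" for n
    by (rule ext) (auto simp: expo_of_def less_Suc_eq)
  have t: "t (h s) = sclW (fps_const (of_int (p + int s) gchoose s)) (YW u (YW v w (q - int s)) (p + int s))" for s
    by (simp add: t_def h_def upd lin_pow_sum del: One_nat_def)
  have t_hpow: "t i \<in> hpow sclW k'"
    if low: "\<And>n. n < M' \<Longrightarrow> YW v w n \<in> hpow sclW k'" and out: "i \<notin> h ` {..<nat (q - M' + 1)}" for i k' M'
  proof (cases "i \<in> range h")
    case True
    then obtain s where s: "i = h s" by blast
    with out have "q - int s < M'" by auto
    then show ?thesis
      unfolding s t by (intro hpow_scale[OF modW] module_hom_hpow[OF YW_hom_right] low)
  next
    case False
    obtain m n where i: "i = (m, n)" by fastforce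
    have "lin_pow [(1, 0), (1, 1)] m (expo_of [p, q - n]) = 0"
    proof (rule ccontr)
      assume "lin_pow [(1, 0), (1, 1)] m (expo_of [p, q - n]) \<noteq> 0"
      then have "0 \<le> q - n" "p + (q - n) = m" by (auto simp: lin_pow_sum simp del: One_nat_def split: if_splits)
      then have "i = h (nat (q - n))" by (simp add: i h_def)
      with False show False by blast
    qed
    then show ?thesis by (simp add: t_def i upd hpow_0[OF modW] del: One_nat_def)
  qed
  have "finite {i \<in> UNIV. t i \<notin> hpow sclW k'}" for k'
  proof -
    obtain m0 where "\<And>n. n \<le> m0 \<Longrightarrow> YW v w n \<in> hpow sclW k'"
      using YW_laurent[of v w] unfolding laurent_h_def by blast
    then have "\<And>n. n < m0 \<Longrightarrow> YW v w n \<in> hpow sclW k'" by simp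
    from t_hpow[OF this] have "{i \<in> UNIV. t i \<notin> hpow sclW k'} \<subseteq> h ` {..<nat (q - m0 + 1)}" by blast
    then show ?thesis by (rule finite_subset) simp
  qed
  then have summable: "hsummable sclW UNIV t" by (auto simp: hsummable_def)
  have "f (YW_shift_comp sclW YW u v w (expo_of [p, q])) = f (hsum sclW UNIV t)"
    by (simp add: YW_shift_comp_def t_def expo_of_def)
  also have "\<dots> = (\<Sum>i\<in>h ` {..<nat (q - M + 1)}. f (t i))"
    by (rule hfunctional_hsum[OF tfW f summable])
      (use t_hpow[OF M] hfunctional_simps(6)[OF f] in auto)
  also have "\<dots> = (\<Sum>s<nat (q - M + 1). f (t (h s)))"
    by (subst sum.reindex) (auto simp: inj_on_def h_def)
  finally show ?thesis
    by (simp add: t subst_sum_def hfunctional_simps(5)[OF f])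
qed

text \<open>
  The exponent \<open>r\<close> depends on \<open>k\<close> but not on the form, so it serves all the forms \<open>\<lambda>x. f (h\<^sup>j x)\<close> at once.
\<close>

lemma weak_associativity_functional:
  "\<exists>r. \<forall>f M. hfunctional sclW k f \<longrightarrow> (\<forall>n<M. YW v w n \<in> hpow sclW k) \<longrightarrow>
    (mult_by_sum ^^ r) (subst_sum M (\<lambda>m n. f (YW u (YW v w n) m))) =
    (mult_by_sum ^^ r) (\<lambda>p q. f (YW (Y u v p) w q))"
proof -
  let ?P = "\<lambda>r d. fps_const (lin_pow [(1, 0), (1, 1)] (int r) d)"
  obtain r where r: "\<And>p q. series_mult sclW (?P r) (YW_shift_comp sclW YW u v w) (expo_of [p, q]) -
      series_mult sclW (?P r) (\<lambda>e. YW (Y u v (e 0)) w (e 1)) (expo_of [p, q]) \<in> hpow sclW k"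
    using YW_associative unfolding weak_associativity_def Let_def by meson
  show ?thesis
  proof (intro exI[of _ r] allI impI ext)
    fix f M p q
    assume f: "hfunctional sclW k f" and "\<forall>n<M. YW v w n \<in> hpow sclW k"
    then have M: "\<And>n. n < M \<Longrightarrow> YW v w n \<in> hpow sclW k" by blast
    have "(mult_by_sum ^^ r) (\<lambda>p q. f (YW_shift_comp sclW YW u v w (expo_of [p, q]))) p q =
        (mult_by_sum ^^ r) (\<lambda>p q. f (YW (Y u v (expo_of [p, q] 0)) w (expo_of [p, q] 1))) p q"
      using hfunctional_simps(6)[OF f r[of p q]]
      unfolding hfunctional_simps(2)[OF f] hfunctional_mult_power_of_sum[OF tfW f] by simp
    moreover have "expo_of [p, q] 0 = p" "expo_of [p, q] 1 = q" for p q
      by (simp_all add: expo_of_def)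
    ultimately show "(mult_by_sum ^^ r) (subst_sum M (\<lambda>m n. f (YW u (YW v w n) m))) p q =
        (mult_by_sum ^^ r) (\<lambda>p q. f (YW (Y u v p) w q)) p q"
      by (simp only: hfunctional_YW_shift_comp[OF f M])
  qed
qed

text \<open>
  Weak associativity multiplied by an \<open>R\<close>-matrix entry: \<open>(h/(z\<^sub>1-z\<^sub>2))\<^sup>j\<close> on one side corresponds to
  \<open>(h/z\<^sub>0)\<^sup>j\<close> on the other.
\<close>

lemma weak_associativity_combination:
  assumes A: "finite A" and f: "hfunctional sclW k f"
    and M: "\<And>c n. c \<in> A \<Longrightarrow> n < M \<Longrightarrow> YW (v c) w n \<in> hpow sclW k"
  shows "\<exists>r. (mult_by_sum ^^ r) (subst_sum M (\<lambda>p q. \<Sum>c\<in>A. \<Sum>j<k. \<kappa> c j *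
      diff_pow M j (\<lambda>m n. f (sclW (fps_X ^ j) (YW (u c) (YW (v c) w n) m))) p q)) =
    (mult_by_sum ^^ r) (\<lambda>p q. \<Sum>c\<in>A. \<Sum>j<k. \<kappa> c j * f (sclW (fps_X ^ j) (YW (Y (u c) (v c) (p + int j)) w q)))"
proof -
  let ?G = "\<lambda>c j m n. f (sclW (fps_X ^ j) (YW (u c) (YW (v c) w n) m))"
  let ?D = "\<lambda>c j p q. f (sclW (fps_X ^ j) (YW (Y (u c) (v c) p) w q))"
  have "\<exists>r. \<forall>c\<in>A. \<forall>j. (mult_by_sum ^^ r) (subst_sum M (?G c j)) = (mult_by_sum ^^ r) (?D c j)"
  proof (rule finite_uniform_bound[OF A])
    fix c assume c: "c \<in> A"
    obtain r where r: "\<forall>f M. hfunctional sclW k f \<longrightarrow> (\<forall>n<M. YW (v c) w n \<in> hpow sclW k) \<longrightarrow>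
        (mult_by_sum ^^ r) (subst_sum M (\<lambda>m n. f (YW (u c) (YW (v c) w n) m))) =
        (mult_by_sum ^^ r) (\<lambda>p q. f (YW (Y (u c) (v c) p) w q))"
      using weak_associativity_functional[of k "v c" w "u c"] by (elim exE)
    show "\<exists>r. \<forall>j. (mult_by_sum ^^ r) (subst_sum M (?G c j)) = (mult_by_sum ^^ r) (?D c j)"
      by (intro exI[of _ r] allI r[rule_format] hfunctional_hom[OF f module_hom_scale[OF modW]] M[OF c])
  next
    fix c r r'
    assume eq: "\<forall>j. (mult_by_sum ^^ r) (subst_sum M (?G c j)) = (mult_by_sum ^^ r) (?D c j)" and "r \<le> r'"
    then have "mult_by_sum ^^ r' = (mult_by_sum ^^ (r' - r)) \<circ> (mult_by_sum ^^ r)"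
      by (simp flip: funpow_add)
    then show "\<forall>j. (mult_by_sum ^^ r') (subst_sum M (?G c j)) = (mult_by_sum ^^ r') (?D c j)"
      using eq by simp
  qed
  then obtain r where r: "\<forall>c\<in>A. \<forall>j. (mult_by_sum ^^ r) (subst_sum M (?G c j)) = (mult_by_sum ^^ r) (?D c j)"
    by (elim exE)
  have "(mult_by_sum ^^ r) (subst_sum M (\<lambda>p q. \<Sum>c\<in>A. \<Sum>j<k. \<kappa> c j * diff_pow M j (?G c j) p q)) =
      (mult_by_sum ^^ r) (\<lambda>p q. \<Sum>c\<in>A. \<Sum>j<k. \<kappa> c j * subst_sum M (?G c j) (p + int j) q)"
    by (rule arg_cong[of _ _ "mult_by_sum ^^ r"], intro ext)
      (simp add: subst_sum_sum subst_sum_scale subst_sum_diff_pow)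
  also have "\<dots> = (mult_by_sum ^^ r) (\<lambda>p q. \<Sum>c\<in>A. \<Sum>j<k. \<kappa> c j * ?D c j (p + int j) q)"
    unfolding mult_by_sum_power_combination[where F = "\<lambda>c j. subst_sum M (?G c j)"]
      mult_by_sum_power_combination[where F = ?D]
    by (intro ext sum.cong refl) (simp add: r)
  finally show ?thesis by (rule exI)
qed

text \<open>
  Weak associativity for \<open>u = l\<^bsup>(-\<alpha>-1)\<^esup> l\<^bsup>(-1)\<^esup>\<close> (matrix indices omitted) and the vacuum: \<open>Y\<^sub>W(u, z\<^sub>0 + z\<^sub>2) w\<close> agrees with
  \<open>Y\<^sub>W(Y(u, z\<^sub>0) 1, z\<^sub>2) w\<close> up to a power of \<open>z\<^sub>0 + z\<^sub>2\<close>, and creation makes the latter a power series in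
  \<open>z\<^sub>0\<close>.  So \<open>expansion_around_diagonal\<close> applies to the series \<open>Y\<^sub>W(u, z\<^sub>1) w\<close>, which does not depend on
  \<open>z\<^sub>2\<close>.
\<close>

lemma translation:
  fixes w :: 'w
  assumes f: "hfunctional sclW k f" and a: "length a = 2" and b: "length b = 2"
  defines "\<psi> \<equiv> \<lambda>\<alpha> \<beta> q. f (YW (l (a ! 0) (b ! 0) \<alpha> * l (a ! 1) (b ! 1) \<beta>) w q)"
  shows "(\<Sum>i\<le>n. (of_nat (\<alpha> + i) gchoose \<alpha>) * \<psi> (\<alpha> + i) (n - i) q) =
    (of_int (int n + q) gchoose n) * \<psi> \<alpha> 0 (int n + q)"
proof -
  let ?u = "l (a ! 0) (b ! 0) \<alpha> * l (a ! 1) (b ! 1) 0"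
  define X where "X = (\<lambda>m n. f (YW ?u (YW 1 w n) m))"
  define D where "D = (\<lambda>p q. f (YW (Y ?u 1 p) w q))"
  have X: "X m n = (if n = 0 then \<psi> \<alpha> 0 m else 0)" for m n
    by (simp add: X_def YW_vacuum \<psi>_def module_hom.zero[OF YW_hom_right] hfunctional_simps(3)[OF f])
  obtain r where assoc: "\<forall>f M. hfunctional sclW k f \<longrightarrow> (\<forall>n<M. YW 1 w n \<in> hpow sclW k) \<longrightarrow>
      (mult_by_sum ^^ r) (subst_sum M (\<lambda>m n. f (YW ?u (YW 1 w n) m))) =
      (mult_by_sum ^^ r) (\<lambda>p q. f (YW (Y ?u 1 p) w q))"
    using weak_associativity_functional[of k 1 w ?u] by (elim exE)
  have r: "(mult_by_sum ^^ r) (subst_sum 0 X) = (mult_by_sum ^^ r) D"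
    unfolding X_def D_def by (rule assoc[rule_format, OF f]) (simp add: YW_vacuum hpow_0[OF modW])
  have neg: "D p q = 0" if "p < 0" for p q
    using that by (simp add: D_def vertex_creation[OF a b] module_hom.zero[OF YW_hom_left]
      hfunctional_simps(3)[OF f] del: One_nat_def)
  have X0: "X p q = 0" if "q < 0" for p q using that by (simp add: X)
  have expand0: "X p q = 0" if "p < - int r" for p q
    by (rule expansion_around_diagonal(1)[OF X0 neg r that])
  have expand: "D (int n) q =
      (\<Sum>m\<in>{- int r..int n + q - 0}. (of_int m gchoose n) * X m (int n + q - m))" for n q
    by (rule expansion_around_diagonal(2)[OF X0 neg r])
  have "(\<Sum>i\<le>n. (of_nat (\<alpha> + i) gchoose \<alpha>) * \<psi> (\<alpha> + i) (n - i) q) = D (int n) q"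
    by (simp add: D_def \<psi>_def vertex_creation[OF a b] hfunctional_simps(4,5)[OF hfunctional_YW[OF f]]
      del: One_nat_def)
  also have "\<dots> = (\<Sum>m\<in>{- int r..int n + q}. if m = int n + q then (of_int m gchoose n) * \<psi> \<alpha> 0 m else 0)"
    unfolding expand X diff_0_right by (intro sum.cong refl) auto
  also have "\<dots> = (of_int (int n + q) gchoose n) * \<psi> \<alpha> 0 (int n + q)"
    using expand0[of "int n + q" 0] by (auto simp: X)
  finally show ?thesis .
qed

text \<open>
  Here \<open>X p q\<close> and \<open>X' q p\<close> are the coefficients of \<open>u\<^sup>p v\<^sup>q\<close> on the two sides.  The right side is treated
  with the variables exchanged, so that it, too, is expanded in nonnegative powers of the second one; its
  factor \<open>R(-v+u)\<close> is the inverse of \<open>R(v-u)\<close>, whence \<open>h_negate\<close>.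
\<close>

lemma RLL_coefficients:
  assumes a: "length a = 2" and b: "length b = 2"
  shows "lmult sclW 2 (leg Rb [(1, 0), (-1, 1)] 0 1)
      (\<lambda>a b e. YW (l (a ! 0) (b ! 0) 0) (YW (l (a ! 1) (b ! 1) 0) w (e 1)) (e 0)) a b (expo_of [p, q]) =
    rmult sclW 2 (\<lambda>a b e. YW (l (a ! 1) (b ! 1) 0) (YW (l (a ! 0) (b ! 0) 0) w (e 0)) (e 1))
      (leg Rb [(-1, 1), (1, 0)] 0 1) a b (expo_of [p, q])"
proof (rule hfunctionals_separate[OF tfW])
  fix k f assume f: "hfunctional sclW k f"
  let ?A = "{c :: 'n list. length c = 2}"
  let ?Z = "\<lambda>a b m n. YW (l (a ! 0) (b ! 0) 0) (YW (l (a ! 1) (b ! 1) 0) w n) m"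
  let ?Z' = "\<lambda>a b m n. YW (l (a ! 1) (b ! 1) 0) (YW (l (a ! 0) (b ! 0) 0) w m) n"
  define \<psi> where "\<psi> = (\<lambda>\<alpha> \<beta> q. f (YW (l (a ! 0) (b ! 0) \<alpha> * l (a ! 1) (b ! 1) \<beta>) w q))"
  have commute: "f (sclW (fps_X ^ j) (YW v w q)) = f (YW (scl (fps_X ^ j) v) w q)" for j v q
    by (simp add: module_hom.scale[OF YW_hom_left])

  have "\<exists>M. \<forall>c\<in>?A. \<forall>n<M. YW (l (c ! 1) (b ! 1) 0) w n \<in> hpow sclW k"
    by (rule laurent_h_uniform[OF finite_lists_2]) (rule YW_laurent)
  then obtain M where M: "\<And>c n. c \<in> ?A \<Longrightarrow> n < M \<Longrightarrow> YW (l (c ! 1) (b ! 1) 0) w n \<in> hpow sclW k"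
    by blast
  define X where "X = (\<lambda>p q. \<Sum>c\<in>?A. \<Sum>j<k. fps_nth (entry Rb a c) j *
      diff_pow M j (\<lambda>m n. f (sclW (fps_X ^ j) (?Z c b m n))) p q)"
  have lower: "\<exists>M. \<forall>m n. n < M \<longrightarrow> ?Z c b m n \<in> hpow sclW k'" for c k'
  proof -
    obtain m0 where "\<And>n. n \<le> m0 \<Longrightarrow> YW (l (c ! 1) (b ! 1) 0) w n \<in> hpow sclW k'"
      using YW_laurent unfolding laurent_h_def by blast
    then show ?thesis by (intro exI[of _ m0] allI impI) (rule module_hom_hpow[OF YW_hom_right], simp)
  qed
  have fX: "f (lmult sclW 2 (leg Rb [(1, 0), (-1, 1)] 0 1)
      (\<lambda>a b e. ?Z a b (e 0) (e 1)) a b (expo_of [p, q])) = X p q" for p q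
  proof -
    have "f (lmult sclW 2 (leg Rb [(1, 0), (- 1, 1)] 0 1)
        (\<lambda>a b e. ?Z a b (e 0) (e 1)) a b (expo_of [p, q])) =
      (\<Sum>c\<in>?A. \<Sum>j<k. 1 ^ j * fps_nth (entry Rb a c) j *
        diff_pow M j (\<lambda>m n. f (sclW (fps_X ^ j) (?Z c b m n))) p q)"
    proof (rule hfunctional_lmult_01[OF tfW f _ _ _ a, where Z = ?Z])
      show "\<exists>M. \<forall>m n. n < M \<longrightarrow> ?Z c b m n \<in> hpow sclW k'" for c k' by (rule lower)
      show "?Z c b m n \<in> hpow sclW k" if "length c = 2" "n < M" for c m n
        by (rule module_hom_hpow[OF YW_hom_right], rule M) (use that in simp_all)
    qed simp
    then show ?thesis by (simp only: X_def power_one mult_1)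
  qed
  have "\<exists>r. (mult_by_sum ^^ r) (subst_sum M X) = (mult_by_sum ^^ r) (\<lambda>p q. \<Sum>c\<in>?A. \<Sum>j<k.
      fps_nth (entry Rb a c) j *
      f (sclW (fps_X ^ j) (YW (Y (l (c ! 0) (b ! 0) 0) (l (c ! 1) (b ! 1) 0) (p + int j)) w q)))"
    (is "\<exists>r. ?eq r")
    unfolding X_def by (rule weak_associativity_combination[OF finite_lists_2 f]) (rule M)
  then obtain r where "?eq r" by (elim exE)
  moreover have "(\<Sum>c\<in>?A. \<Sum>j<k. fps_nth (entry Rb a c) j *
      f (sclW (fps_X ^ j) (YW (Y (l (c ! 0) (b ! 0) 0) (l (c ! 1) (b ! 1) 0) (p + int j)) w q))) =
    f (YW (l_plus l (a ! 0) (b ! 0) p * l (a ! 1) (b ! 1) 0) w q)" for p q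
    unfolding vertex_generator commute by (rule R_L_on_generator[OF hfunctional_YW[OF f] a b])
  ultimately have r: "(mult_by_sum ^^ r) (subst_sum M X) =
      (mult_by_sum ^^ r) (\<lambda>p q. f (YW (l_plus l (a ! 0) (b ! 0) p * l (a ! 1) (b ! 1) 0) w q))"
    by simp
  have XM: "X p q = 0" if "q < M" for p q using that by (simp add: X_def diff_pow_vanish)
  have neg: "f (YW (l_plus l (a ! 0) (b ! 0) p * l (a ! 1) (b ! 1) 0) w q) = 0" if "p < 0" for p q
    using that by (simp add: l_plus_neg hfunctional_simps(3)[OF hfunctional_YW[OF f]])
  have expandX0: "X p q = 0" if "p < - int r" for p q
    by (rule expansion_around_diagonal(1)[OF XM neg r that])
  have expandX: "f (YW (l_plus l (a ! 0) (b ! 0) (int n) * l (a ! 1) (b ! 1) 0) w q) =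
      (\<Sum>m\<in>{- int r..int n + q - M}. (of_int m gchoose n) * X m (int n + q - m))" for n q
    by (rule expansion_around_diagonal(2)[OF XM neg r])

  have "\<exists>M. \<forall>c\<in>?A. \<forall>n<M. YW (l (a ! 0) (c ! 0) 0) w n \<in> hpow sclW k"
    by (rule laurent_h_uniform[OF finite_lists_2]) (rule YW_laurent)
  then obtain M' where M': "\<And>c n. c \<in> ?A \<Longrightarrow> n < M' \<Longrightarrow> YW (l (a ! 0) (c ! 0) 0) w n \<in> hpow sclW k"
    by blast
  define X' where "X' = (\<lambda>q p. \<Sum>c\<in>?A. \<Sum>j<k. fps_nth (entry (h_negate Rb) c b) j *
      diff_pow M' j (\<lambda>n m. f (sclW (fps_X ^ j) (?Z' a c m n))) q p)"
  have lower': "\<exists>M. \<forall>m n. m < M \<longrightarrow> ?Z' a c m n \<in> hpow sclW k'" for c k'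
  proof -
    obtain m0 where "\<And>n. n \<le> m0 \<Longrightarrow> YW (l (a ! 0) (c ! 0) 0) w n \<in> hpow sclW k'"
      using YW_laurent unfolding laurent_h_def by blast
    then show ?thesis by (intro exI[of _ m0] allI impI) (rule module_hom_hpow[OF YW_hom_right], simp)
  qed
  have fX': "f (rmult sclW 2 (\<lambda>a b e. ?Z' a b (e 0) (e 1))
      (leg Rb [(-1, 1), (1, 0)] 0 1) a b (expo_of [p, q])) = X' q p" for p q
  proof -
    have "f (rmult sclW 2 (\<lambda>a b e. ?Z' a b (e 0) (e 1))
        (leg Rb [(- 1, 1), (- (- 1), 0)] 0 1) a b (expo_of [p, q])) =
      (\<Sum>c\<in>?A. \<Sum>j<k. (- 1) ^ j * fps_nth (entry Rb c b) j *
        diff_pow M' j (\<lambda>n m. f (sclW (fps_X ^ j) (?Z' a c m n))) q p)"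
    proof (rule hfunctional_rmult_10[OF tfW f, where Z = ?Z'])
      show "\<exists>M. \<forall>m n. m < M \<longrightarrow> ?Z' a c m n \<in> hpow sclW k'" for c k' by (rule lower')
      show "?Z' a c m n \<in> hpow sclW k" if "length c = 2" "m < M'" for c m n
        by (rule module_hom_hpow[OF YW_hom_right], rule M') (use that in simp_all)
    qed simp
    then show ?thesis by (simp only: X'_def entry_h_negate minus_minus)
  qed
  have "\<exists>r. (mult_by_sum ^^ r) (subst_sum M' X') = (mult_by_sum ^^ r) (\<lambda>q p. \<Sum>c\<in>?A. \<Sum>j<k.
      fps_nth (entry (h_negate Rb) c b) j *
      f (sclW (fps_X ^ j) (YW (Y (l (a ! 1) (c ! 1) 0) (l (a ! 0) (c ! 0) 0) (q + int j)) w p)))"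
    (is "\<exists>r. ?eq r")
    unfolding X'_def by (rule weak_associativity_combination[OF finite_lists_2 f]) (rule M')
  then obtain r' where "?eq r'" by (elim exE)
  moreover have "(\<Sum>c\<in>?A. \<Sum>j<k. fps_nth (entry (h_negate Rb) c b) j *
      f (sclW (fps_X ^ j) (YW (Y (l (a ! 1) (c ! 1) 0) (l (a ! 0) (c ! 0) 0) (q + int j)) w p))) =
    f (YW (l (a ! 0) (b ! 0) 0 * l_plus l (a ! 1) (b ! 1) q) w p)" for p q
    unfolding vertex_generator commute by (rule L_on_generator_R[OF hfunctional_YW[OF f] a b])
  ultimately have r': "(mult_by_sum ^^ r') (subst_sum M' X') =
      (mult_by_sum ^^ r') (\<lambda>q p. f (YW (l (a ! 0) (b ! 0) 0 * l_plus l (a ! 1) (b ! 1) q) w p))"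
    by simp
  have XM': "X' q p = 0" if "p < M'" for p q using that by (simp add: X'_def diff_pow_vanish)
  have neg': "f (YW (l (a ! 0) (b ! 0) 0 * l_plus l (a ! 1) (b ! 1) q) w p) = 0" if "q < 0" for p q
    using that by (simp add: l_plus_neg hfunctional_simps(3)[OF hfunctional_YW[OF f]])
  have expandX'0: "X' p q = 0" if "p < - int r'" for p q
    by (rule expansion_around_diagonal(1)[OF XM' neg' r' that])
  have expandX': "f (YW (l (a ! 0) (b ! 0) 0 * l_plus l (a ! 1) (b ! 1) (int n)) w q) =
      (\<Sum>m\<in>{- int r'..int n + q - M'}. (of_int m gchoose n) * X' m (int n + q - m))" for n q
    by (rule expansion_around_diagonal(2)[OF XM' neg' r'])

  have "X p q = X' q p"
  proof (rule equal_by_expansion_around_diagonal[where X = X and Y = "\<lambda>p q. X' q p" and \<psi> = \<psi>])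
    show "\<psi> n 0 q = (\<Sum>m\<in>{- int r..int n + q - M}. (of_int m gchoose n) * X m (int n + q - m))" for n q
      using expandX[of n q] by (simp add: \<psi>_def l_plus_nat)
    show "\<psi> 0 n q = (\<Sum>m\<in>{- int r'..int n + q - M'}. (of_int m gchoose n) * X' m (int n + q - m))" for n q
      using expandX'[of n q] by (simp add: \<psi>_def l_plus_nat)
    show "\<psi> 0 n q = (\<Sum>a\<le>n. (- 1) ^ a * (of_int (int n + q - int a) gchoose (n - a)) *
        \<psi> a 0 (int n + q - int a))" for n q
      by (rule translation_recurrence) (unfold \<psi>_def, rule translation[OF f a b])
  qed (use XM XM' expandX0 expandX'0 in auto)
  then show "f (lmult sclW 2 (leg Rb [(1, 0), (-1, 1)] 0 1)
      (\<lambda>a b e. ?Z a b (e 0) (e 1)) a b (expo_of [p, q])) =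
    f (rmult sclW 2 (\<lambda>a b e. ?Z' a b (e 0) (e 1))
      (leg Rb [(-1, 1), (1, 0)] 0 1) a b (expo_of [p, q]))"
    by (simp only: fX fX')
qed

end

theorem proposition5p3:
  fixes Rb :: "'n::finite rmatrix"
    and V :: "('v::ring_1, 't::ab_group_add) qva_data"
    and l :: "'n \<Rightarrow> 'n \<Rightarrow> nat \<Rightarrow> 'v"
    and sclW :: "complex fps \<Rightarrow> 'w::ab_group_add \<Rightarrow> 'w"
    and YW :: "'v \<Rightarrow> 'w \<Rightarrow> int \<Rightarrow> 'w"
    and L :: "'n \<Rightarrow> 'n \<Rightarrow> int \<Rightarrow> 'w \<Rightarrow> 'w"
  assumes "CARD('n) \<ge> 2"
    and "Rb = R_plus \<or> Rb = R_minus"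
    and "is_V_Rbar Rb V l"
    and "qva_module V sclW YW"
    and "\<And>i j m w. L i j m w = YW (l i j 0) w m"
  shows "(\<forall>i j. operator_series sclW sclW (L i j)) \<and> RLL_relation Rb sclW L"
proof -
  obtain LV where "is_L_operator Rb (scale V) l LV" "is_vertex_map Rb (scale V) l LV (vertex V)"
    using assms(3) unfolding is_V_Rbar_def by blast
  moreover have "is_A_Rbar Rb (scale V) l" "vacuum V = 1"
    using assms(3) by (simp_all add: is_V_Rbar_def)
  ultimately interpret Rbar_module Rb "scale V" l LV "vertex V" sclW YW
    using assms(2,4) by unfold_locales (simp_all add: qva_module_def)
  have L: "L i j m = (\<lambda>w. YW (l i j 0) w m)" for i j m
    by (rule ext) (rule assms(5))
  have "operator_series sclW sclW (L i j)" for i j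
    unfolding operator_series_def L using YW_hom_right YW_laurent by auto
  moreover have "RLL_relation Rb sclW L"
    unfolding RLL_relation_def L by (intro allI impI RLL_coefficients)
  ultimately show ?thesis by blast
qed

end
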